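(* Let $f:\mathbb{R}^n\to\mathbb{R}$ be a function with Lipschitz continuous gradient, i.e. there is a constant $L>0$ with $\|\nabla f(y_1)-\nabla f(y_2)\|\le L\|y_1-y_2\|$ for all $y_1,y_2\in\mathbb{R}^n$, and let $l\in\mathbb{R}$ be such that $f+\frac{l}{2}\|\cdot\|^2$ is convex. Let $g:\mathbb{R}^n\to(-\infty,\infty]$ be a proper closed function such that for every $x\in\mathbb{R}^n$ and $\gamma>0$ the set $\arg\min_{y}\{g(y)+\frac{1}{2\gamma}\|y-x\|^2\}$ is nonempty. Suppose that $0<\alpha\le2$ and that the step-size parameter $\gamma>0$ is chosen so that $$\frac{4-\alpha}{2}(1+\gamma L)^2+\frac{9-2\alpha}{2}\gamma l-\frac{1+\alpha}{2}<0.$$ Suppose additionally that the functions $f$ and $g$ are semi-algebraic. If a sequence $\{(u^t,v^t,x^t)\}$ generated by the parameterized Douglas-Rachford iteration with parameters $\alpha,\gamma$ (from an arbitrary initial point $x^0\in\mathbb{R}^n$) has a cluster point, then the whole sequence $\{(u^t,v^t,x^t)\}$ is convergent.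
   Context: $\|\cdot\|$ is the Euclidean norm on $\mathbb{R}^n$. A function with values in $(-\infty,\infty]$ is proper if its domain (the set where it is finite) is nonempty, and closed if it is proper and lower semicontinuous. A set $S\subseteq\mathbb{R}^n$ is semi-algebraic if it is a finite union of sets of the form $\{x\in\mathbb{R}^n: h_1(x)=\cdots=h_k(x)=0,\ g_1(x)<0,\dots,g_m(x)<0\}$ with $h_i,g_j$ real polynomials. A function $F$ on $\mathbb{R}^n$ is semi-algebraic if its graph $\{(x,F(x))\in\mathbb{R}^{n+1}\}$ is semi-algebraic (for an extended-real-valued $F$, the graph is taken over the points where $F$ is finite). Parameterized Douglas-Rachford iteration: given $x^0\in\mathbb{R}^n$, for $t=0,1,2,\dots$, $$u^{t+1}\in\arg\min_u\Big\{f(u)+\tfrac{1}{2\gamma}\|u-x^t\|^2\Big\},\quad v^{t+1}\in\arg\min_v\Big\{g(v)+\tfrac{1}{2\gamma}\|v-\alpha u^{t+1}+x^t\|^2\Big\},\quad x^{t+1}=x^t+(v^{t+1}-u^{t+1}).$$ *)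

theory Defs
  imports "HOL-Analysis.Analysis"
begin

text \<open>The space R^(n+1) containing the graph of a function on R^n is rendered as the
  product of the domain with the reals; on such finite-dimensional spaces
  \<^const>\<open>real_polynomial_function\<close> describes exactly the polynomials in the coordinates.\<close>

definition basic_semialgebraic :: "'a::euclidean_space set \<Rightarrow> bool" where
  "basic_semialgebraic S \<longleftrightarrow>
     (\<exists>H G. finite H \<and> finite G \<and>
        (\<forall>h\<in>H. real_polynomial_function h) \<and> (\<forall>p\<in>G. real_polynomial_function p) \<and>
        S = {x. (\<forall>h\<in>H. h x = 0) \<and> (\<forall>p\<in>G. p x < 0)})"

definition semialgebraic :: "'a::euclidean_space set \<Rightarrow> bool" where
  "semialgebraic S \<longleftrightarrow> (\<exists>\<S>. finite \<S> \<and> (\<forall>B\<in>\<S>. basic_semialgebraic B) \<and> S = \<Union>\<S>)"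

text \<open>Only the points where the function is finite contribute to the graph.\<close>

definition semialgebraic_fun :: "('a::euclidean_space \<Rightarrow> ereal) \<Rightarrow> bool" where
  "semialgebraic_fun F \<longleftrightarrow> semialgebraic {(x, r::real). F x = ereal r}"

text \<open>Properness of a function with values in (-\<infinity>,\<infinity>]; the exclusion of -\<infinity>
  is part of the definition because \<^typ>\<open>ereal\<close> contains that value.\<close>

definition proper_fun :: "('a \<Rightarrow> ereal) \<Rightarrow> bool" where
  "proper_fun F \<longleftrightarrow> (\<forall>x. F x \<noteq> -\<infinity>) \<and> (\<exists>x. F x \<noteq> \<infinity>)"

definition lower_semicont :: "('a::topological_space \<Rightarrow> ereal) \<Rightarrow> bool" where
  "lower_semicont F \<longleftrightarrow> (\<forall>x. F x \<le> Liminf (at x) F)"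

definition closed_fun :: "('a::topological_space \<Rightarrow> ereal) \<Rightarrow> bool" where
  "closed_fun F \<longleftrightarrow> proper_fun F \<and> lower_semicont F"

definition argmin_set :: "('a \<Rightarrow> 'b::ord) \<Rightarrow> 'a set" where
  "argmin_set F = {x. is_arg_min F (\<lambda>_. True) x}"

text \<open>The iteration does not determine \<open>u 0\<close> and \<open>v 0\<close>; they are left arbitrary.\<close>

definition param_DR_iteration ::
  "('a::real_normed_vector \<Rightarrow> real) \<Rightarrow> ('a \<Rightarrow> ereal) \<Rightarrow> real \<Rightarrow> real \<Rightarrow>
   (nat \<Rightarrow> 'a) \<Rightarrow> (nat \<Rightarrow> 'a) \<Rightarrow> (nat \<Rightarrow> 'a) \<Rightarrow> bool" where
  "param_DR_iteration f g \<alpha> \<gamma> u v x \<longleftrightarrow>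
     (\<forall>t. u (Suc t) \<in> argmin_set (\<lambda>w. f w + 1 / (2 * \<gamma>) * (norm (w - x t))\<^sup>2) \<and>
          v (Suc t) \<in> argmin_set
            (\<lambda>w. g w + ereal (1 / (2 * \<gamma>) * (norm (w - \<alpha> *\<^sub>R u (Suc t) + x t))\<^sup>2)) \<and>
          x (Suc t) = x t + (v (Suc t) - u (Suc t)))"

definition cluster_point :: "(nat \<Rightarrow> 'a::topological_space) \<Rightarrow> 'a \<Rightarrow> bool" where
  "cluster_point X z \<longleftrightarrow> (\<exists>r::nat \<Rightarrow> nat. strict_mono r \<and> (X \<circ> r) \<longlonglongrightarrow> z)"

end

theory Submission
  imports Defs
begin

text \<open>The merit function \<open>merit (u, v, x)\<close> decreases along the iteration by a multiple of
  \<open>|u\<^bsub>t+2\<^esub> - u\<^bsub>t+1\<^esub>|\<^sup>2\<close>, and at every iterate it has a proximal subgradient bounded by a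
  multiple of \<open>|v - u|\<close>, which in turn is at most a multiple of \<open>|u\<^bsub>t+2\<^esub> - u\<^bsub>t+1\<^esub>|\<close>. Hence a
  Kurdyka--Lojasiewicz inequality on the set of proximal points makes the lengths of the steps
  telescope near the cluster point.

  The inequality is obtained from semialgebraicity by Kurdyka's curve argument, in a form without
  derivatives. Quantifier elimination and the existence of lexicographic minima on compact level
  sets give a semialgebraic curve \<open>w\<close> with \<open>F (w r) = r\<close> along which the slope is minimal. Near \<open>0\<close>
  its coordinates are monotone and continuous, so it has finite length, and the length between two
  levels bounds the drop of \<open>F\<close> divided by the slope.

  Quantifier elimination for one variable is by induction on the degree: the roots of a family of
  polynomials are covered by finitely many functions \<open>z\<close> of the parameters, each of them the least
  root above a root of the derivative. The sign of a further polynomial at \<open>z\<close> is decided by reducing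
  it modulo the given one and comparing \<open>z\<close> with the roots of the remainder.\<close>

subsection \<open>Polynomial sign conditions and tame functions\<close>

text \<open>The function \<open>g\<close> is merely lower semicontinuous, so \<open>merit\<close> is
  neither continuous nor open to a gradient calculus on the whole space. On \<open>Prox\<close> both
  defects vanish. Minimality of \<open>v\<close> bounds \<open>g\<close> from above along a
  sequence, which gives continuity and compact level sets in a ball; and it yields the inequality
  \<open>F P - F Q <= b * slope P * |P - Q| + C * |P - Q|^2\<close> that stands for a subgradient.
  Along a continuous curve of points the quadratic term disappears under subdivision, so the slope
  along the curve can be used without a differentiable parametrisation. Quantifier elimination works
  with environments \<open>nat => real\<close> because the number of variables changes at each
  quantifier, whereas a Euclidean space carries its dimension in its type. Predicates are handled
  semantically: quantifier elimination is a closure property of \<open>qf\<close>, and no syntax of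
  formulas occurs. What complicates the induction on the degree is that a leading coefficient may
  vanish for some parameters; hence degree bounds instead of degrees, and a separate truncated
  family.\<close>

inductive pol :: "((nat \<Rightarrow> real) \<Rightarrow> real) \<Rightarrow> bool" where
  pol_const: "pol (\<lambda>e. c)"
| pol_var: "pol (\<lambda>e. e i)"
| pol_add: "pol p \<Longrightarrow> pol q \<Longrightarrow> pol (\<lambda>e. p e + q e)"
| pol_mult: "pol p \<Longrightarrow> pol q \<Longrightarrow> pol (\<lambda>e. p e * q e)"

lemma pol_uminus: "pol p \<Longrightarrow> pol (\<lambda>e. - p e)"
  using pol_mult[OF pol_const[of "-1"], of p] by simp

lemma pol_diff: "pol p \<Longrightarrow> pol q \<Longrightarrow> pol (\<lambda>e. p e - q e)"
  using pol_add[OF _ pol_uminus, of p q] by simp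

lemma pol_sum: "(\<And>i. i \<in> I \<Longrightarrow> pol (p i)) \<Longrightarrow> pol (\<lambda>e. \<Sum>i\<in>I. p i e)"
  by (induction I rule: infinite_finite_induct) (auto intro: pol_const pol_add)

lemma pol_power: "pol p \<Longrightarrow> pol (\<lambda>e. p e ^ n)"
  by (induction n) (auto intro: pol_const pol_mult)

lemmas pol_intros = pol_const pol_var pol_add pol_mult pol_uminus pol_diff pol_sum pol_power

lemma pol_subst: "pol p \<Longrightarrow> (\<And>i. pol (\<lambda>e. s e i)) \<Longrightarrow> pol (\<lambda>e. p (s e))"
  by (induction rule: pol.induct) (auto intro: pol_intros)

text \<open>One strict atom suffices: equality and the weak order are Boolean combinations of
  \<open>p e > 0\<close>.\<close>

inductive qf :: "((nat \<Rightarrow> real) \<Rightarrow> bool) \<Rightarrow> bool" where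
  qf_pos: "pol p \<Longrightarrow> qf (\<lambda>e. p e > 0)"
| qf_not: "qf A \<Longrightarrow> qf (\<lambda>e. \<not> A e)"
| qf_conj: "qf A \<Longrightarrow> qf B \<Longrightarrow> qf (\<lambda>e. A e \<and> B e)"

lemma qf_disj: "qf A \<Longrightarrow> qf B \<Longrightarrow> qf (\<lambda>e. A e \<or> B e)"
  using qf_not[OF qf_conj[OF qf_not qf_not], of A B] by simp

lemma qf_False: "qf (\<lambda>e. False)"
  using qf_pos[OF pol_const[of 0]] by simp

lemma qf_True: "qf (\<lambda>e. True)"
  using qf_not[OF qf_False] by simp

lemma qf_less: "pol p \<Longrightarrow> pol q \<Longrightarrow> qf (\<lambda>e. p e < q e)"
  using qf_pos[OF pol_diff, of q p] by simp

lemma qf_eq: "pol p \<Longrightarrow> pol q \<Longrightarrow> qf (\<lambda>e. p e = q e)"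
  using qf_conj[OF qf_not[OF qf_less] qf_not[OF qf_less], of p q q p]
  by (simp add: linorder_not_less order_eq_iff conj_commute)

lemma qf_Bex: "finite I \<Longrightarrow> (\<And>i. i \<in> I \<Longrightarrow> qf (A i)) \<Longrightarrow> qf (\<lambda>e. \<exists>i\<in>I. A i e)"
  by (induction I rule: finite_induct) (auto intro: qf_False qf_disj)

lemma qf_Ball: "finite I \<Longrightarrow> (\<And>i. i \<in> I \<Longrightarrow> qf (A i)) \<Longrightarrow> qf (\<lambda>e. \<forall>i\<in>I. A i e)"
  by (induction I rule: finite_induct) (auto intro: qf_True qf_conj)

lemma qf_subst: "qf A \<Longrightarrow> (\<And>i. pol (\<lambda>e. s e i)) \<Longrightarrow> qf (\<lambda>e. A (s e))"
proof (induction rule: qf.induct)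
  case (qf_pos p)
  show ?case by (rule qf.qf_pos[OF pol_subst[OF qf_pos(1)]]) (rule qf_pos(2))
next
  case (qf_not A)
  show ?case by (rule qf.qf_not[OF qf_not(2)]) (rule qf_not(3))
next
  case (qf_conj A B)
  show ?case by (rule qf.qf_conj[OF qf_conj(3,4)]) (rule qf_conj(5))+
qed

section \<open>Univariate polynomials depending on parameters\<close>

text \<open>The main variable is split off from the parameters \<open>e\<close>. The number
  \<open>d\<close> bounds the degree uniformly in \<open>e\<close> and need not be attained:
  \<open>coeff (P e) d\<close> may vanish for some parameters.\<close>

definition pfam :: "((nat \<Rightarrow> real) \<Rightarrow> real poly) \<Rightarrow> nat \<Rightarrow> bool" where
  "pfam P d \<longleftrightarrow> (\<forall>e. degree (P e) \<le> d) \<and> (\<forall>k. pol (\<lambda>e. coeff (P e) k))"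

lemma pfam_subst: "pfam P d \<Longrightarrow> (\<And>i. pol (\<lambda>e. s e i)) \<Longrightarrow> pfam (\<lambda>e. P (s e)) d"
  unfolding pfam_def by (auto intro: pol_subst)

lemma poly_sum_le: "degree p \<le> d \<Longrightarrow> poly p x = (\<Sum>i\<le>d. coeff p i * x ^ i)"
  for p :: "real poly"
  unfolding poly_altdef by (rule sum.mono_neutral_left) (auto simp: coeff_eq_0)

lemma pol_poly: "pfam P d \<Longrightarrow> pol y \<Longrightarrow> pol (\<lambda>e. poly (P e) (y e))"
  unfolding pfam_def by (subst poly_sum_le) (auto intro!: pol_sum pol_mult pol_power)

lemma pfam_add: "pfam P d \<Longrightarrow> pfam Q d \<Longrightarrow> pfam (\<lambda>e. P e + Q e) d"
  unfolding pfam_def by (auto intro: pol_intros degree_add_le)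

lemma pfam_diff: "pfam P d \<Longrightarrow> pfam Q d \<Longrightarrow> pfam (\<lambda>e. P e - Q e) d"
  unfolding pfam_def by (auto intro: pol_intros degree_diff_le)

lemma pfam_mult: "pfam P d \<Longrightarrow> pfam Q d' \<Longrightarrow> pfam (\<lambda>e. P e * Q e) (d + d')"
  unfolding pfam_def coeff_mult
  by (auto intro!: pol_sum pol_mult) (meson add_mono degree_mult_le order.trans)

lemma pfam_mono: "pfam P d \<Longrightarrow> d \<le> d' \<Longrightarrow> pfam P d'"
  unfolding pfam_def by (meson order.trans)

lemma pfam_monom: assumes "pol c" shows "pfam (\<lambda>e. monom (c e) n) n"
  unfolding pfam_def
proof (intro conjI allI)
  fix k show "pol (\<lambda>e. coeff (monom (c e) n) k)"
    using assms pol_const by (cases "n = k") simp_all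
qed (rule degree_monom_le)

lemma pfam_pderiv: assumes "pfam P (Suc d)" shows "pfam (\<lambda>e. pderiv (P e)) d"
  unfolding pfam_def
proof (intro conjI allI)
  fix e show "degree (pderiv (P e)) \<le> d"
    using assms unfolding pfam_def degree_pderiv by (simp add: le_diff_conv)
next
  fix k show "pol (\<lambda>e. coeff (pderiv (P e)) k)"
    unfolding coeff_pderiv using assms by (intro pol_mult pol_const) (simp add: pfam_def)
qed

lemma pfam_of_pol:
  assumes "pol p" shows "\<exists>Q D. pfam Q D \<and> (\<forall>e y. p (case_nat y e) = poly (Q e) y)"
  using assms
proof (induction rule: pol.induct)
  case (pol_const c)
  show ?case
    by (rule exI[of _ "\<lambda>e. monom c 0"]) (auto intro!: exI[of _ 0] pfam_monom pol.intros simp: poly_monom)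
next
  case (pol_var i)
  show ?case
  proof (cases i)
    case 0
    then show ?thesis
      by (intro exI[of _ "\<lambda>e. monom 1 1"] exI[of _ 1])
        (auto intro!: pfam_monom pol.intros simp: poly_monom)
  next
    case (Suc j)
    then show ?thesis
      by (intro exI[of _ "\<lambda>e. monom (e j) 0"] exI[of _ 0])
        (auto intro!: pfam_monom pol.intros simp: poly_monom)
  qed
next
  case (pol_add p q)
  then obtain P d Q d' where *: "pfam P d" "pfam Q d'"
    "\<And>e y. p (case_nat y e) = poly (P e) y" "\<And>e y. q (case_nat y e) = poly (Q e) y"
    by blast
  have "pfam (\<lambda>e. P e + Q e) (max d d')"
    by (intro pfam_add) (auto intro: pfam_mono[OF *(1)] pfam_mono[OF *(2)])
  with * show ?case by (intro exI[of _ "\<lambda>e. P e + Q e"] exI conjI) auto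
next
  case (pol_mult p q)
  then obtain P d Q d' where *: "pfam P d" "pfam Q d'"
    "\<And>e y. p (case_nat y e) = poly (P e) y" "\<And>e y. q (case_nat y e) = poly (Q e) y"
    by blast
  with pfam_mult[OF *(1,2)] show ?case by (intro exI[of _ "\<lambda>e. P e * Q e"] exI conjI) auto
qed

text \<open>The base change \<open>s\<close> makes room for a fresh variable in the environment, which is what
  allows two tame functions to be substituted simultaneously.\<close>

definition tame :: "((nat \<Rightarrow> real) \<Rightarrow> real) \<Rightarrow> bool" where
  "tame z \<longleftrightarrow> (\<forall>s Q D. (\<forall>i. pol (\<lambda>e. s e i)) \<longrightarrow> pfam Q D \<longrightarrow> qf (\<lambda>e. poly (Q e) (z (s e)) > 0))"

lemma tame_poly: "tame z \<Longrightarrow> pfam Q D \<Longrightarrow> qf (\<lambda>e. poly (Q e) (z e) > 0)"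
  unfolding tame_def using pol_var by fastforce

lemma tame_base: "tame z \<Longrightarrow> (\<And>i. pol (\<lambda>e. s e i)) \<Longrightarrow> tame (\<lambda>e. z (s e))"
  unfolding tame_def
proof (intro allI impI)
  fix s' :: "(nat \<Rightarrow> real) \<Rightarrow> nat \<Rightarrow> real" and Q D
  assume 1: "\<forall>s Q D. (\<forall>i. pol (\<lambda>e. s e i)) \<longrightarrow> pfam Q D \<longrightarrow> qf (\<lambda>e. poly (Q e) (z (s e)) > 0)"
    and 2: "\<And>i. pol (\<lambda>e. s e i)" and 3: "\<forall>i. pol (\<lambda>e. s' e i)" and 4: "pfam Q D"
  have "\<forall>i. pol (\<lambda>e. s (s' e) i)"
    using pol_subst[OF 2, of s'] 3 by blast
  with 1[rule_format, of "\<lambda>e. s (s' e)" Q D] 4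
  show "qf (\<lambda>e. poly (Q e) (z (s (s' e))) > 0)" by simp
qed

lemma tame_subst1: "qf A \<Longrightarrow> tame z \<Longrightarrow> qf (\<lambda>e. A (case_nat (z e) e))"
proof (induction rule: qf.induct)
  case (qf_pos p)
  then obtain Q D where "pfam Q D" "\<And>e y. p (case_nat y e) = poly (Q e) y"
    using pfam_of_pol by blast
  then show ?case using tame_poly[OF qf_pos(2), of Q D] by simp
next
  case (qf_not A)
  show ?case by (rule qf.qf_not[OF qf_not(2)[OF qf_not(3)]])
next
  case (qf_conj A B)
  show ?case by (rule qf.qf_conj[OF qf_conj(3)[OF qf_conj(5)] qf_conj(4)[OF qf_conj(5)]])
qed

lemma tame_subst2:
  assumes "qf A" "tame y" "tame z"
  shows "qf (\<lambda>e. A (case_nat (y e) (case_nat (z e) e)))"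
proof -
  \<comment> \<open>\<open>y\<close> is read in the environment without its first entry, the slot
    that \<open>z\<close> fills in the second substitution.\<close>
  have "qf (\<lambda>e. A (case_nat (y (\<lambda>i. e (Suc i))) e))"
    by (rule tame_subst1[OF assms(1) tame_base[OF assms(2)]]) (rule pol_var)
  from tame_subst1[OF this assms(3)] show ?thesis by simp
qed

lemma pol_case_nat: "pol y \<Longrightarrow> (\<And>i. pol (\<lambda>e. s e i)) \<Longrightarrow> pol (\<lambda>e. case_nat (y e) (s e) i)"
  by (cases i) auto

lemma tame_pol2:
  assumes "pol p" "tame y" "tame z"
  shows "tame (\<lambda>e. p (case_nat (y e) (case_nat (z e) e)))"
  unfolding tame_def
proof (intro allI impI)
  fix s :: "(nat \<Rightarrow> real) \<Rightarrow> nat \<Rightarrow> real" and Q D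
  assume s: "\<forall>i. pol (\<lambda>e. s e i)" and Q: "pfam Q D"
  \<comment> \<open>Entries 0 and 1 hold the values of \<open>y\<close> and \<open>z\<close>; the
    parameters start at entry 2.\<close>
  define A where "A e = (poly (Q (\<lambda>i. e (Suc (Suc i))))
    (p (case_nat (e 0) (case_nat (e 1) (s (\<lambda>i. e (Suc (Suc i))))))) > 0)" for e
  have "pol (\<lambda>e. s (\<lambda>i. e (Suc (Suc i))) i)" for i
    using pol_subst[OF s[rule_format], of "\<lambda>e i. e (Suc (Suc i))"] pol_var by blast
  then have "pol (\<lambda>e. case_nat (e 0) (case_nat (e 1) (s (\<lambda>i. e (Suc (Suc i))))) i)" for i
    by (rule pol_case_nat[OF pol_var[of 0] pol_case_nat[OF pol_var[of 1]]])
  moreover have "pfam (\<lambda>e. Q (\<lambda>i. e (Suc (Suc i)))) D"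
    by (rule pfam_subst[OF Q pol_var])
  ultimately have "qf A" unfolding A_def
    by (intro qf_pos pol_poly pol_subst[OF assms(1)])
  from tame_subst2[OF this tame_base[OF assms(2), of s] tame_base[OF assms(3), of s]] s
  show "qf (\<lambda>e. poly (Q e) (p (case_nat (y (s e)) (case_nat (z (s e)) (s e)))) > 0)"
    unfolding A_def by simp
qed

lemma tame_pol: assumes "pol p" shows "tame p"
  unfolding tame_def
proof (intro allI impI)
  fix s :: "(nat \<Rightarrow> real) \<Rightarrow> nat \<Rightarrow> real" and Q D
  assume s: "\<forall>i. pol (\<lambda>e. s e i)" and Q: "pfam Q D"
  have "pol (\<lambda>e. p (s e))"
    by (rule pol_subst[OF assms]) (rule s[rule_format])
  then show "qf (\<lambda>e. poly (Q e) (p (s e)) > 0)"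
    by (rule qf_pos[OF pol_poly[OF Q]])
qed

lemma tame_add: "tame y \<Longrightarrow> tame z \<Longrightarrow> tame (\<lambda>e. y e + z e)"
  using tame_pol2[OF pol_add[OF pol_var[of 0] pol_var[of 1]], of y z] by simp

lemma tame_mult: "tame y \<Longrightarrow> tame z \<Longrightarrow> tame (\<lambda>e. y e * z e)"
  using tame_pol2[OF pol_mult[OF pol_var[of 0] pol_var[of 1]], of y z] by simp

lemma tame_const: "tame (\<lambda>e. c)" by (rule tame_pol[OF pol_const])

lemma tame_midpoint: "tame y \<Longrightarrow> tame z \<Longrightarrow> tame (\<lambda>e. (y e + z e) / 2)"
  using tame_mult[OF tame_add tame_const[of "1/2"], of y z] by simp

lemma tame_less: "tame y \<Longrightarrow> tame z \<Longrightarrow> qf (\<lambda>e. y e < z e)"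
  using tame_subst2[OF qf_less[OF pol_var[of 0] pol_var[of 1]], of y z] by simp

lemma tame_poly_neg: "tame z \<Longrightarrow> pfam Q D \<Longrightarrow> qf (\<lambda>e. poly (Q e) (z e) < 0)"
  using tame_poly[of z "\<lambda>e. 0 - Q e" D] pfam_diff[of "\<lambda>e. 0" D Q]
  by (auto simp: pfam_def pol_const)

lemma tame_poly_eq: "tame z \<Longrightarrow> pfam Q D \<Longrightarrow> qf (\<lambda>e. poly (Q e) (z e) = 0)"
  using qf_conj[OF qf_not[OF tame_poly] qf_not[OF tame_poly_neg], of z Q D z Q D]
  by (simp add: linorder_not_less order_eq_iff)

lemma tame_inverse: assumes "pol q" shows "tame (\<lambda>e. 1 / q e)"
  unfolding tame_def
proof (intro allI impI)
  fix s :: "(nat \<Rightarrow> real) \<Rightarrow> nat \<Rightarrow> real" and Q D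
  assume s: "\<forall>i. pol (\<lambda>e. s e i)" and Q: "pfam Q D"
  let ?q = "\<lambda>e. q (s e)"
  have q: "pol ?q" by (rule pol_subst[OF assms]) (rule s[rule_format])
  \<comment> \<open>The even exponent \<open>2 * D\<close> makes the cleared factor positive, so the
    sign survives. Where \<open>q\<close> vanishes, division by zero gives 0 and the case is treated
    apart.\<close>
  define R where "R e = (\<Sum>k\<le>D. coeff (Q e) k * ?q e ^ (2 * D - k))" for e
  have "pol (\<lambda>e. coeff (Q e) k)" for k using Q by (simp add: pfam_def)
  then have R: "pol R" unfolding R_def by (intro pol_sum pol_mult pol_power q)
  have *: "R e = ?q e ^ (2 * D) * poly (Q e) (1 / ?q e)" if "?q e \<noteq> 0" for e
  proof -
    have k: "?q e ^ (2 * D - k) = ?q e ^ (2 * D) * (1 / ?q e) ^ k" if "k \<le> D" for k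
      using power_diff[OF \<open>?q e \<noteq> 0\<close>, of k "2 * D"] that by (simp add: divide_inverse power_inverse)
    have "degree (Q e) \<le> D" using Q by (auto simp: pfam_def)
    then show ?thesis unfolding R_def sum_distrib_left poly_sum_le[OF \<open>degree (Q e) \<le> D\<close>]
      by (intro sum.cong refl) (simp add: k mult.left_commute)
  qed
  have eq: "(poly (Q e) (1 / ?q e) > 0) \<longleftrightarrow>
      (?q e = 0 \<and> poly (Q e) 0 > 0) \<or> (\<not> ?q e = 0 \<and> R e > 0)" for e
  proof (cases "?q e = 0")
    case False
    then have "?q e ^ (2 * D) > 0" by (simp add: power_mult)
    with False * show ?thesis by (simp add: zero_less_mult_iff)
  qed simp
  show "qf (\<lambda>e. poly (Q e) (1 / q (s e)) > 0)" unfolding eq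
    by (rule qf_disj[OF qf_conj[OF qf_eq[OF q pol_const] qf_pos[OF pol_poly[OF Q pol_const]]]
        qf_conj[OF qf_not[OF qf_eq[OF q pol_const]] qf_pos[OF R]]])
qed

subsection \<open>Quantifier elimination\<close>

lemma degree_le_of_coeff_0:
  fixes p :: "real poly"
  assumes "degree p \<le> Suc d" "coeff p (Suc d) = 0" shows "degree p \<le> d"
  using assms by (metis coeff_0 degree_0 le_SucE le_zero_eq leading_coeff_0_iff nat_le_linear)

text \<open>Only signs at roots of \<open>P\<close> have to be kept, so multiples of
  \<open>P\<close> may be subtracted freely. Each round removes the top coefficient of
  \<open>Q\<close> without a division; where the leading coefficient of \<open>P\<close> vanishes
  nothing is claimed.\<close>

lemma pseudo_remainder:
  assumes P: "pfam P (Suc n)" and "pfam Q D"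
  shows "\<exists>R. pfam R n \<and> (\<forall>e y. coeff (P e) (Suc n) \<noteq> 0 \<longrightarrow> poly (P e) y = 0 \<longrightarrow>
            sgn (poly (R e) y) = sgn (poly (Q e) y))"
  using assms(2)
proof (induction D arbitrary: Q)
  case 0
  then show ?case by (intro exI[of _ Q]) (auto intro: pfam_mono)
next
  case (Suc D)
  show ?case
  proof (cases "Suc D \<le> n")
    case True
    then show ?thesis using Suc.prems by (intro exI[of _ Q]) (auto intro: pfam_mono)
  next
    case False
    let ?c = "\<lambda>e. coeff (P e) (Suc n)" and ?q = "\<lambda>e. coeff (Q e) (Suc D)"
    \<comment> \<open>The factor of \<open>Q\<close> is the square of the leading coefficient,
      positive wherever that is nonzero; the coefficient itself could flip the sign.\<close>
    define Q1 where "Q1 e = monom (?c e * ?c e) 0 * Q e - monom (?c e * ?q e) (D - n) * P e" for e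
    have c: "pol ?c" and q: "pol ?q" using P Suc.prems by (auto simp: pfam_def)
    have 1: "pfam Q1 (Suc D)"
      unfolding Q1_def
      using pfam_mult[OF pfam_monom[OF pol_mult[OF c c], of 0] Suc.prems]
        pfam_mult[OF pfam_monom[OF pol_mult[OF c q], of "D - n"] P] False
      by (intro pfam_diff) auto
    have "coeff (Q1 e) (Suc D) = 0" for e
      using False by (simp add: Q1_def coeff_monom_mult Suc_diff_le)
    then have "pfam Q1 D"
      using 1 degree_le_of_coeff_0 unfolding pfam_def by blast
    from Suc.IH[OF this] obtain R where R: "pfam R n"
      "\<And>e y. ?c e \<noteq> 0 \<Longrightarrow> poly (P e) y = 0 \<Longrightarrow> sgn (poly (R e) y) = sgn (poly (Q1 e) y)"
      by blast
    have "sgn (poly (Q1 e) y) = sgn (poly (Q e) y)" if "?c e \<noteq> 0" "poly (P e) y = 0" for e y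
      using that by (simp add: Q1_def poly_monom sgn_mult)
    with R show ?thesis by (intro exI[of _ R]) auto
  qed
qed

lemma poly_sgn_const:
  fixes p :: "real poly"
  assumes "\<And>x. min y t \<le> x \<Longrightarrow> x \<le> max y t \<Longrightarrow> poly p x \<noteq> 0"
  shows "sgn (poly p y) = sgn (poly p t)"
proof -
  have *: "sgn (poly p y) = sgn (poly p t)"
    if "y < t" "\<And>x. y \<le> x \<Longrightarrow> x \<le> t \<Longrightarrow> poly p x \<noteq> 0" for y t
  proof -
    have "\<not> poly p y * poly p t < 0"
      using poly_IVT[OF that(1)] that(2) by (meson less_imp_le)
    moreover have "poly p y \<noteq> 0" "poly p t \<noteq> 0" using that by auto
    ultimately show ?thesis by (simp add: sgn_if mult_less_0_iff) linarith
  qed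
  show ?thesis
  proof (cases y t rule: linorder_cases)
    case less
    show ?thesis by (rule *[OF less assms]) (use less in simp_all)
  next
    case greater
    show ?thesis by (rule *[OF greater assms, symmetric]) (use greater in simp_all)
  qed simp
qed

lemma finite_gap:
  fixes y :: real
  assumes "finite A" "a \<in> A" "a < y" "finite B" "b \<in> B" "y < b"
  obtains c c' where "c \<in> A" "c' \<in> B" "c < y" "y < c'"
    "\<And>x. x \<in> A \<Longrightarrow> c < x \<Longrightarrow> y \<le> x" "\<And>x. x \<in> B \<Longrightarrow> x < c' \<Longrightarrow> x \<le> y"
proof -
  let ?A = "{x\<in>A. x < y}" and ?B = "{x\<in>B. y < x}"
  have "finite ?A" "?A \<noteq> {}" "finite ?B" "?B \<noteq> {}" using assms by auto
  from Max_in[OF this(1,2)] Max_ge[OF this(1)] Min_in[OF this(3,4)] Min_le[OF this(3)]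
  show thesis by (intro that[of "Max ?A" "Min ?B"]) (auto simp: not_le[symmetric])
qed

text \<open>A polynomial is strictly monotone between neighbouring critical points, so a root that
  is not in \<open>H\<close> shows up as a sign change between its neighbours in \<open>H\<close>
  and the end points. The right side evaluates signs at finitely many points only, and
  \<open>H\<close> may contain points that are not critical.\<close>

lemma root_between_iff:
  fixes p :: "real poly"
  assumes H: "finite H" "\<And>y. poly (pderiv p) y = 0 \<Longrightarrow> y \<in> H"
  shows "(\<exists>y. a < y \<and> y < c \<and> poly p y = 0) \<longleftrightarrow>
    (\<exists>h\<in>H. a < h \<and> h < c \<and> poly p h = 0) \<or>
    (\<exists>h\<in>insert a H. \<exists>h'\<in>insert c H. \<not> h < a \<and> h < h' \<and> \<not> c < h' \<and>
       ((poly p h < 0 \<and> poly p h' > 0) \<or> (poly p h > 0 \<and> poly p h' < 0)))"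
    (is "?L \<longleftrightarrow> ?R1 \<or> ?R2")
proof
  assume ?L
  then obtain y where y: "a < y" "y < c" "poly p y = 0" by auto
  show "?R1 \<or> ?R2"
  proof (cases "y \<in> H")
    case True then show ?thesis using y by auto
  next
    case False
    obtain h h' where h: "h \<in> insert a H" "h' \<in> insert c H" "h < y" "y < h'"
      "\<And>x. x \<in> insert a H \<Longrightarrow> h < x \<Longrightarrow> y \<le> x" "\<And>x. x \<in> insert c H \<Longrightarrow> x < h' \<Longrightarrow> x \<le> y"
      using finite_gap[of "insert a H" a y "insert c H" c] H(1) y(1,2) by auto
    have ac: "\<not> h < a" "\<not> c < h'" using h(5)[of a] h(6)[of c] y by auto
    have nz: "poly (pderiv p) x \<noteq> 0" if "h < x" "x < h'" for x
      using h(5)[of x] h(6)[of x] that H(2)[of x] False by force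
    obtain s where s: "h < s" "s < y" "poly p y - poly p h = (y - h) * poly (pderiv p) s"
      using poly_MVT[OF h(3)] by blast
    obtain t where t: "y < t" "t < h'" "poly p h' - poly p y = (h' - y) * poly (pderiv p) t"
      using poly_MVT[OF h(4)] by blast
    have st: "sgn (poly (pderiv p) s) = sgn (poly (pderiv p) t)"
      using s t by (intro poly_sgn_const nz) auto
    have "(poly p h < 0 \<and> poly p h' > 0) \<or> (poly p h > 0 \<and> poly p h' < 0)"
    proof (cases "poly (pderiv p) s > 0")
      case True
      then have "poly (pderiv p) t > 0" using st by (simp add: sgn_if split: if_splits)
      then have "0 < (y - h) * poly (pderiv p) s" "0 < (h' - y) * poly (pderiv p) t"
        using True h(3,4) by simp_all
      then show ?thesis using s(3) t(3) y(3) by (intro disjI1 conjI) linarith+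
    next
      case False
      then have "poly (pderiv p) s < 0" using nz[of s] s t by force
      moreover from this have "poly (pderiv p) t < 0" using st by (simp add: sgn_if split: if_splits)
      ultimately have "(y - h) * poly (pderiv p) s < 0" "(h' - y) * poly (pderiv p) t < 0"
        using h(3,4) by (simp_all add: mult_pos_neg)
      then show ?thesis using s(3) t(3) y(3) by (intro disjI2 conjI) linarith+
    qed
    then have ?R2 using h ac by (meson order.strict_trans)
    then show ?thesis ..
  qed
next
  assume "?R1 \<or> ?R2"
  then show ?L
  proof
    assume ?R2
    then obtain h h' where h: "a \<le> h" "h < h'" "h' \<le> c"
      "(poly p h < 0 \<and> poly p h' > 0) \<or> (poly p h > 0 \<and> poly p h' < 0)" by (auto simp: not_less)
    then obtain y where "h < y" "y < h'" "poly p y = 0"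
      using poly_IVT_pos[of h h' p] poly_IVT_neg[of h h' p] by blast
    with h show ?L by (intro exI[of _ y]) auto
  qed auto
qed

section \<open>Roots as tame functions of the parameters\<close>

definition roots_in :: "real poly \<Rightarrow> real \<Rightarrow> real \<Rightarrow> real set" where
  "roots_in p a b = {y. a < y \<and> y < b \<and> poly p y = 0}"

lemma finite_roots_in: "p \<noteq> 0 \<Longrightarrow> finite (roots_in p a b)"
  unfolding roots_in_def by (rule finite_subset[OF _ poly_roots_finite]) auto

text \<open>The default 0 makes the function total while its sign questions stay within
  \<open>qf\<close>. The upper end \<open>b\<close> will be a bound for all roots.\<close>

definition least_root :: "nat \<Rightarrow> real poly \<Rightarrow> real \<Rightarrow> real \<Rightarrow> real" where
  "least_root n p a b =
     (if coeff p n \<noteq> 0 \<and> roots_in p a b \<noteq> {} then Min (roots_in p a b) else 0)"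

text \<open>The statement of the induction on the degree. A covering function may take values that
  are not roots, and parameters with \<open>P e = 0\<close>, where every point is a root, are left
  out.\<close>

definition roots_covered :: "nat \<Rightarrow> bool" where
  "roots_covered d \<longleftrightarrow> (\<forall>P. pfam P d \<longrightarrow> (\<exists>Z. finite Z \<and> (\<forall>z\<in>Z. tame z) \<and>
      (\<forall>e y. P e \<noteq> 0 \<longrightarrow> poly (P e) y = 0 \<longrightarrow> (\<exists>z\<in>Z. z e = y))))"

text \<open>\<open>N\<close> is one operator for all \<open>c\<close>, because the same question
  will be asked for many end points. It is \<open>root_between_iff\<close> evaluated at functions
  that cover the roots of the derivative.\<close>

lemma qf_root_between:
  assumes "pfam P (Suc n)" "roots_covered n" "tame a"
  shows "\<exists>N. (\<forall>c. tame c \<longrightarrow> qf (N c)) \<and>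
    (\<forall>c e. coeff (P e) (Suc n) \<noteq> 0 \<longrightarrow> (N c e \<longleftrightarrow> roots_in (P e) (a e) (c e) \<noteq> {}))"
proof -
  obtain H where H: "finite H" "\<And>z. z \<in> H \<Longrightarrow> tame z"
    "\<And>e y. pderiv (P e) \<noteq> 0 \<Longrightarrow> poly (pderiv (P e)) y = 0 \<Longrightarrow> \<exists>z\<in>H. z e = y"
    using assms(2)[unfolded roots_covered_def, rule_format, OF pfam_pderiv[OF assms(1)]] by metis
  define N where "N c e \<longleftrightarrow> (\<exists>h\<in>H. a e < h e \<and> h e < c e \<and> poly (P e) (h e) = 0) \<or>
    (\<exists>h\<in>insert a H. \<exists>h'\<in>insert c H. \<not> h e < a e \<and> h e < h' e \<and> \<not> c e < h' e \<and>
       ((poly (P e) (h e) < 0 \<and> poly (P e) (h' e) > 0) \<or> (poly (P e) (h e) > 0 \<and> poly (P e) (h' e) < 0)))"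
    for c e
  have "qf (N c)" if "tame c" for c
  proof -
    have t: "tame h" if "h \<in> insert c (insert a H)" for h
      using H(2) assms(3) \<open>tame c\<close> that by blast
    show ?thesis unfolding N_def
      by (intro qf_disj qf_Bex qf_conj qf_not finite.insertI H(1);
          rule tame_poly[OF _ assms(1)] tame_poly_neg[OF _ assms(1)] tame_poly_eq[OF _ assms(1)] tame_less;
          rule t; blast)
  qed
  moreover have "N c e \<longleftrightarrow> roots_in (P e) (a e) (c e) \<noteq> {}" if "coeff (P e) (Suc n) \<noteq> 0" for c e
  proof -
    have "degree (P e) \<noteq> 0" using that by (metis coeff_eq_0 nat.distinct(1) neq0_conv zero_less_Suc)
    then have "pderiv (P e) \<noteq> 0" by (simp add: pderiv_eq_0_iff)
    then have "\<exists>z\<in>H. z e = y" if "poly (pderiv (P e)) y = 0" for y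
      using H(3) that by blast
    then have *: "y \<in> (\<lambda>z. z e) ` H" if "poly (pderiv (P e)) y = 0" for y
      using that by blast
    show ?thesis
    proof -
      have "roots_in (P e) (a e) (c e) \<noteq> {} \<longleftrightarrow> (\<exists>y. a e < y \<and> y < c e \<and> poly (P e) y = 0)"
        by (auto simp: roots_in_def)
      also have "\<dots> \<longleftrightarrow> N c e"
        unfolding N_def using root_between_iff[OF finite_imageI[OF H(1), of "\<lambda>z. z e"], of "P e" "a e" "c e", OF *] by simp
      finally show ?thesis ..
    qed
  qed
  ultimately show ?thesis by blast
qed

text \<open>The remainder \<open>R\<close> of \<open>Q\<close> modulo \<open>P\<close> has the sign
  of \<open>Q\<close> at the least root, and its own roots are covered by \<open>cov\<close>. Since
  \<open>N\<close> compares the least root with any tame function, its neighbours among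
  \<open>a\<close>, \<open>b\<close> and the covering functions of \<open>R\<close> can be
  identified. If \<open>R\<close> is positive at the least root, it has no root between these
  neighbours, and its sign can be read at their midpoint.\<close>

lemma qf_poly_least_root:
  assumes P: "pfam P (Suc n)" and cov: "roots_covered n" and a: "tame a" and b: "tame b"
    and Q: "pfam Q D"
  shows "qf (\<lambda>e. poly (Q e) (least_root (Suc n) (P e) (a e) (b e)) > 0)"
proof -
  obtain N where N: "\<And>c. tame c \<Longrightarrow> qf (N c)"
    "\<And>c e. coeff (P e) (Suc n) \<noteq> 0 \<Longrightarrow> (N c e \<longleftrightarrow> roots_in (P e) (a e) (c e) \<noteq> {})"
    using qf_root_between[OF P cov a] by blast
  obtain R where R: "pfam R n" "\<And>e y. coeff (P e) (Suc n) \<noteq> 0 \<Longrightarrow> poly (P e) y = 0 \<Longrightarrow>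
            sgn (poly (R e) y) = sgn (poly (Q e) y)"
    using pseudo_remainder[OF P Q] by blast
  obtain Z where Z: "finite Z" "\<And>z. z \<in> Z \<Longrightarrow> tame z"
    "\<And>e y. R e \<noteq> 0 \<Longrightarrow> poly (R e) y = 0 \<Longrightarrow> \<exists>z\<in>Z. z e = y"
    using cov[unfolded roots_covered_def, rule_format, OF R(1)] by metis
  \<comment> \<open>No root in \<open>(a, c)\<close> and \<open>c\<close> no root above
    \<open>a\<close> together say that \<open>c\<close> lies strictly below the least root;
    \<open>N c'\<close> says that \<open>c'\<close> lies strictly above it.\<close>
  define T where "T e \<longleftrightarrow> (\<exists>c\<in>insert a Z. \<exists>c'\<in>insert b Z.
      (\<not> N c e \<and> \<not> (a e < c e \<and> poly (P e) (c e) = 0)) \<and> N c' e \<and>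
      (\<forall>r\<in>Z. \<not> (c e < r e \<and> r e < c' e \<and> poly (R e) (r e) = 0)) \<and>
      poly (R e) ((c e + c' e) / 2) > 0)" for e
  have "qf T"
  proof -
    have t: "tame h" if "h \<in> insert a (insert b Z)" for h
      using Z(2) a b that by blast
    show ?thesis unfolding T_def
      by (intro qf_Bex qf_Ball qf_conj qf_not finite.insertI Z(1);
          rule N(1) tame_poly[OF tame_midpoint R(1)] tame_poly_eq[OF _ P] tame_poly_eq[OF _ R(1)] tame_less;
          rule t; blast)
  qed
  have T: "poly (Q e) (Min (roots_in (P e) (a e) (b e))) > 0 \<longleftrightarrow> T e"
    if lc: "coeff (P e) (Suc n) \<noteq> 0" and ne: "roots_in (P e) (a e) (b e) \<noteq> {}" for e
  proof -
    let ?S = "roots_in (P e) (a e) (b e)"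
    let ?z = "Min ?S"
    have fin: "finite ?S" using lc by (intro finite_roots_in) auto
    have z: "a e < ?z" "?z < b e" "poly (P e) ?z = 0"
      using Min_in[OF fin ne] by (auto simp: roots_in_def)
    have least: "?z \<le> y" if "a e < y" "poly (P e) y = 0" for y
      using that z(2) Min_le[OF fin, of y] by (cases "y < b e") (auto simp: roots_in_def)
    have upper: "N c e \<longleftrightarrow> ?z < c e" for c
    proof
      assume "N c e"
      then obtain y where "a e < y" "y < c e" "poly (P e) y = 0"
        unfolding N(2)[OF lc] roots_in_def by blast
      then show "?z < c e" using least[of y] by linarith
    qed (use z in \<open>auto simp: N(2)[OF lc] roots_in_def\<close>)
    have lower: "(\<not> N c e \<and> \<not> (a e < c e \<and> poly (P e) (c e) = 0)) \<longleftrightarrow> c e < ?z" for c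
      unfolding upper using z(1,3) least[of "c e"] by (cases "c e" ?z rule: linorder_cases) auto
    have sg: "poly (Q e) ?z > 0 \<longleftrightarrow> poly (R e) ?z > 0"
      using R(2)[OF lc z(3)] by (metis sgn_1_pos)
    show ?thesis unfolding sg
    proof
      assume pos: "poly (R e) ?z > 0"
      obtain c c' where c: "c \<in> (\<lambda>z. z e) ` insert a Z" "c' \<in> (\<lambda>z. z e) ` insert b Z" "c < ?z" "?z < c'"
        "\<And>x. x \<in> (\<lambda>z. z e) ` insert a Z \<Longrightarrow> c < x \<Longrightarrow> ?z \<le> x"
        "\<And>x. x \<in> (\<lambda>z. z e) ` insert b Z \<Longrightarrow> x < c' \<Longrightarrow> x \<le> ?z"
        using finite_gap[of "(\<lambda>z. z e) ` insert a Z" "a e" ?z "(\<lambda>z. z e) ` insert b Z" "b e"] Z(1) z(1,2)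
        by auto
      have no: "poly (R e) r \<noteq> 0" if "c < r" "r < c'" for r
      proof
        assume r0: "poly (R e) r = 0"
        moreover have "R e \<noteq> 0" using pos by auto
        ultimately obtain x where "x \<in> Z" "x e = r" using Z(3) by blast
        then have "r = ?z" using c(5)[of r] c(6)[of r] that by force
        with r0 pos show False by simp
      qed
      have "sgn (poly (R e) ((c + c') / 2)) = sgn (poly (R e) ?z)"
        by (rule poly_sgn_const, rule no) (use c(3,4) in \<open>auto simp: min_def max_def split: if_splits\<close>)
      then have "poly (R e) ((c + c') / 2) > 0" using pos by (metis sgn_1_pos)
      moreover from c(1,2) obtain g g' where "g \<in> insert a Z" "g e = c" "g' \<in> insert b Z" "g' e = c'"
        by auto
      ultimately show "T e" unfolding T_def unfolding lower unfolding upper using c(3,4) no by blast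
    next
      assume "T e"
      then obtain c c' where c: "c e < ?z" "?z < c' e" "poly (R e) ((c e + c' e) / 2) > 0"
        "\<And>r. r \<in> Z \<Longrightarrow> \<not> (c e < r e \<and> r e < c' e \<and> poly (R e) (r e) = 0)"
        unfolding T_def unfolding lower unfolding upper by blast
      have no: "poly (R e) r \<noteq> 0" if "c e < r" "r < c' e" for r
        using Z(3)[of e r] c(3,4) that by force
      have "sgn (poly (R e) ?z) = sgn (poly (R e) ((c e + c' e) / 2))"
        by (rule poly_sgn_const, rule no) (use c(1,2) in \<open>auto simp: min_def max_def split: if_splits\<close>)
      then show "poly (R e) ?z > 0" using c(3) by (metis sgn_1_pos)
    qed
  qed
  let ?c = "\<lambda>e. coeff (P e) (Suc n)"
  have eq: "poly (Q e) (least_root (Suc n) (P e) (a e) (b e)) > 0 \<longleftrightarrow>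
    ((\<not> ?c e = 0 \<and> N b e) \<and> T e) \<or> (\<not> (\<not> ?c e = 0 \<and> N b e) \<and> poly (Q e) 0 > 0)" for e
    using T[of e] N(2)[of e b] by (auto simp: least_root_def)
  have c: "pol ?c" using P by (simp add: pfam_def)
  show ?thesis unfolding eq
    by (intro qf_disj qf_conj qf_not qf_eq[OF c pol_const] N(1)[OF b] \<open>qf T\<close> qf_pos[OF pol_poly[OF Q pol_const]])
qed

lemma tame_least_root:
  assumes P: "pfam P (Suc n)" and cov: "roots_covered n" and a: "tame a" and b: "tame b"
  shows "tame (\<lambda>e. least_root (Suc n) (P e) (a e) (b e))"
  unfolding tame_def
proof (intro allI impI)
  fix s :: "(nat \<Rightarrow> real) \<Rightarrow> nat \<Rightarrow> real" and Q D
  assume s: "\<forall>i. pol (\<lambda>e. s e i)" and Q: "pfam Q D"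
  show "qf (\<lambda>e. poly (Q e) (least_root (Suc n) (P (s e)) (a (s e)) (b (s e))) > 0)"
    by (rule qf_poly_least_root[OF pfam_subst[OF P s[rule_format]] cov
          tame_base[OF a s[rule_format]] tame_base[OF b s[rule_format]] Q])
qed

text \<open>A Cauchy bound that is a rational function of the coefficients, since absolute values are
  not available to \<^const>\<open>pol\<close>.\<close>

lemma root_bound:
  fixes p :: "real poly"
  assumes "degree p \<le> Suc n" "coeff p (Suc n) \<noteq> 0" "poly p y = 0"
  defines "c \<equiv> coeff p (Suc n)"
  shows "\<bar>y\<bar> < 2 + (\<Sum>k\<le>n. coeff p k * coeff p k + c * c) * (1 / (c * c))"
proof -
  let ?T = "\<Sum>k\<le>n. coeff p k * coeff p k + c * c"
  have T0: "?T \<ge> 0" by (intro sum_nonneg) simp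
  have c2: "c * c > 0" using assms(2) by (auto simp: c_def mult_pos_pos zero_less_mult_iff)
  show ?thesis
  proof (cases "\<bar>y\<bar> < 1")
    case True
    moreover have "0 \<le> ?T * (1 / (c * c))" using T0 c2 by (intro mult_nonneg_nonneg) auto
    ultimately show ?thesis by linarith
  next
    case False
    have "c * y ^ Suc n = - (\<Sum>k\<le>n. coeff p k * y ^ k)"
      using assms(3) poly_sum_le[OF assms(1), of y] by (simp add: c_def)
    then have "\<bar>c * y ^ Suc n\<bar> = \<bar>\<Sum>k\<le>n. coeff p k * y ^ k\<bar>"
      by (simp only: abs_minus_cancel)
    then have "\<bar>c\<bar> * \<bar>y\<bar> ^ Suc n = \<bar>\<Sum>k\<le>n. coeff p k * y ^ k\<bar>"
      by (simp only: abs_mult power_abs)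
    also have "\<dots> \<le> (\<Sum>k\<le>n. \<bar>coeff p k\<bar> * \<bar>y\<bar> ^ k)"
      using sum_abs[of "\<lambda>k. coeff p k * y ^ k" "{..n}"] by (simp add: abs_mult power_abs)
    also have "\<dots> \<le> (\<Sum>k\<le>n. \<bar>coeff p k\<bar> * \<bar>y\<bar> ^ n)"
      using False by (intro sum_mono mult_left_mono power_increasing) auto
    finally have "\<bar>c\<bar> * \<bar>y\<bar> * \<bar>y\<bar> ^ n \<le> (\<Sum>k\<le>n. \<bar>coeff p k\<bar>) * \<bar>y\<bar> ^ n"
      by (simp add: sum_distrib_right mult.assoc)
    moreover have "\<bar>y\<bar> ^ n > 0" using False by (intro zero_less_power) auto
    ultimately have "\<bar>c\<bar> * \<bar>y\<bar> \<le> (\<Sum>k\<le>n. \<bar>coeff p k\<bar>)" by simp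
    \<comment> \<open>A second factor \<open>|c|\<close> turns the summands into products that are
      bounded by sums of squares, free of absolute values.\<close>
    then have "\<bar>c\<bar> * (\<bar>c\<bar> * \<bar>y\<bar>) \<le> \<bar>c\<bar> * (\<Sum>k\<le>n. \<bar>coeff p k\<bar>)" by (intro mult_left_mono) auto
    also have "\<dots> \<le> ?T"
      unfolding sum_distrib_left
    proof (rule sum_mono)
      fix k
      have "2 * (\<bar>c\<bar> * \<bar>coeff p k\<bar>) \<le> coeff p k * coeff p k + c * c"
        using sum_squares_bound[of "\<bar>c\<bar>" "\<bar>coeff p k\<bar>"] by (simp add: power2_eq_square)
      moreover have "0 \<le> \<bar>c\<bar> * \<bar>coeff p k\<bar>" by simp
      ultimately show "\<bar>c\<bar> * \<bar>coeff p k\<bar> \<le> coeff p k * coeff p k + c * c" by linarith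
    qed
    finally have "(c * c) * \<bar>y\<bar> \<le> ?T" by (simp add: mult.assoc[symmetric])
    then have "\<bar>y\<bar> \<le> ?T / (c * c)" using c2 by (simp add: pos_le_divide_eq mult.commute)
    then show ?thesis by simp
  qed
qed

text \<open>If the leading coefficient vanishes, the truncation \<open>P0\<close> covers the roots
  by induction. Otherwise the lowest root is the least one above \<open>- B\<close>, and any later
  root is the least one above the point that Rolle's theorem provides between it and its
  predecessor.\<close>

lemma roots_covered: "roots_covered d"
proof (induction d)
  case 0
  show ?case unfolding roots_covered_def
  proof (intro allI impI exI[of _ "{}"] conjI)
    fix P e y assume "pfam P 0" "P e \<noteq> 0" "poly (P e) y = 0"
    moreover from this have "degree (P e) = 0" by (simp add: pfam_def)
    then obtain c where "P e = [:c:]" by (rule degree_eq_zeroE)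
    ultimately show "\<exists>z\<in>{}. z e = y" by simp
  qed auto
next
  case (Suc n)
  show ?case unfolding roots_covered_def
  proof (intro allI impI)
    fix P assume P: "pfam P (Suc n)"
    let ?c = "\<lambda>e. coeff (P e) (Suc n)"
    have c: "pol ?c" using P by (simp add: pfam_def)
    define P0 where "P0 e = P e - monom (?c e) (Suc n)" for e
    have "pfam P0 n"
    proof -
      have *: "pfam P0 (Suc n)" unfolding P0_def by (intro pfam_diff P pfam_monom c)
      moreover have "coeff (P0 e) (Suc n) = 0" for e by (simp add: P0_def)
      ultimately show ?thesis using degree_le_of_coeff_0 unfolding pfam_def by blast
    qed
    from Suc[unfolded roots_covered_def, rule_format, OF this] obtain Z0 where Z0: "finite Z0" "\<And>z. z \<in> Z0 \<Longrightarrow> tame z"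
      "\<And>e y. P0 e \<noteq> 0 \<Longrightarrow> poly (P0 e) y = 0 \<Longrightarrow> \<exists>z\<in>Z0. z e = y"
      by metis
    obtain H where H: "finite H" "\<And>z. z \<in> H \<Longrightarrow> tame z"
      "\<And>e y. pderiv (P e) \<noteq> 0 \<Longrightarrow> poly (pderiv (P e)) y = 0 \<Longrightarrow> \<exists>z\<in>H. z e = y"
      using Suc[unfolded roots_covered_def, rule_format, OF pfam_pderiv[OF P]] by metis
    define B where "B e = 2 + (\<Sum>k\<le>n. coeff (P e) k * coeff (P e) k + ?c e * ?c e) * (1 / (?c e * ?c e))" for e
    have "pol (\<lambda>e. coeff (P e) k)" for k using P by (simp add: pfam_def)
    then have "pol (\<lambda>e. \<Sum>k\<le>n. coeff (P e) k * coeff (P e) k + ?c e * ?c e)"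
      by (intro pol_sum pol_add pol_mult)
    then have B: "tame B" unfolding B_def
      by (intro tame_add[OF tame_const] tame_mult tame_inverse pol_mult c) (rule tame_pol)
    then have mB: "tame (\<lambda>e. - B e)" using tame_mult[OF tame_const[of "-1"] B] by simp
    define H' where "H' = insert (\<lambda>e. - B e) H"
    define Z where "Z = Z0 \<union> (\<lambda>a e. least_root (Suc n) (P e) (a e) (B e)) ` H'"
    have "tame z" if "z \<in> Z" for z
      using that Z0(2) H(2) mB unfolding Z_def H'_def by (auto intro!: tame_least_root[OF P Suc _ B])
    moreover have "finite Z" unfolding Z_def H'_def using Z0(1) H(1) by simp
    moreover have "\<exists>z\<in>Z. z e = y" if nz: "P e \<noteq> 0" and y: "poly (P e) y = 0" for e y
    proof (cases "?c e = 0")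
      case True
      then have "P0 e = P e" by (simp add: P0_def)
      then show ?thesis using Z0(3)[of e y] nz y unfolding Z_def by auto
    next
      case False
      have yB: "\<bar>y\<bar> < B e"
        using root_bound[OF _ False y] P unfolding B_def pfam_def by blast
      obtain a where a: "a \<in> H'" "a e < y" "\<And>x. a e < x \<Longrightarrow> poly (P e) x = 0 \<Longrightarrow> y \<le> x"
      proof (cases "roots_in (P e) (- B e) y = {}")
        case True
        then show ?thesis using yB that[of "\<lambda>e. - B e"] by (force simp: H'_def roots_in_def)
      next
        case ne: False
        let ?S = "roots_in (P e) (- B e) y"
        have fin: "finite ?S" by (rule finite_roots_in[OF nz])
        have m: "Max ?S < y" "poly (P e) (Max ?S) = 0" using Max_in[OF fin ne] by (auto simp: roots_in_def)
        obtain x where x: "Max ?S < x" "x < y" "poly (pderiv (P e)) x = 0"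
          using poly_MVT[OF m(1), of "P e"] m(2) y m(1) by auto
        have "degree (P e) \<noteq> 0" using False by (metis coeff_eq_0 neq0_conv zero_less_Suc)
        then have "pderiv (P e) \<noteq> 0" by (simp add: pderiv_eq_0_iff)
        then obtain h where h: "h \<in> H" "h e = x" using H(3) x(3) by blast
        show ?thesis
        proof (rule that[of h])
          fix t assume t: "h e < t" "poly (P e) t = 0"
          have "\<bar>t\<bar> < B e" using root_bound[OF _ False t(2)] P unfolding B_def pfam_def by blast
          then show "y \<le> t" using Max_ge[OF fin, of t] t h x by (force simp: roots_in_def)
        qed (use h x in \<open>auto simp: H'_def\<close>)
      qed
      have "least_root (Suc n) (P e) (a e) (B e) = y"
      proof -
        have "y \<in> roots_in (P e) (a e) (B e)" using a yB y by (auto simp: roots_in_def)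
        moreover from this have "Min (roots_in (P e) (a e) (B e)) = y"
          using a(3) by (intro Min_eqI finite_roots_in[OF nz]) (auto simp: roots_in_def)
        ultimately show ?thesis using False by (auto simp: least_root_def)
      qed
      then show ?thesis using a(1) unfolding Z_def
        by (intro bexI[of _ "\<lambda>e. least_root (Suc n) (P e) (a e) (B e)"] UnI2 imageI)
    qed
    ultimately show "\<exists>Z. finite Z \<and> (\<forall>z\<in>Z. tame z) \<and>
      (\<forall>e y. P e \<noteq> 0 \<longrightarrow> poly (P e) y = 0 \<longrightarrow> (\<exists>z\<in>Z. z e = y))" by blast
  qed
qed

section \<open>Elimination of one quantifier\<close>

lemma qf_sign_family:
  assumes "qf A"
  shows "\<exists>F. finite F \<and> (\<forall>Q\<in>F. \<exists>D. pfam Q D) \<and> (\<forall>e y t.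
    (\<forall>Q\<in>F. sgn (poly (Q e) y) = sgn (poly (Q e) t)) \<longrightarrow> (A (case_nat y e) \<longleftrightarrow> A (case_nat t e)))"
  using assms
proof (induction rule: qf.induct)
  case (qf_pos p)
  then obtain Q D where "pfam Q D" "\<And>e y. p (case_nat y e) = poly (Q e) y"
    using pfam_of_pol by blast
  then show ?case by (intro exI[of _ "{Q}"]) (auto, (metis sgn_1_pos)+)
next
  case (qf_conj A B)
  then obtain F G where "finite F" "\<forall>Q\<in>F. \<exists>D. pfam Q D" "finite G" "\<forall>Q\<in>G. \<exists>D. pfam Q D"
    and "\<forall>e y t. (\<forall>Q\<in>F. sgn (poly (Q e) y) = sgn (poly (Q e) t)) \<longrightarrow> (A (case_nat y e) \<longleftrightarrow> A (case_nat t e))"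
    and "\<forall>e y t. (\<forall>Q\<in>G. sgn (poly (Q e) y) = sgn (poly (Q e) t)) \<longrightarrow> (B (case_nat y e) \<longleftrightarrow> B (case_nat t e))"
    by blast
  then show ?case by (intro exI[of _ "F \<union> G"]) (simp add: ball_Un, blast)
qed auto

text \<open>Tarski--Seidenberg: it suffices to test the finitely many tame sample points given by the
  roots, the midpoints between them, and one point beyond each of them.\<close>

theorem qf_ex:
  assumes "qf A" shows "qf (\<lambda>e. \<exists>y. A (case_nat y e))"
proof -
  obtain F where F: "finite F" "\<And>Q. Q \<in> F \<Longrightarrow> \<exists>D. pfam Q D"
    "\<And>e y t. (\<forall>Q\<in>F. sgn (poly (Q e) y) = sgn (poly (Q e) t)) \<Longrightarrow> (A (case_nat y e) \<longleftrightarrow> A (case_nat t e))"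
    using qf_sign_family[OF assms] by metis
  have "\<forall>Q\<in>F. \<exists>Z. finite Z \<and> (\<forall>z\<in>Z. tame z) \<and>
      (\<forall>e y. Q e \<noteq> 0 \<longrightarrow> poly (Q e) y = 0 \<longrightarrow> (\<exists>z\<in>Z. z e = y))"
    using F(2) roots_covered unfolding roots_covered_def by meson
  then obtain Z where Z: "\<And>Q. Q \<in> F \<Longrightarrow> finite (Z Q)" "\<And>Q z. Q \<in> F \<Longrightarrow> z \<in> Z Q \<Longrightarrow> tame z"
    "\<And>Q e y. Q \<in> F \<Longrightarrow> Q e \<noteq> 0 \<Longrightarrow> poly (Q e) y = 0 \<Longrightarrow> \<exists>z\<in>Z Q. z e = y"
    by metis
  \<comment> \<open>The zero function keeps the sample set nonempty when \<open>F\<close>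
    contributes no points, so that a minimum and a maximum exist.\<close>
  define X where "X = insert (\<lambda>e. 0) (\<Union>Q\<in>F. Z Q)"
  have X: "finite X" "\<And>z. z \<in> X \<Longrightarrow> tame z"
    unfolding X_def using F(1) Z(1,2) tame_const by auto
  define T where "T = X \<union> (\<lambda>(a, b) e. (a e + b e) / 2) ` (X \<times> X) \<union> (\<lambda>a e. a e + 1) ` X \<union> (\<lambda>a e. a e - 1) ` X"
  have T: "finite T" unfolding T_def using X(1) by simp
  have tT: "tame t" if "t \<in> T" for t
  proof -
    have "tame (\<lambda>e. x e - 1)" if "x \<in> X" for x
      using tame_add[OF X(2)[OF that] tame_const[of "-1"]] by simp
    then show ?thesis
      using that X(2) unfolding T_def by (auto intro: tame_midpoint tame_add[OF _ tame_const])
  qed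
  have "\<exists>t\<in>T. A (case_nat (t e) e)" if A: "A (case_nat y e)" for e y
  proof -
    let ?X = "(\<lambda>x. x e) ` X"
    have fX: "finite ?X" "?X \<noteq> {}" using X(1) by (auto simp: X_def)
    have same: "A (case_nat t e)" if "\<And>x. x \<in> ?X \<Longrightarrow> min y t \<le> x \<Longrightarrow> x \<le> max y t \<Longrightarrow> False" for t
    proof -
      have "sgn (poly (Q e) y) = sgn (poly (Q e) t)" if "Q \<in> F" for Q
      proof (cases "Q e = 0")
        case False
        have "x \<in> ?X" if "poly (Q e) x = 0" for x
          using Z(3)[OF \<open>Q \<in> F\<close> False that] \<open>Q \<in> F\<close> by (auto simp: X_def)
        then show ?thesis using \<open>\<And>x. x \<in> ?X \<Longrightarrow> min y t \<le> x \<Longrightarrow> x \<le> max y t \<Longrightarrow> False\<close>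
          by (intro poly_sgn_const) blast
      qed simp
      then show ?thesis using F(3)[of e y t] A by blast
    qed
    consider "y \<in> ?X" | "\<forall>x\<in>?X. y < x" | "\<forall>x\<in>?X. x < y" |
      a b where "a \<in> ?X" "b \<in> ?X" "a < y" "y < b" "y \<notin> ?X"
    proof -
      have "y \<in> S \<or> (\<forall>x\<in>S. y < x) \<or> (\<forall>x\<in>S. x < y) \<or>
        (\<exists>a b. a \<in> S \<and> b \<in> S \<and> a < y \<and> y < b \<and> y \<notin> S)" for S
        by (metis linorder_less_linear)
      from this[of ?X] show ?thesis using that by metis
    qed
    then show ?thesis
    proof cases
      case 1
      then show ?thesis using A unfolding T_def by auto
    next
      case 2
      let ?m = "Min ?X"
      obtain x where x: "x \<in> X" "x e = ?m" using Min_in[OF fX] by auto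
      have "A (case_nat (?m - 1) e)"
        by (rule same) (use 2 Min_le[OF fX(1)] Min_in[OF fX] in \<open>force simp: max_def split: if_splits\<close>)
      moreover have "(\<lambda>e. x e - 1) \<in> T" unfolding T_def using x(1) by blast
      ultimately show ?thesis using x(2) by (intro bexI[of _ "\<lambda>e. x e - 1"]) auto
    next
      case 3
      let ?m = "Max ?X"
      obtain x where x: "x \<in> X" "x e = ?m" using Max_in[OF fX] by auto
      have "A (case_nat (?m + 1) e)"
        by (rule same) (use 3 Max_ge[OF fX(1)] Max_in[OF fX] in \<open>force simp: min_def split: if_splits\<close>)
      moreover have "(\<lambda>e. x e + 1) \<in> T" unfolding T_def using x(1) by blast
      ultimately show ?thesis using x(2) by (intro bexI[of _ "\<lambda>e. x e + 1"]) auto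
    next
      case (4 a b)
      obtain c c' where c: "c \<in> ?X" "c' \<in> ?X" "c < y" "y < c'"
        "\<And>x. x \<in> ?X \<Longrightarrow> c < x \<Longrightarrow> y \<le> x" "\<And>x. x \<in> ?X \<Longrightarrow> x < c' \<Longrightarrow> x \<le> y"
        by (rule finite_gap[OF fX(1) 4(1,3) fX(1) 4(2,4)], rule that) auto
      have "A (case_nat ((c + c') / 2) e)"
      proof (rule same)
        fix x assume x: "x \<in> ?X" "min y ((c + c') / 2) \<le> x" "x \<le> max y ((c + c') / 2)"
        then have "c < x" "x < c'" using c(3,4) by (auto simp: min_def max_def split: if_splits)
        with c(5,6)[OF x(1)] have "x = y" by simp
        with x(1) 4(5) show False by simp
      qed
      moreover obtain g g' where g: "g \<in> X" "g e = c" "g' \<in> X" "g' e = c'" using c(1,2) by auto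
      moreover have "(\<lambda>e. (g e + g' e) / 2) \<in> T"
        unfolding T_def using g(1,3) by (auto simp: image_iff intro!: bexI[of _ "(g, g')"])
      ultimately show ?thesis by (intro bexI[of _ "\<lambda>e. (g e + g' e) / 2"]) auto
    qed
  qed
  then have "(\<exists>y. A (case_nat y e)) \<longleftrightarrow> (\<exists>t\<in>T. A (case_nat (t e) e))" for e by blast
  then show ?thesis by (simp only:) (rule qf_Bex[OF T tame_subst1[OF assms tT]])
qed

text \<open>The quantified coordinate of a Euclidean point may stand at any position
  \<open>i\<close>; the base change moves it to the front, where \<open>qf_ex\<close> binds
  it.\<close>

lemma qf_ex_update:
  assumes "qf A" shows "qf (\<lambda>e. \<exists>y. A (e(i := y)))"
proof -
  define s :: "(nat \<Rightarrow> real) \<Rightarrow> nat \<Rightarrow> real" where "s e j = (if j = i then e 0 else e (Suc j))" for e j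
  have "pol (\<lambda>e. s e j)" for j unfolding s_def by (cases "j = i") (simp_all add: pol_var)
  then have "qf (\<lambda>e. \<exists>y. A (s (case_nat y e)))"
    by (rule qf_ex[OF qf_subst[OF assms]])
  moreover have "s (case_nat y e) = e(i := y)" for y e
    by (auto simp: s_def fun_eq_iff)
  ultimately show ?thesis by simp
qed

subsection \<open>Semialgebraic sets\<close>

(* As introduction rules these loop: composition unifies with every function. *)
declare polynomial_function_compose [rule del] real_polynomial_function_compose [rule del]

lemma pf_inner:
  fixes f g :: "'a::real_normed_vector \<Rightarrow> 'b::euclidean_space"
  assumes "polynomial_function f" "polynomial_function g"
  shows "polynomial_function (\<lambda>x. f x \<bullet> g x)"
proof -
  have "polynomial_function (\<lambda>x. \<Sum>b\<in>Basis. (f x \<bullet> b) *\<^sub>R (g x \<bullet> b))"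
    by (rule polynomial_function_sum[OF finite_Basis polynomial_function_mult[OF
            polynomial_function_inner polynomial_function_inner]]) (rule assms)+
  then show ?thesis by (simp add: euclidean_inner[of "f _" "g _"])
qed

lemma pf_fst: "polynomial_function f \<Longrightarrow> polynomial_function (\<lambda>x. fst (f x))"
  using polynomial_function_compose[OF _ polynomial_function_bounded_linear[OF bounded_linear_fst]]
  by (auto simp: o_def)

lemma pf_snd: "polynomial_function f \<Longrightarrow> polynomial_function (\<lambda>x. snd (f x))"
  using polynomial_function_compose[OF _ polynomial_function_bounded_linear[OF bounded_linear_snd]]
  by (auto simp: o_def)

lemma pf_Pair:
  fixes f :: "'a::real_normed_vector \<Rightarrow> 'b::euclidean_space" and g :: "'a \<Rightarrow> 'c::euclidean_space"
  assumes "polynomial_function f" "polynomial_function g"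
  shows "polynomial_function (\<lambda>x. (f x, g x))"
proof -
  have "polynomial_function (\<lambda>x. (f x, 0::'c))"
    using polynomial_function_compose[OF assms(1) polynomial_function_bounded_linear[OF
        bounded_linear_Pair[OF bounded_linear_ident bounded_linear_zero]]] by (simp add: o_def)
  moreover have "polynomial_function (\<lambda>x. (0::'b, g x))"
    using polynomial_function_compose[OF assms(2) polynomial_function_bounded_linear[OF
        bounded_linear_Pair[OF bounded_linear_zero bounded_linear_ident]]] by (simp add: o_def)
  ultimately show ?thesis using polynomial_function_add by fastforce
qed

lemma pf_mult:
  fixes f g :: "'a::real_normed_vector \<Rightarrow> real"
  shows "polynomial_function f \<Longrightarrow> polynomial_function g \<Longrightarrow> polynomial_function (\<lambda>x. f x * g x)"
  using polynomial_function_mult[of f g] by simp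

lemma pf_power:
  fixes f :: "'a::real_normed_vector \<Rightarrow> real"
  shows "polynomial_function f \<Longrightarrow> polynomial_function (\<lambda>x. f x ^ n)"
  by (induction n) (auto intro: pf_mult)

lemma pf_norm_sq:
  fixes f :: "'a::real_normed_vector \<Rightarrow> 'b::euclidean_space"
  shows "polynomial_function f \<Longrightarrow> polynomial_function (\<lambda>x. (norm (f x))\<^sup>2)"
  unfolding power2_norm_eq_inner by (rule pf_inner)

lemmas pf_intros = polynomial_function_const polynomial_function_id pf_inner pf_fst pf_snd pf_Pair
  polynomial_function_add polynomial_function_diff polynomial_function_minus
  polynomial_function_mult pf_mult pf_norm_sq pf_power

lemma sa_basic: "basic_semialgebraic S \<Longrightarrow> semialgebraic S"
  unfolding semialgebraic_def by (intro exI[of _ "{S}"]) auto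

lemma basicI:
  fixes H G :: "('a::euclidean_space \<Rightarrow> real) set"
  assumes "finite H" "finite G" "\<forall>h\<in>H \<union> G. polynomial_function h"
    "X = {x. (\<forall>h\<in>H. h x = 0) \<and> (\<forall>p\<in>G. p x < 0)}"
  shows "basic_semialgebraic X"
  unfolding basic_semialgebraic_def real_polynomial_function_eq
  by (rule exI[of _ H], rule exI[of _ G]) (use assms in simp)

lemma basicE:
  fixes X :: "'a::euclidean_space set"
  assumes "basic_semialgebraic X"
  obtains H G :: "('a \<Rightarrow> real) set" where "finite H" "finite G" "\<forall>h\<in>H \<union> G. polynomial_function h"
    "X = {x. (\<forall>h\<in>H. h x = 0) \<and> (\<forall>p\<in>G. p x < 0)}"
proof -
  from assms[unfolded basic_semialgebraic_def real_polynomial_function_eq]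
  show thesis
    by (elim exE conjE) (rule that, auto)
qed

lemma sa_less_0: "polynomial_function p \<Longrightarrow> semialgebraic {x. p x < 0}"
  for p :: "_ \<Rightarrow> real"
  by (rule sa_basic, rule basicI[of "{}" "{p}"]) auto

lemma sa_eq_0: "polynomial_function p \<Longrightarrow> semialgebraic {x. p x = 0}"
  for p :: "_ \<Rightarrow> real"
  by (rule sa_basic, rule basicI[of "{p}" "{}"]) auto

lemma sa_UNIV: "semialgebraic UNIV"
  using sa_eq_0[OF polynomial_function_const[of 0]] by simp

lemma sa_empty: "semialgebraic {}"
  unfolding semialgebraic_def by (intro exI[of _ "{}"]) auto

lemma sa_Un: "semialgebraic S \<Longrightarrow> semialgebraic T \<Longrightarrow> semialgebraic (S \<union> T)"
  unfolding semialgebraic_def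
  by (elim exE conjE, rename_tac A B, rule_tac x = "A \<union> B" in exI) auto

lemma basic_Int:
  fixes S T :: "'a::euclidean_space set"
  assumes "basic_semialgebraic S" "basic_semialgebraic T"
  shows "basic_semialgebraic (S \<inter> T)"
proof -
  obtain H G :: "('a \<Rightarrow> real) set" where *: "finite H" "finite G" "\<forall>h\<in>H \<union> G. polynomial_function h"
    and S: "S = {x. (\<forall>h\<in>H. h x = 0) \<and> (\<forall>p\<in>G. p x < 0)}"
    using assms(1) by (rule basicE)
  obtain H' G' :: "('a \<Rightarrow> real) set" where **: "finite H'" "finite G'" "\<forall>h\<in>H' \<union> G'. polynomial_function h"
    and T: "T = {x. (\<forall>h\<in>H'. h x = 0) \<and> (\<forall>p\<in>G'. p x < 0)}"
    using assms(2) by (rule basicE)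
  show ?thesis
    by (rule basicI[of "H \<union> H'" "G \<union> G'"]) (use * ** in \<open>auto simp: S T\<close>)
qed

lemma sa_Int: assumes "semialgebraic S" "semialgebraic T" shows "semialgebraic (S \<inter> T)"
proof -
  obtain A B where A: "finite A" "\<forall>X\<in>A. basic_semialgebraic X" "S = \<Union>A"
    and B: "finite B" "\<forall>X\<in>B. basic_semialgebraic X" "T = \<Union>B"
    using assms unfolding semialgebraic_def by metis
  show ?thesis unfolding semialgebraic_def
  proof (intro exI[of _ "(\<lambda>(X, Y). X \<inter> Y) ` (A \<times> B)"] conjI)
    show "S \<inter> T = \<Union> ((\<lambda>(X, Y). X \<inter> Y) ` (A \<times> B))" using A(3) B(3) by auto
  qed (use A B basic_Int in auto)
qed

lemma sa_INT: "finite I \<Longrightarrow> (\<And>i. i \<in> I \<Longrightarrow> semialgebraic (S i)) \<Longrightarrow> semialgebraic (\<Inter>i\<in>I. S i)"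
  by (induction I rule: finite_induct) (auto intro: sa_UNIV sa_Int)

lemma sa_UN: "finite I \<Longrightarrow> (\<And>i. i \<in> I \<Longrightarrow> semialgebraic (S i)) \<Longrightarrow> semialgebraic (\<Union>i\<in>I. S i)"
  by (induction I rule: finite_induct) (auto intro: sa_empty sa_Un)

lemma sa_Compl:
  fixes S :: "'a::euclidean_space set"
  assumes "semialgebraic S" shows "semialgebraic (- S)"
proof -
  have basic: "semialgebraic (- X)" if X: "basic_semialgebraic X" for X :: "'a set"
  proof -
    obtain H G :: "('a \<Rightarrow> real) set" where *: "finite H" "finite G" "\<forall>h\<in>H \<union> G. polynomial_function h"
      and X: "X = {x. (\<forall>h\<in>H. h x = 0) \<and> (\<forall>p\<in>G. p x < 0)}"
      using X by (rule basicE)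
    have "- X = (\<Union>h\<in>H. {x. h x < 0} \<union> {x. - h x < 0}) \<union> (\<Union>p\<in>G. {x. p x = 0} \<union> {x. - p x < 0})"
      unfolding X by (auto simp: not_less order_le_less)
    also have "semialgebraic \<dots>"
      by (intro sa_Un sa_UN sa_less_0 sa_eq_0 polynomial_function_minus *(1,2)) (use *(3) in auto)
    finally show ?thesis .
  qed
  obtain A where A: "finite A" "\<forall>X\<in>A. basic_semialgebraic X" "S = \<Union>A"
    using assms unfolding semialgebraic_def by metis
  have "- S = (\<Inter>X\<in>A. - X)" using A(3) by auto
  then show ?thesis using A basic by (auto intro: sa_INT)
qed

lemma sa_vimage:
  fixes S :: "'a::euclidean_space set" and q :: "'b::euclidean_space \<Rightarrow> 'a"
  assumes "semialgebraic S" "polynomial_function q"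
  shows "semialgebraic {x. q x \<in> S}"
proof -
  have basic: "semialgebraic {x. q x \<in> X}" if X: "basic_semialgebraic X" for X
  proof -
    obtain H G :: "('a \<Rightarrow> real) set" where *: "finite H" "finite G" "\<forall>h\<in>H \<union> G. polynomial_function h"
      and X: "X = {x. (\<forall>h\<in>H. h x = 0) \<and> (\<forall>p\<in>G. p x < 0)}"
      using X by (rule basicE)
    show ?thesis
      by (rule sa_basic, rule basicI[of "(\<lambda>h. h \<circ> q) ` H" "(\<lambda>h. h \<circ> q) ` G"])
        (use * polynomial_function_compose[OF assms(2)] in \<open>auto simp: X\<close>)
  qed
  obtain A where A: "finite A" "\<forall>X\<in>A. basic_semialgebraic X" "S = \<Union>A"
    using assms unfolding semialgebraic_def by metis
  have "{x. q x \<in> S} = (\<Union>X\<in>A. {x. q x \<in> X})" using A(3) by auto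
  then show ?thesis using A basic by (auto intro: sa_UN)
qed

lemma sa_conj: "semialgebraic {x. P x} \<Longrightarrow> semialgebraic {x. Q x} \<Longrightarrow> semialgebraic {x. P x \<and> Q x}"
  using sa_Int[of "{x. P x}" "{x. Q x}"] by (simp add: Collect_conj_eq)

lemma sa_disj: "semialgebraic {x. P x} \<Longrightarrow> semialgebraic {x. Q x} \<Longrightarrow> semialgebraic {x. P x \<or> Q x}"
  using sa_Un[of "{x. P x}" "{x. Q x}"] by (simp add: Collect_disj_eq)

lemma sa_not: "semialgebraic {x. P x} \<Longrightarrow> semialgebraic {x. \<not> P x}"
  using sa_Compl[of "{x. P x}"] by (simp add: Collect_neg_eq)

lemma sa_imp: "semialgebraic {x. P x} \<Longrightarrow> semialgebraic {x. Q x} \<Longrightarrow> semialgebraic {x. P x \<longrightarrow> Q x}"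
  unfolding imp_conv_disj by (rule sa_disj[OF sa_not])

lemma sa_less:
  "polynomial_function p \<Longrightarrow> polynomial_function q \<Longrightarrow> semialgebraic {x. p x < q x}"
  for p q :: "_ \<Rightarrow> real"
  using sa_less_0[OF polynomial_function_diff, of p q] by simp

lemma sa_eq:
  "polynomial_function p \<Longrightarrow> polynomial_function q \<Longrightarrow> semialgebraic {x. p x = q x}"
  for p q :: "_ \<Rightarrow> real"
  using sa_eq_0[OF polynomial_function_diff, of p q] by simp

lemma sa_le:
  "polynomial_function p \<Longrightarrow> polynomial_function q \<Longrightarrow> semialgebraic {x. p x \<le> q x}"
  for p q :: "_ \<Rightarrow> real"
  using sa_not[OF sa_less, of q p] by (simp add: not_less)

section \<open>Points as environments; projections of semialgebraic sets\<close>

definition basis_enum :: "nat \<Rightarrow> 'a::euclidean_space" where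
  "basis_enum = (SOME f. bij_betw f {..<DIM('a)} Basis)"

lemma bij_basis_enum: "bij_betw (basis_enum :: nat \<Rightarrow> 'a::euclidean_space) {..<DIM('a)} Basis"
proof -
  obtain f where "bij_betw f {0..<DIM('a)} (Basis :: 'a set)"
    using ex_bij_betw_nat_finite[OF finite_Basis] by blast
  then show ?thesis unfolding basis_enum_def atLeast0LessThan
    by (rule someI[where P = "\<lambda>f. bij_betw f {..<DIM('a)} (Basis :: 'a set)"])
qed

text \<open>Entries past the dimension are filled with 0, since an environment is infinite and a
  sign condition may mention any variable.\<close>

definition coords :: "'a::euclidean_space \<Rightarrow> nat \<Rightarrow> real" where
  "coords x k = (if k < DIM('a) then x \<bullet> basis_enum k else 0)"

lemma real_polynomial_function_imp_pol:
  assumes "real_polynomial_function h"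
  shows "\<exists>p. pol p \<and> (\<forall>x::'a::euclidean_space. h x = p (coords x))"
  using assms
proof (induction rule: real_polynomial_function.induct)
  case (linear h)
  then interpret bounded_linear h .
  define p where "p e = (\<Sum>k<DIM('a). e k * h (basis_enum k))" for e :: "nat \<Rightarrow> real"
  have "h x = p (coords x)" for x
  proof -
    have "h x = h (\<Sum>b\<in>Basis. (x \<bullet> b) *\<^sub>R b)" by (simp add: euclidean_representation)
    also have "\<dots> = (\<Sum>b\<in>Basis. (x \<bullet> b) * h b)" by (simp add: sum scaleR)
    also have "\<dots> = p (coords x)"
      unfolding p_def coords_def by (subst sum.reindex_bij_betw[OF bij_basis_enum, symmetric]) simp
    finally show ?thesis .
  qed
  moreover have "pol p" unfolding p_def by (intro pol_sum pol_mult pol_const pol_var)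
  ultimately show ?case by blast
next
  case (const c)
  show ?case using pol_const by blast
next
  case (add f g)
  then obtain p q where "pol p" "\<And>x. f x = p (coords x)" "pol q" "\<And>x. g x = q (coords x)"
    by metis
  then show ?case using pol_add[of p q] by (intro exI[of _ "\<lambda>e. p e + q e"]) simp
next
  case (mult f g)
  then obtain p q where "pol p" "\<And>x. f x = p (coords x)" "pol q" "\<And>x. g x = q (coords x)"
    by metis
  then show ?case using pol_mult[of p q] by (intro exI[of _ "\<lambda>e. p e * q e"]) simp
qed

lemma pol_coords: "pol p \<Longrightarrow> polynomial_function (\<lambda>x::'a::euclidean_space. p (coords x))"
proof (induction rule: pol.induct)
  case (pol_var i)
  then show ?case unfolding coords_def
    by (cases "i < DIM('a)") (simp_all add: polynomial_function_inner)
qed (simp_all add: polynomial_function_add pf_mult)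

lemma qf_coords: "qf A \<Longrightarrow> semialgebraic {x. A (coords x)}"
proof (induction rule: qf.induct)
  case (qf_pos p)
  show ?case by (rule sa_less[OF polynomial_function_const pol_coords[OF qf_pos]])
next
  case (qf_not A)
  show ?case by (rule sa_not[OF qf_not(2)])
next
  case (qf_conj A B)
  show ?case by (rule sa_conj[OF qf_conj(3,4)])
qed

lemma semialgebraic_imp_qf:
  fixes S :: "'a::euclidean_space set"
  assumes "semialgebraic S" shows "\<exists>A. qf A \<and> (\<forall>x. x \<in> S \<longleftrightarrow> A (coords x))"
proof -
  have basic: "\<exists>A. qf A \<and> (\<forall>x. x \<in> X \<longleftrightarrow> A (coords x))" if X: "basic_semialgebraic X" for X :: "'a set"
  proof -
    obtain H G :: "('a \<Rightarrow> real) set" where *: "finite H" "finite G" "\<forall>h\<in>H \<union> G. polynomial_function h"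
      and X: "X = {x. (\<forall>h\<in>H. h x = 0) \<and> (\<forall>p\<in>G. p x < 0)}"
      using X by (rule basicE)
    have "\<forall>h\<in>H \<union> G. \<exists>p. pol p \<and> (\<forall>x. h x = p (coords x))"
      using *(3) real_polynomial_function_imp_pol unfolding real_polynomial_function_eq by blast
    then obtain p where p: "\<And>h. h \<in> H \<union> G \<Longrightarrow> pol (p h)"
      "\<And>h x. h \<in> H \<union> G \<Longrightarrow> h x = p h (coords x)" by metis
    have "qf (\<lambda>e. (\<forall>h\<in>H. p h e = 0) \<and> (\<forall>h\<in>G. p h e < 0))"
      by (rule qf_conj[OF qf_Ball[OF *(1) qf_eq[OF p(1) pol_const]] qf_Ball[OF *(2) qf_less[OF p(1) pol_const]]]) auto
    moreover have "x \<in> X \<longleftrightarrow> (\<forall>h\<in>H. p h (coords x) = 0) \<and> (\<forall>h\<in>G. p h (coords x) < 0)" for x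
      unfolding X using p(2) by auto
    ultimately show ?thesis by blast
  qed
  obtain \<A> where \<A>: "finite \<A>" "\<forall>X\<in>\<A>. basic_semialgebraic X" "S = \<Union>\<A>"
    using assms unfolding semialgebraic_def by metis
  then obtain Q where Q: "\<And>X. X \<in> \<A> \<Longrightarrow> qf (Q X)" "\<And>X x. X \<in> \<A> \<Longrightarrow> x \<in> X \<longleftrightarrow> Q X (coords x)"
    using basic by metis
  have "qf (\<lambda>e. \<exists>X\<in>\<A>. Q X e)" by (rule qf_Bex[OF \<A>(1) Q(1)])
  moreover have "x \<in> S \<longleftrightarrow> (\<exists>X\<in>\<A>. Q X (coords x))" for x
    unfolding \<A>(3) using Q(2) by auto
  ultimately show ?thesis by blast
qed

lemma sa_ex_direction:
  fixes S :: "'a::euclidean_space set"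
  assumes "semialgebraic S" "b \<in> Basis"
  shows "semialgebraic {x. \<exists>t::real. x + t *\<^sub>R b \<in> S}"
proof -
  obtain A where A: "qf A" "\<And>x. x \<in> S \<longleftrightarrow> A (coords x)"
    using semialgebraic_imp_qf[OF assms(1)] by blast
  obtain i where i: "i < DIM('a)" "b = basis_enum i"
    using bij_basis_enum assms(2) unfolding bij_betw_def by blast
  have c: "coords (x + t *\<^sub>R b) = (coords x)(i := coords x i + t)" for x t
  proof
    fix k show "coords (x + t *\<^sub>R b) k = ((coords x)(i := coords x i + t)) k"
    proof (cases "k < DIM('a)")
      case True
      then have "(basis_enum k :: 'a) = b \<longleftrightarrow> k = i" "(basis_enum k :: 'a) \<in> Basis"
        using bij_basis_enum[where 'a = 'a] i unfolding bij_betw_def inj_on_def by blast+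
      then show ?thesis
        using True assms(2) by (auto simp: coords_def inner_add_left inner_Basis)
    qed (use i in \<open>auto simp: coords_def\<close>)
  qed
  have "(\<exists>t. x + t *\<^sub>R b \<in> S) \<longleftrightarrow> (\<exists>y. A ((coords x)(i := y)))" for x
    unfolding A(2) c by (metis add.commute diff_add_cancel)
  then show ?thesis using qf_coords[OF qf_ex_update[OF A(1), of i]] by simp
qed

text \<open>The fibre directions are eliminated one basis vector at a time: \<open>span B\<close>
  grows from the zero space to the whole second factor. The quantifier ranges over shifts
  \<open>z + (0, w)\<close>, so that all intermediate sets live in the same product space.\<close>

lemma sa_ex_mem:
  fixes S :: "('a::euclidean_space \<times> 'b::euclidean_space) set"
  assumes S: "semialgebraic S"
  shows "semialgebraic {x. \<exists>y. (x, y) \<in> S}"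
proof -
  have *: "semialgebraic {z. \<exists>w\<in>span B. z + (0, w) \<in> S}" if "finite B" "B \<subseteq> Basis" for B
    using that
  proof (induction B rule: finite_induct)
    case empty
    then show ?case using S by (simp add: zero_prod_def[symmetric])
  next
    case (insert b B)
    let ?T = "{z. \<exists>w\<in>span B. z + (0, w) \<in> S}"
    have b: "(0, b) \<in> Basis" using insert.prems by (auto simp: Basis_prod_def)
    have "{z. \<exists>w\<in>span (insert b B). z + (0, w) \<in> S} = {z. \<exists>t. z + t *\<^sub>R (0, b) \<in> ?T}"
    proof (intro set_eqI iffI)
      fix z assume "z \<in> {z. \<exists>w\<in>span (insert b B). z + (0, w) \<in> S}"
      then obtain w t where w: "z + (0, w) \<in> S" "w - t *\<^sub>R b \<in> span B"
        by (auto simp: span_insert)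
      have "z + t *\<^sub>R (0, b) + (0, w - t *\<^sub>R b) = z + (0, w)" by (cases z) auto
      with w show "z \<in> {z. \<exists>t. z + t *\<^sub>R (0, b) \<in> ?T}" by (metis (mono_tags, lifting) mem_Collect_eq)
    next
      fix z assume "z \<in> {z. \<exists>t. z + t *\<^sub>R (0, b) \<in> ?T}"
      then obtain t w where w: "w \<in> span B" "z + t *\<^sub>R (0, b) + (0, w) \<in> S" by auto
      have "z + t *\<^sub>R (0, b) + (0, w) = z + (0, t *\<^sub>R b + w)" by (cases z) auto
      moreover have "t *\<^sub>R b + w \<in> span (insert b B)"
        using w(1) by (auto simp: span_insert intro!: exI[of _ t])
      ultimately show "z \<in> {z. \<exists>w\<in>span (insert b B). z + (0, w) \<in> S}"
        using w(2) unfolding mem_Collect_eq by (metis (no_types))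
    qed
    then show ?case using sa_ex_direction[OF insert.IH b] insert.prems by simp
  qed
  have "semialgebraic {z. \<exists>w. z + (0, w) \<in> S}" using *[of Basis] by simp
  \<comment> \<open>This set is invariant under shifts of the second factor, so its slice at second
    component 0 is the projection.\<close>
  from sa_vimage[OF this pf_Pair[OF polynomial_function_id polynomial_function_const[of 0]]]
  show ?thesis by simp
qed

lemma sa_ex:
  fixes P :: "'a::euclidean_space \<Rightarrow> 'b::euclidean_space \<Rightarrow> bool"
  assumes "semialgebraic {z. P (fst z) (snd z)}"
  shows "semialgebraic {x. \<exists>y. P x y}"
  using sa_ex_mem[OF assms] by simp

lemma sa_all:
  fixes P :: "'a::euclidean_space \<Rightarrow> 'b::euclidean_space \<Rightarrow> bool"
  assumes "semialgebraic {z. P (fst z) (snd z)}"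
  shows "semialgebraic {x. \<forall>y. P x y}"
  using sa_not[OF sa_ex[OF sa_not[OF assms]]] by simp

lemmas sa_intros = sa_ex sa_all sa_conj sa_disj sa_imp sa_not sa_less sa_le sa_eq sa_vimage

section \<open>One-sided germs of semialgebraic predicates on the line\<close>

text \<open>For one-sided neighbourhoods this is the part of o-minimality that is used: a
  semialgebraic predicate has a constant truth value close to a point on either side.\<close>

definition decided :: "'a filter \<Rightarrow> ('a \<Rightarrow> bool) \<Rightarrow> bool" where
  "decided F P \<longleftrightarrow> eventually P F \<or> eventually (\<lambda>x. \<not> P x) F"

lemma decided_not: "decided F P \<Longrightarrow> decided F (\<lambda>x. \<not> P x)"
  unfolding decided_def by auto

lemma decided_conj: "decided F P \<Longrightarrow> decided F Q \<Longrightarrow> decided F (\<lambda>x. P x \<and> Q x)"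
  unfolding decided_def
  using eventually_conj[of P F Q] eventually_mono[of "\<lambda>x. \<not> P x" F "\<lambda>x. \<not> (P x \<and> Q x)"]
    eventually_mono[of "\<lambda>x. \<not> Q x" F "\<lambda>x. \<not> (P x \<and> Q x)"] by blast

lemma decided_const:
  assumes "eventually D F" "\<And>x. D x \<Longrightarrow> P x \<longleftrightarrow> c" shows "decided F P"
  unfolding decided_def using eventually_mono[OF assms(1), of P]
    eventually_mono[OF assms(1), of "\<lambda>x. \<not> P x"] assms(2) by blast

lemma poly_function_eq_poly:
  assumes "polynomial_function (f :: real \<Rightarrow> real)"
  obtains p where "f = poly p"
proof -
  obtain a n where f: "f = (\<lambda>x. \<Sum>i\<le>n. a i * x ^ i)"
    using assms real_polynomial_function_imp_sum real_polynomial_function_eq by blast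
  show thesis
    by (rule that[of "\<Sum>i\<le>n. monom (a i) i"]) (simp add: f poly_sum poly_monom fun_eq_iff)
qed

lemma decided_poly:
  fixes a :: real
  shows "decided (at_right a) (\<lambda>x. poly p x > 0)" "decided (at_left a) (\<lambda>x. poly p x > 0)"
proof -
  have "\<exists>d>0. (\<forall>x y. a < x \<and> x < a + d \<and> a < y \<and> y < a + d \<longrightarrow> sgn (poly p x) = sgn (poly p y)) \<and>
    (\<forall>x y. a - d < x \<and> x < a \<and> a - d < y \<and> y < a \<longrightarrow> sgn (poly p x) = sgn (poly p y))"
  proof (cases "p = 0")
    case False
    obtain d where d: "d > 0" "\<And>x. poly p x = 0 \<Longrightarrow> x \<noteq> a \<Longrightarrow> d \<le> dist a x"
      using finite_set_avoid[OF poly_roots_finite[OF False], of a] by auto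
    have nz: "poly p x \<noteq> 0" if "x \<noteq> a" "a - d < x" "x < a + d" for x
      using d(2)[of x] that by (auto simp: dist_real_def)
    show ?thesis
      by (intro exI[of _ d] conjI allI impI poly_sgn_const nz d)
        (auto simp: min_def max_def split: if_splits)
  qed (auto intro: exI[of _ 1])
  then obtain d where d: "d > 0"
    "\<And>x y. a < x \<Longrightarrow> x < a + d \<Longrightarrow> a < y \<Longrightarrow> y < a + d \<Longrightarrow> sgn (poly p x) = sgn (poly p y)"
    "\<And>x y. a - d < x \<Longrightarrow> x < a \<Longrightarrow> a - d < y \<Longrightarrow> y < a \<Longrightarrow> sgn (poly p x) = sgn (poly p y)"
    by metis
  have ev: "eventually (\<lambda>x. a < x \<and> x < a + d) (at_right a)" "eventually (\<lambda>x. a - d < x \<and> x < a) (at_left a)"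
    using d(1) eventually_at_right_real[of a "a + d"] eventually_at_left_real[of "a - d" a] by simp_all
  have 1: "poly p x > 0 \<longleftrightarrow> poly p (a + d / 2) > 0" if "a < x \<and> x < a + d" for x
  proof -
    have "sgn (poly p x) = sgn (poly p (a + d / 2))" using d(1) that by (intro d(2)) auto
    then show ?thesis by (metis sgn_1_pos)
  qed
  have 2: "poly p x > 0 \<longleftrightarrow> poly p (a - d / 2) > 0" if "a - d < x \<and> x < a" for x
  proof -
    have "sgn (poly p x) = sgn (poly p (a - d / 2))" using d(1) that by (intro d(3)) auto
    then show ?thesis by (metis sgn_1_pos)
  qed
  show "decided (at_right a) (\<lambda>x. poly p x > 0)" "decided (at_left a) (\<lambda>x. poly p x > 0)"
    using decided_const[OF ev(1) 1] decided_const[OF ev(2) 2] by auto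
qed

lemma semialgebraic_decided:
  fixes a :: real
  assumes "semialgebraic {x. P x}"
  shows "decided (at_right a) P" "decided (at_left a) P"
proof -
  obtain A where A: "qf A" "\<And>x. P x \<longleftrightarrow> A (coords x)"
    using semialgebraic_imp_qf[OF assms] by auto
  have "decided (at_right a) (\<lambda>x. A (coords x)) \<and> decided (at_left a) (\<lambda>x. A (coords x))"
    using A(1)
  proof (induction rule: qf.induct)
    case (qf_pos p)
    then obtain q where "(\<lambda>x::real. p (coords x)) = poly q"
      using poly_function_eq_poly[OF pol_coords] by metis
    then have "\<And>x::real. p (coords x) = poly q x" by metis
    then show ?case using decided_poly by simp
  qed (auto intro: decided_not decided_conj)
  then show "decided (at_right a) P" "decided (at_left a) P" by (simp_all add: A(2)[abs_def])
qed

subsection \<open>Semialgebraic functions of one variable\<close>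

text \<open>Strict local minima are countable: a rational interval on which the minimum is strict
  determines it, since two minima that share such an interval would each lie below the
  other.\<close>

lemma uncountable_not_strict_min:
  fixes h :: "real \<Rightarrow> real"
  assumes "a < b"
    "\<And>r. a < r \<Longrightarrow> r < b \<Longrightarrow> \<exists>d>0. \<forall>s. s \<noteq> r \<longrightarrow> \<bar>s - r\<bar> < d \<longrightarrow> h r < h s"
  shows False
proof -
  have "\<exists>p q :: rat. of_rat p < r \<and> r < of_rat q \<and>
      (\<forall>s. of_rat p < s \<and> s < of_rat q \<and> s \<noteq> r \<longrightarrow> h r < h s)" if "r \<in> {a<..<b}" for r
  proof -
    have "a < r" "r < b" using that by auto
    from assms(2)[OF this] obtain d
      where d: "d > 0" "\<And>s. s \<noteq> r \<Longrightarrow> \<bar>s - r\<bar> < d \<Longrightarrow> h r < h s" by blast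
    obtain p where "r - d < of_rat p" "of_rat p < r" using of_rat_dense[of "r - d" r] d(1) by auto
    moreover obtain q where "r < of_rat q" "of_rat q < r + d" using of_rat_dense[of r "r + d"] d(1) by auto
    ultimately show ?thesis by (intro exI[of _ p] exI[of _ q] conjI allI impI d(2)) auto
  qed
  then obtain p q :: "real \<Rightarrow> rat" where pq: "\<And>r. r \<in> {a<..<b} \<Longrightarrow> of_rat (p r) < r"
    "\<And>r. r \<in> {a<..<b} \<Longrightarrow> r < of_rat (q r)"
    "\<And>r s. r \<in> {a<..<b} \<Longrightarrow> of_rat (p r) < s \<Longrightarrow> s < of_rat (q r) \<Longrightarrow> s \<noteq> r \<Longrightarrow> h r < h s"
    by metis
  have "inj_on (\<lambda>r. (p r, q r)) {a<..<b}"
  proof (rule inj_onI, rule ccontr)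
    fix r s assume *: "r \<in> {a<..<b}" "s \<in> {a<..<b}" "(p r, q r) = (p s, q s)" "r \<noteq> s"
    then have "h r < h s" using pq(1,2)[OF *(2)] by (intro pq(3)) auto
    moreover have "h s < h r" using * pq(1,2)[OF *(1)] by (intro pq(3)) auto
    ultimately show False by simp
  qed
  then have "countable {a<..<b}" by (rule countableI')
  then show False using uncountable_open_interval assms(1) by blast
qed

text \<open>The germ of \<open>h\<close> to the right (\<open>\<sigma> = 1\<close>) or left (\<open>\<sigma> = -1\<close>) of \<open>r\<close> compared with \<open>h r\<close>.\<close>

definition near :: "real \<Rightarrow> (real \<Rightarrow> real \<Rightarrow> bool) \<Rightarrow> (real \<Rightarrow> real) \<Rightarrow> real \<Rightarrow> bool" where
  "near \<sigma> R h r \<longleftrightarrow> (\<exists>d>0. \<forall>s. 0 < \<sigma> * (s - r) \<and> \<sigma> * (s - r) < d \<longrightarrow> R (h r) (h s))"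

text \<open>Bolzano's bisection principle glues the local comparisons: a short interval around
  \<open>r\<close> splits at \<open>r\<close> into two pieces, each handled by one of the
  hypotheses.\<close>

lemma local_imp_mono:
  fixes h :: "real \<Rightarrow> real"
  assumes "\<And>r. a < r \<Longrightarrow> r < b \<Longrightarrow> near 1 (\<le>) h r" "\<And>r. a < r \<Longrightarrow> r < b \<Longrightarrow> near (-1) (\<ge>) h r"
  shows "mono_on {a<..<b} h"
proof (rule mono_onI)
  fix x y assume xy: "x \<in> {a<..<b}" "y \<in> {a<..<b}" "x \<le> y"
  have "x \<le> x \<longrightarrow> y \<le> y \<longrightarrow> h x \<le> h y"
  proof (rule Bolzano[of x y "\<lambda>u v. x \<le> u \<longrightarrow> v \<le> y \<longrightarrow> h u \<le> h v"])
    fix r assume "x \<le> r" "r \<le> y"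
    then have r: "a < r" "r < b" using xy by auto
    obtain d where d: "d > 0" "\<And>s. r < s \<Longrightarrow> s < r + d \<Longrightarrow> h r \<le> h s"
      using assms(1)[OF r] by (auto simp: near_def algebra_simps)
    obtain d' where d': "d' > 0" "\<And>s. s < r \<Longrightarrow> r < s + d' \<Longrightarrow> h s \<le> h r"
      using assms(2)[OF r] by (auto simp: near_def algebra_simps)
    have "h u \<le> h v" if "u \<le> r" "r \<le> v" "v - u < min d d'" for u v
    proof -
      have "h u \<le> h r" using d'(2)[of u] that by (cases "u = r") auto
      moreover have "h r \<le> h v" using d(2)[of v] that by (cases "v = r") auto
      ultimately show ?thesis by simp
    qed
    then show "\<exists>d>0. \<forall>u v. u \<le> r \<and> r \<le> v \<and> v - u < d \<longrightarrow> x \<le> u \<longrightarrow> v \<le> y \<longrightarrow> h u \<le> h v"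
      using d(1) d'(1) by (intro exI[of _ "min d d'"]) auto
  qed (use xy in auto)
  then show "h x \<le> h y" by simp
qed

text \<open>If \<open>h\<close> is constant just beyond \<open>r\<close> on the side \<sigma>, a
  point \<open>t\<close> of that stretch looks back over values equal to its own, which an
  irreflexive \<open>R\<close> rules out.\<close>

lemma near_irrefl:
  assumes "a < b" "\<And>r. a < r \<Longrightarrow> r < b \<Longrightarrow> near \<sigma> (=) h r" "\<And>r. a < r \<Longrightarrow> r < b \<Longrightarrow> near (- \<sigma>) R h r"
    "\<sigma> = 1 \<or> \<sigma> = -1" "\<And>y. \<not> R y y"
  shows False
proof -
  define r where "r = (a + b) / 2"
  have r: "a < r" "r < b" using assms(1) by (auto simp: r_def field_simps)
  obtain d where d: "d > 0" "\<And>s. 0 < \<sigma> * (s - r) \<Longrightarrow> \<sigma> * (s - r) < d \<Longrightarrow> h r = h s"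
    using assms(2)[OF r] by (auto simp: near_def)
  define d1 where "d1 = Min {d, (b - r), (r - a)}"
  have d1: "0 < d1" "d1 \<le> d" "d1 \<le> b - r" "d1 \<le> r - a" using d(1) r by (auto simp: d1_def)
  define t where "t = r + \<sigma> * (d1 / 2)"
  have "a < t" "t < b" using assms(4) d1 by (auto simp: t_def)
  then obtain e where e: "e > 0" "\<And>s. 0 < - \<sigma> * (s - t) \<Longrightarrow> - \<sigma> * (s - t) < e \<Longrightarrow> R (h t) (h s)"
    using assms(3)[of t] by (auto simp: near_def)
  define s where "s = t - \<sigma> * (min (d1 / 4) (e / 2))"
  have m: "0 < min (d1 / 4) (e / 2)" "min (d1 / 4) (e / 2) < e" "min (d1 / 4) (e / 2) \<le> d1 / 4"
    using d1 e(1) by auto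
  have "R (h t) (h s)" using assms(4) m by (intro e(2)) (auto simp: s_def)
  moreover have "h r = h t" using assms(4) d1 by (intro d(2)) (auto simp: t_def)
  moreover have "h r = h s" using assms(4) d1 m by (intro d(2)) (auto simp: s_def t_def)
  ultimately show False using assms(5) by simp
qed

text \<open>Each point has one of the germs \<open><\<close>, \<open>>\<close>, \<open>=\<close> on
  each side, and near 0 the same pair occurs throughout, because these conditions are semialgebraic.
  Equal strict germs on both sides would make every point a strict extremum, against countability; a
  strict germ opposite an equality is contradictory; every other pair makes \<open>h\<close>
  monotone. Discontinuities of a monotone function are countable, and as continuity is a
  semialgebraic condition, they are absent near 0.\<close>

theorem semialgebraic_eventually_monotone:
  fixes h :: "real \<Rightarrow> real"
  assumes "0 < \<epsilon>" and sa: "semialgebraic {(r, y). 0 < r \<and> r < \<epsilon> \<and> y = h r}"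
  obtains \<delta> where "0 < \<delta>" "\<delta> \<le> \<epsilon>" "mono_on {0<..<\<delta>} h \<or> mono_on {0<..<\<delta>} (\<lambda>r. - h r)"
    "continuous_on {0<..<\<delta>} h"
proof -
  let ?G = "{(r, y). 0 < r \<and> r < \<epsilon> \<and> y = h r}"
  \<comment> \<open>\<open>near\<close> rewritten through points of the graph \<open>?G\<close>, the
    form to which the closure rules for semialgebraic sets apply.\<close>
  define nr where "nr \<sigma> R r \<longleftrightarrow> (\<exists>d. 0 < d \<and> (\<forall>s. 0 < \<sigma> * (s - r) \<and> \<sigma> * (s - r) < d \<longrightarrow>
      (\<exists>y y'. (r, y) \<in> ?G \<and> (s, y') \<in> ?G \<and> R y y')))" for \<sigma> :: real and R r
  have nr_near: "near \<sigma> R h r" if "nr \<sigma> R r" for \<sigma> R r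
  proof -
    from that[unfolded nr_def] obtain d where d: "0 < d"
      "\<forall>s. 0 < \<sigma> * (s - r) \<and> \<sigma> * (s - r) < d \<longrightarrow>
        (\<exists>y y'. (r, y) \<in> ?G \<and> (s, y') \<in> ?G \<and> R y y')" by iprover
    show ?thesis unfolding near_def
    proof (intro exI[of _ d] conjI d allI impI)
      fix s assume "0 < \<sigma> * (s - r) \<and> \<sigma> * (s - r) < d"
      from d(2)[rule_format, OF this] show "R (h r) (h s)" by auto
    qed
  qed
  have sa_nr: "semialgebraic {r. nr \<sigma> (<) r}" "semialgebraic {r. nr \<sigma> (>) r}" "semialgebraic {r. nr \<sigma> (=) r}" for \<sigma>
    unfolding nr_def by (intro sa_intros sa pf_intros)+
  have one: "nr \<sigma> (<) r \<or> nr \<sigma> (>) r \<or> nr \<sigma> (=) r" if r: "0 < r" "r < \<epsilon>" and \<sigma>: "\<sigma> = 1 \<or> \<sigma> = -1" for \<sigma> r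
  proof -
    define F where "F = (if \<sigma> = 1 then at_right r else at_left r)"
    have F: "eventually P F \<longleftrightarrow> (\<exists>d>0. \<forall>s. 0 < \<sigma> * (s - r) \<and> \<sigma> * (s - r) < d \<longrightarrow> P s)" for P
    proof (cases "\<sigma> = 1")
      case True
      have "eventually P F \<longleftrightarrow> (\<exists>b>r. \<forall>y>r. y < b \<longrightarrow> P y)"
        using True by (simp add: F_def eventually_at_right_field)
      also have "\<dots> \<longleftrightarrow> (\<exists>d>0. \<forall>s. 0 < s - r \<and> s - r < d \<longrightarrow> P s)"
        by (auto intro: exI[of _ "_ - r"] exI[of _ "r + _"])
      finally show ?thesis using True by simp
    next
      case False
      have "eventually P F \<longleftrightarrow> (\<exists>b<r. \<forall>y>b. y < r \<longrightarrow> P y)"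
        using False by (simp add: F_def eventually_at_left_field)
      also have "\<dots> \<longleftrightarrow> (\<exists>d>0. \<forall>s. 0 < r - s \<and> r - s < d \<longrightarrow> P s)"
        by (auto intro: exI[of _ "r - _"])
      finally show ?thesis using False \<sigma> by simp
    qed
    have inG: "\<exists>d>0. \<forall>s. 0 < \<sigma> * (s - r) \<and> \<sigma> * (s - r) < d \<longrightarrow> 0 < s \<and> s < \<epsilon>"
      using r \<sigma> by (intro exI[of _ "min r (\<epsilon> - r)"]) auto
    have nrF: "nr \<sigma> R r \<longleftrightarrow> eventually (\<lambda>s. \<exists>y y'. (r, y) \<in> ?G \<and> (s, y') \<in> ?G \<and> R y y') F" for R
      unfolding F nr_def ..
    have dec: "decided F (\<lambda>s. \<exists>y y'. (r, y) \<in> ?G \<and> (s, y') \<in> ?G \<and> y < y')"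
      "decided F (\<lambda>s. \<exists>y y'. (r, y) \<in> ?G \<and> (s, y') \<in> ?G \<and> y > y')"
      unfolding F_def
      by (cases "\<sigma> = 1"; simp only: if_True if_False simp_thms;
          intro semialgebraic_decided sa_intros sa pf_intros)+
    show ?thesis
    proof (rule ccontr)
      assume "\<not> (nr \<sigma> (<) r \<or> nr \<sigma> (>) r \<or> nr \<sigma> (=) r)"
      then have 1: "\<not> nr \<sigma> (<) r" "\<not> nr \<sigma> (>) r" "\<not> nr \<sigma> (=) r" by auto
      have "eventually (\<lambda>s. \<not> (\<exists>y y'. (r, y) \<in> ?G \<and> (s, y') \<in> ?G \<and> y < y')) F"
        "eventually (\<lambda>s. \<not> (\<exists>y y'. (r, y) \<in> ?G \<and> (s, y') \<in> ?G \<and> y > y')) F"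
        using dec 1(1,2) unfolding nrF decided_def by blast+
      moreover have "eventually (\<lambda>s. 0 < s \<and> s < \<epsilon>) F" unfolding F by (rule inG)
      ultimately have "eventually (\<lambda>s. \<exists>y y'. (r, y) \<in> ?G \<and> (s, y') \<in> ?G \<and> y = y') F"
      proof eventually_elim
        case (elim s)
        then show ?case using r by (auto simp: not_less)
      qed
      then show False using 1(3) unfolding nrF by blast
    qed
  qed
  have pick: "\<exists>R. (R = (<) \<or> R = (>) \<or> R = (=)) \<and> eventually (nr \<sigma> R) (at_right 0)"
    if \<sigma>: "\<sigma> = 1 \<or> \<sigma> = -1" for \<sigma>
  proof (rule ccontr)
    assume "\<not> ?thesis"
    then have "eventually (\<lambda>r. \<not> nr \<sigma> (<) r) (at_right 0)" "eventually (\<lambda>r. \<not> nr \<sigma> (>) r) (at_right 0)"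
      "eventually (\<lambda>r. \<not> nr \<sigma> (=) r) (at_right 0)"
      using sa_nr[THEN semialgebraic_decided(1)] unfolding decided_def by blast+
    moreover have "eventually (\<lambda>r. r \<in> {0<..<\<epsilon>}) (at_right 0)"
      using eventually_at_right_real[OF assms(1)] .
    ultimately have "eventually (\<lambda>r. False) (at_right (0::real))"
      by eventually_elim (use one[OF _ _ \<sigma>] in auto)
    then show False by simp
  qed
  obtain R1 where R1: "R1 = (<) \<or> R1 = (>) \<or> R1 = (=)" "eventually (nr 1 R1) (at_right 0)"
    using pick[of 1] by auto
  obtain R2 where R2: "R2 = (<) \<or> R2 = (>) \<or> R2 = (=)" "eventually (nr (-1) R2) (at_right 0)"
    using pick[of "-1"] by auto
  have "eventually (\<lambda>r. r \<in> {0<..<\<epsilon>} \<and> nr 1 R1 r \<and> nr (-1) R2 r) (at_right 0)"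
    using eventually_conj[OF eventually_at_right_real[OF assms(1)] eventually_conj[OF R1(2) R2(2)]] .
  then obtain b where b: "b > 0" "\<And>r. 0 < r \<Longrightarrow> r < b \<Longrightarrow> r \<in> {0<..<\<epsilon>} \<and> nr 1 R1 r \<and> nr (-1) R2 r"
    unfolding eventually_at_right_field by blast
  have b\<epsilon>: "b \<le> \<epsilon>"
    using b(2)[of \<epsilon>] assms(1) by (auto simp: not_less[symmetric])
  have n1: "near 1 R1 h r" and n2: "near (-1) R2 h r" if "0 < r" "r < b" for r
    using b(2)[OF that] nr_near by auto
  have mono: "mono_on {0<..<b} h \<or> mono_on {0<..<b} (\<lambda>r. - h r)"
  proof -
    have weak: "near \<sigma> R' h' r" if "near \<sigma> R h r" "\<And>x y. R (h x) (h y) \<Longrightarrow> R' (h' x) (h' y)" for \<sigma> R R' h' r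
      using that unfolding near_def by blast
    have nomin: "\<not> (R1 = (<) \<and> R2 = (<))" "\<not> (R1 = (>) \<and> R2 = (>))"
    proof -
      have two: "\<exists>d>0. \<forall>s. s \<noteq> r \<longrightarrow> \<bar>s - r\<bar> < d \<longrightarrow> R (h r) (h s)"
        if ne: "near 1 R h r" "near (-1) R h r" for R r
      proof -
        obtain d d' where "d > 0" "d' > 0" "\<And>s. 0 < s - r \<Longrightarrow> s - r < d \<Longrightarrow> R (h r) (h s)"
          "\<And>s. 0 < r - s \<Longrightarrow> r - s < d' \<Longrightarrow> R (h r) (h s)"
          using ne unfolding near_def by auto
        then show ?thesis by (intro exI[of _ "min d d'"]) (auto simp: abs_if split: if_splits)
      qed
      show "\<not> (R1 = (<) \<and> R2 = (<))"
        using uncountable_not_strict_min[OF b(1), of h] two n1 n2 by blast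
      show "\<not> (R1 = (>) \<and> R2 = (>))"
        using uncountable_not_strict_min[OF b(1), of "\<lambda>r. - h r"] two[of "(>)"] n1 n2
        unfolding neg_less_iff_less by blast
    qed
    have noeq: "R1 = (=) \<longleftrightarrow> R2 = (=)"
    proof
      assume "R1 = (=)"
      then show "R2 = (=)" using near_irrefl[OF b(1), of 1 h R2] n1 n2 R2(1) by auto
    next
      assume "R2 = (=)"
      then show "R1 = (=)" using near_irrefl[OF b(1), of "-1" h R1] n1 n2 R1(1) by auto
    qed
    consider "R1 = (=)" "R2 = (=)" | "R1 = (<)" "R2 = (>)" | "R1 = (>)" "R2 = (<)"
      using R1(1) R2(1) nomin noeq by metis
    then show ?thesis
    proof cases
      case 1
      have "mono_on {0<..<b} h"
      proof (rule local_imp_mono)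
        fix r assume r: "0 < r" "r < b"
        show "near 1 (\<le>) h r" by (rule weak[OF n1[OF r]]) (simp add: 1)
        show "near (-1) (\<ge>) h r" by (rule weak[OF n2[OF r]]) (simp add: 1)
      qed
      then show ?thesis ..
    next
      case 2
      have "mono_on {0<..<b} h"
      proof (rule local_imp_mono)
        fix r assume r: "0 < r" "r < b"
        show "near 1 (\<le>) h r" by (rule weak[OF n1[OF r]]) (simp add: 2)
        show "near (-1) (\<ge>) h r" by (rule weak[OF n2[OF r]]) (simp add: 2)
      qed
      then show ?thesis ..
    next
      case 3
      have "mono_on {0<..<b} (\<lambda>r. - h r)"
      proof (rule local_imp_mono)
        fix r assume r: "0 < r" "r < b"
        show "near 1 (\<le>) (\<lambda>r. - h r) r" by (rule weak[OF n1[OF r]]) (simp add: 3)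
        show "near (-1) (\<ge>) (\<lambda>r. - h r) r" by (rule weak[OF n2[OF r]]) (simp add: 3)
      qed
      then show ?thesis ..
    qed
  qed
  \<comment> \<open>Continuity in the same graph form, with absolute values split into two
    inequalities.\<close>
  define C where "C r \<longleftrightarrow> (\<forall>e. 0 < e \<longrightarrow> (\<exists>d. 0 < d \<and> (\<forall>s. s - r < d \<and> r - s < d \<longrightarrow>
    (\<exists>y y'. (r, y) \<in> ?G \<and> (s, y') \<in> ?G \<and> y - y' < e \<and> y' - y < e))))" for r
  have "semialgebraic {r. C r}" unfolding C_def by (intro sa_intros sa pf_intros)
  then have decC: "decided (at_right 0) C" by (rule semialgebraic_decided)
  have C_iff: "C r \<longleftrightarrow> continuous (at r) h" if r: "0 < r" "r < \<epsilon>" for r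
  proof
    assume Cr: "C r"
    show "continuous (at r) h" unfolding continuous_at_eps_delta
    proof (intro allI impI)
      fix e :: real assume "0 < e"
      from Cr[unfolded C_def, rule_format, OF this] obtain d where d: "0 < d"
        "\<forall>s. s - r < d \<and> r - s < d \<longrightarrow>
          (\<exists>y y'. (r, y) \<in> ?G \<and> (s, y') \<in> ?G \<and> y - y' < e \<and> y' - y < e)" by iprover
      show "\<exists>d>0. \<forall>s. dist s r < d \<longrightarrow> dist (h s) (h r) < e"
      proof (intro exI[of _ d] conjI d allI impI)
        fix s assume "dist s r < d"
        then have "s - r < d \<and> r - s < d" by (simp add: dist_real_def abs_less_iff)
        from d(2)[rule_format, OF this] show "dist (h s) (h r) < e"
          by (auto simp: dist_real_def abs_less_iff)
      qed
    qed
  next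
    assume c: "continuous (at r) h"
    show "C r" unfolding C_def
    proof (intro allI impI)
      fix e :: real assume "0 < e"
      then obtain d where d: "d > 0" "\<And>s. dist s r < d \<Longrightarrow> dist (h s) (h r) < e"
        using c unfolding continuous_at_eps_delta by blast
      show "\<exists>d. 0 < d \<and> (\<forall>s. s - r < d \<and> r - s < d \<longrightarrow>
        (\<exists>y y'. (r, y) \<in> ?G \<and> (s, y') \<in> ?G \<and> y - y' < e \<and> y' - y < e))"
      proof (rule exI[of _ "Min {d, r, \<epsilon> - r}"], intro conjI allI impI)
        show "0 < Min {d, r, \<epsilon> - r}" using d r by auto
        fix s assume s: "s - r < Min {d, r, \<epsilon> - r} \<and> r - s < Min {d, r, \<epsilon> - r}"
        then have "dist (h s) (h r) < e" by (intro d(2)) (auto simp: dist_real_def)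
        then show "\<exists>y y'. (r, y) \<in> ?G \<and> (s, y') \<in> ?G \<and> y - y' < e \<and> y' - y < e"
          using r s by (auto simp: dist_real_def abs_less_iff)
      qed
    qed
  qed
  have "eventually C (at_right 0)"
  proof (rule ccontr)
    assume "\<not> ?thesis"
    then have "eventually (\<lambda>r. \<not> C r) (at_right 0)" using decC unfolding decided_def by blast
    then obtain c where c: "c > 0" "\<And>r. 0 < r \<Longrightarrow> r < c \<Longrightarrow> \<not> C r"
      unfolding eventually_at_right_field by blast
    let ?I = "{0<..<b}"
    have *: "countable {r\<in>?I. \<not> continuous (at r) h}"
      using mono
    proof
      assume "mono_on ?I h"
      from mono_on_ctble_discont_open[OF open_greaterThanLessThan this] show ?thesis by simp
    next
      assume "mono_on ?I (\<lambda>r. - h r)"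
      from mono_on_ctble_discont_open[OF open_greaterThanLessThan this]
      have "countable {r\<in>?I. \<not> continuous (at r) (\<lambda>r. - h r)}" by simp
      moreover have "continuous (at r) (\<lambda>r. - h r) \<longleftrightarrow> continuous (at r) h" for r
        using continuous_minus[of "at r" h] continuous_minus[of "at r" "\<lambda>r. - h r"] by auto
      ultimately show ?thesis by simp
    qed
    have "{0<..<min b c} \<subseteq> {r\<in>?I. \<not> continuous (at r) h}"
    proof
      fix r assume "r \<in> {0<..<min b c}"
      with c(2)[of r] C_iff[of r] b\<epsilon> show "r \<in> {r\<in>?I. \<not> continuous (at r) h}" by simp
    qed
    then have "countable {0<..<min b c}" using * countable_subset by blast
    then show False using uncountable_open_interval[of 0 "min b c"] b(1) c(1) by auto
  qed
  then obtain c where c: "c > 0" "\<And>r. 0 < r \<Longrightarrow> r < c \<Longrightarrow> C r"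
    unfolding eventually_at_right_field by blast
  show thesis
  proof (rule that[of "min b c"])
    show "mono_on {0<..<min b c} h \<or> mono_on {0<..<min b c} (\<lambda>r. - h r)"
      using mono by (auto intro: mono_on_subset)
    have "isCont h r" if "r \<in> {0<..<min b c}" for r
      using c(2)[of r] C_iff[of r] b\<epsilon> that by simp
    then show "continuous_on {0<..<min b c} h"
      by (simp add: continuous_at_imp_continuous_on)
  qed (use b(1) c(1) b\<epsilon> in auto)
qed

subsection \<open>A Kurdyka--Lojasiewicz inequality\<close>

lemma pf_comp:
  "polynomial_function p \<Longrightarrow> polynomial_function f \<Longrightarrow> polynomial_function (\<lambda>x. p (f x))"
  using polynomial_function_compose[of f p] by (simp add: o_def)

definition fibre :: "(real \<times> 'a) set \<Rightarrow> real \<Rightarrow> 'a set" where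
  "fibre K r = {P. (r, P) \<in> K}"

definition minimisers :: "(real \<times> 'a) set \<Rightarrow> ('a \<Rightarrow> real) \<Rightarrow> (real \<times> 'a) set" where
  "minimisers K p = {z. z \<in> K \<and> (\<forall>Q. (fst z, Q) \<in> K \<longrightarrow> p (snd z) \<le> p Q)}"

lemma minimisers:
  fixes K :: "(real \<times> 'a::euclidean_space) set"
  assumes K: "semialgebraic K" "\<And>r. compact (fibre K r)" and p: "polynomial_function p"
  shows "semialgebraic (minimisers K p)" "compact (fibre (minimisers K p) r)"
    "fibre K r \<noteq> {} \<Longrightarrow> fibre (minimisers K p) r \<noteq> {}"
proof -
  have cont: "continuous_on S p" for S by (rule continuous_on_polymonial_function[OF p])
  show "semialgebraic (minimisers K p)"
    unfolding minimisers_def by (intro sa_intros K pf_comp[OF p] pf_intros)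
  show "fibre (minimisers K p) r \<noteq> {}" if "fibre K r \<noteq> {}"
    using continuous_attains_inf[OF K(2) that cont] by (auto simp: fibre_def minimisers_def)
  show "compact (fibre (minimisers K p) r)"
  proof (cases "fibre (minimisers K p) r = {}")
    case False
    then obtain P0 where P0: "(r, P0) \<in> K" "\<And>Q. (r, Q) \<in> K \<Longrightarrow> p P0 \<le> p Q"
      by (auto simp: fibre_def minimisers_def)
    have "fibre (minimisers K p) r = fibre K r \<inter> {P. p P \<le> p P0}"
      using P0 by (auto simp: fibre_def minimisers_def intro: order.trans)
    moreover have "closed {P. p P \<le> p P0}"
      by (intro closed_Collect_le continuous_intros cont)
    ultimately show ?thesis using K(2) by (simp add: compact_Int_closed)
  qed simp
qed

lemma minimisers_eq:
  "(r, P) \<in> minimisers K p \<Longrightarrow> (r, Q) \<in> minimisers K p \<Longrightarrow> p P = p Q"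
  by (auto simp: minimisers_def intro: antisym)

text \<open>Definable choice for compact fibres: the lexicographic minimum.\<close>

lemma semialgebraic_selection:
  fixes K :: "(real \<times> 'a::euclidean_space) set"
  assumes K: "semialgebraic K" "\<And>r. compact (fibre K r)"
  obtains w where "\<And>r. fibre K r \<noteq> {} \<Longrightarrow> (r, w r) \<in> K"
    "\<And>(p :: 'a \<Rightarrow> real) \<epsilon>. polynomial_function p \<Longrightarrow> (\<And>r. 0 < r \<Longrightarrow> r < \<epsilon> \<Longrightarrow> fibre K r \<noteq> {}) \<Longrightarrow>
      semialgebraic {(r, y). 0 < r \<and> r < \<epsilon> \<and> y = p (w r)}"
proof -
  have "\<exists>K'. semialgebraic K' \<and> (\<forall>r. compact (fibre K' r)) \<and> K' \<subseteq> K \<and>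
    (\<forall>r. fibre K r \<noteq> {} \<longrightarrow> fibre K' r \<noteq> {}) \<and>
    (\<forall>r P Q. (r, P) \<in> K' \<longrightarrow> (r, Q) \<in> K' \<longrightarrow> (\<forall>b\<in>B. P \<bullet> b = Q \<bullet> b))"
    if "finite B" for B :: "'a set"
    using that
  proof (induction B rule: finite_induct)
    case empty
    then show ?case using K by (intro exI[of _ K]) auto
  next
    case (insert b B)
    then obtain K' where K': "semialgebraic K'" "\<And>r. compact (fibre K' r)" "K' \<subseteq> K"
      "\<And>r. fibre K r \<noteq> {} \<Longrightarrow> fibre K' r \<noteq> {}"
      "\<And>r P Q b. (r, P) \<in> K' \<Longrightarrow> (r, Q) \<in> K' \<Longrightarrow> b \<in> B \<Longrightarrow> P \<bullet> b = Q \<bullet> b"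
      by blast
    have p: "polynomial_function (\<lambda>P. P \<bullet> b)" by (intro pf_intros)
    note m = minimisers[OF K'(1,2) p]
    have sub: "minimisers K' (\<lambda>P. P \<bullet> b) \<subseteq> K'" by (auto simp: minimisers_def)
    show ?case
    proof (intro exI conjI allI impI)
      show "semialgebraic (minimisers K' (\<lambda>P. P \<bullet> b))" by (rule m)
      show "minimisers K' (\<lambda>P. P \<bullet> b) \<subseteq> K" using sub K'(3) by blast
      fix r
      show "compact (fibre (minimisers K' (\<lambda>P. P \<bullet> b)) r)" by (rule m)
      show "fibre (minimisers K' (\<lambda>P. P \<bullet> b)) r \<noteq> {}" if "fibre K r \<noteq> {}"
        using m(3) K'(4) that by blast
      show "\<forall>c\<in>insert b B. P \<bullet> c = Q \<bullet> c"
        if "(r, P) \<in> minimisers K' (\<lambda>P. P \<bullet> b)" "(r, Q) \<in> minimisers K' (\<lambda>P. P \<bullet> b)" for P Q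
        using minimisers_eq[OF that] K'(5) that sub by blast
    qed
  qed
  from this[OF finite_Basis] obtain K' where K': "semialgebraic K'" "K' \<subseteq> K"
    "\<And>r. fibre K r \<noteq> {} \<Longrightarrow> fibre K' r \<noteq> {}"
    "\<And>r P Q b. (r, P) \<in> K' \<Longrightarrow> (r, Q) \<in> K' \<Longrightarrow> b \<in> Basis \<Longrightarrow> P \<bullet> b = Q \<bullet> b"
    by blast
  \<comment> \<open>Each fibre of \<open>K'\<close> has at most one point, so the choice is forced
    and the graph of \<open>w\<close> can be described through \<open>K'\<close>.\<close>
  define w where "w r = (SOME P. (r, P) \<in> K')" for r
  have w: "(r, w r) \<in> K'" if ne: "fibre K r \<noteq> {}" for r
  proof -
    obtain P where "(r, P) \<in> K'" using K'(3)[OF ne] by (auto simp: fibre_def)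
    then show ?thesis unfolding w_def by (rule someI)
  qed
  show thesis
  proof (rule that[of w])
    show "(r, w r) \<in> K" if "fibre K r \<noteq> {}" for r using w[OF that] K'(2) by blast
    fix p :: "'a \<Rightarrow> real" and \<epsilon>
    assume p: "polynomial_function p" and ne: "\<And>r. 0 < r \<Longrightarrow> r < \<epsilon> \<Longrightarrow> fibre K r \<noteq> {}"
    have "{(r, y). 0 < r \<and> r < \<epsilon> \<and> y = p (w r)} =
      {z. 0 < fst z \<and> fst z < \<epsilon> \<and> (\<exists>P. (fst z, P) \<in> K' \<and> snd z = p P)}"
    proof (intro set_eqI iffI)
      fix z assume "z \<in> {(r, y). 0 < r \<and> r < \<epsilon> \<and> y = p (w r)}"
      then obtain r where "z = (r, p (w r))" "0 < r" "r < \<epsilon>" by auto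
      then show "z \<in> {z. 0 < fst z \<and> fst z < \<epsilon> \<and> (\<exists>P. (fst z, P) \<in> K' \<and> snd z = p P)}"
        using w[OF ne] by auto
    next
      fix z assume "z \<in> {z. 0 < fst z \<and> fst z < \<epsilon> \<and> (\<exists>P. (fst z, P) \<in> K' \<and> snd z = p P)}"
      then obtain P where z: "0 < fst z" "fst z < \<epsilon>" "(fst z, P) \<in> K'" "snd z = p P" by auto
      have "P = w (fst z)"
        using K'(4)[OF z(3) w[OF ne[OF z(1,2)]]] by (auto intro: euclidean_eqI)
      then show "z \<in> {(r, y). 0 < r \<and> r < \<epsilon> \<and> y = p (w r)}" using z by (auto simp: case_prod_beta)
    qed
    then show "semialgebraic {(r, y). 0 < r \<and> r < \<epsilon> \<and> y = p (w r)}"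
      by (simp only:) (intro sa_intros K' pf_comp[OF p] pf_intros)
  qed
qed

text \<open>The linear part of \<open>step\<close> adds up over a subdivision, and the quadratic
  part becomes negligible: by continuity the increments of \<open>V\<close> are small, so
  \<open>C\<close> times their square is at most \<eta> times the increment. Bolzano's principle
  replaces an explicit subdivision, and \<eta> is removed at the end.\<close>

lemma monotone_length_bound:
  fixes V :: "real \<Rightarrow> real"
  assumes "r1 \<le> r2" "continuous_on {r1..r2} V" "mono_on {r1..r2} V" "0 \<le> C"
    and step: "\<And>u v. r1 \<le> u \<Longrightarrow> u \<le> v \<Longrightarrow> v \<le> r2 \<Longrightarrow> v - u \<le> A * (V v - V u) + C * (V v - V u)\<^sup>2"
  shows "r2 - r1 \<le> A * (V r2 - V r1)"
proof -
  have eta: "r2 - r1 \<le> (A + \<eta>) * (V r2 - V r1)" if "\<eta> > 0" for \<eta>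
  proof -
    have "r1 \<le> r1 \<longrightarrow> r2 \<le> r2 \<longrightarrow> r2 - r1 \<le> (A + \<eta>) * (V r2 - V r1)"
    proof (rule Bolzano[OF assms(1), of "\<lambda>u v. r1 \<le> u \<longrightarrow> v \<le> r2 \<longrightarrow> v - u \<le> (A + \<eta>) * (V v - V u)"])
      fix a b c assume "a \<le> b" "b \<le> c"
        "r1 \<le> a \<longrightarrow> b \<le> r2 \<longrightarrow> b - a \<le> (A + \<eta>) * (V b - V a)"
        "r1 \<le> b \<longrightarrow> c \<le> r2 \<longrightarrow> c - b \<le> (A + \<eta>) * (V c - V b)"
      then show "r1 \<le> a \<longrightarrow> c \<le> r2 \<longrightarrow> c - a \<le> (A + \<eta>) * (V c - V a)"
        by (auto simp: algebra_simps)
    next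
      fix r assume r: "r1 \<le> r" "r \<le> r2"
      \<comment> \<open>Increments of \<open>V\<close> close to \<open>r\<close> are at most
        \<open>2 * e\<close>, and \<open>C * (2 * e) \<le> \<eta>\<close>; the summand 1 covers
        \<open>C = 0\<close>.\<close>
      define e where "e = \<eta> / (2 * (C + 1))"
      have e: "e > 0" "C * (2 * e) \<le> \<eta>" using \<open>\<eta> > 0\<close> assms(4) by (auto simp: e_def field_simps)
      obtain d where d: "d > 0" "\<And>s. s \<in> {r1..r2} \<Longrightarrow> dist s r < d \<Longrightarrow> dist (V s) (V r) < e"
        using assms(2) r e(1) unfolding continuous_on_iff by (metis atLeastAtMost_iff)
      have "v - u \<le> (A + \<eta>) * (V v - V u)" if uv: "u \<le> r" "r \<le> v" "v - u < d" "r1 \<le> u" "v \<le> r2" for u v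
      proof -
        have "dist (V u) (V r) < e" "dist (V v) (V r) < e"
          using uv by (intro d(2); simp add: dist_real_def)+
        then have "V v - V u \<le> 2 * e" by (auto simp: dist_real_def)
        moreover have V0: "0 \<le> V v - V u" using mono_onD[OF assms(3), of u v] uv by simp
        ultimately have "C * (V v - V u) \<le> \<eta>"
          using e(2) mult_left_mono[of "V v - V u" "2 * e" C] assms(4) by linarith
        then have "C * (V v - V u)\<^sup>2 \<le> \<eta> * (V v - V u)"
          unfolding power2_eq_square mult.assoc[symmetric] using V0 by (rule mult_right_mono)
        then show ?thesis using step[of u v] uv by (simp add: algebra_simps)
      qed
      then show "\<exists>d>0. \<forall>u v. u \<le> r \<and> r \<le> v \<and> v - u < d \<longrightarrow>
          r1 \<le> u \<longrightarrow> v \<le> r2 \<longrightarrow> v - u \<le> (A + \<eta>) * (V v - V u)"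
        using d(1) by blast
    qed
    then show ?thesis by simp
  qed
  have V0: "0 \<le> V r2 - V r1" using mono_onD[OF assms(3), of r1 r2] assms(1) by simp
  show ?thesis
  proof (rule field_le_epsilon)
    fix e :: real assume "e > 0"
    define \<eta> where "\<eta> = e / (V r2 - V r1 + 1)"
    have "\<eta> > 0" "\<eta> * (V r2 - V r1) \<le> e" using \<open>e > 0\<close> V0 by (auto simp: \<eta>_def field_simps)
    then show "r2 - r1 \<le> A * (V r2 - V r1) + e" using eta[of \<eta>] by (simp add: algebra_simps)
  qed
qed

text \<open>A derivative-free Kurdyka--Lojasiewicz inequality: \<open>sqrt (q P)\<close> plays the role of the
  norm of a proximal subgradient of \<open>F\<close> at \<open>P\<close>. The function \<open>\<phi>\<close> is the signed
  coordinate sum along a semialgebraic curve that meets every level of \<open>F\<close> near \<open>0\<close>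
  at a point of minimal slope.\<close>

theorem semialgebraic_KL:
  fixes Z :: "'a::euclidean_space set" and F q :: "'a \<Rightarrow> real"
  assumes K: "semialgebraic {(r, P). P \<in> Z \<and> F P = r}"
    and comp: "\<And>r. compact {P\<in>Z. F P = r}" and bdd: "bounded Z"
    and q: "polynomial_function q" "\<And>P. 0 \<le> q P"
    and ineq: "\<And>P Q. P \<in> Z \<Longrightarrow> Q \<in> Z \<Longrightarrow>
      F P - F Q \<le> b * sqrt (q P) * norm (P - Q) + C * (norm (P - Q))\<^sup>2"
    and bC: "0 \<le> b" "0 \<le> C"
  obtains \<epsilon> \<phi> where "0 < \<epsilon>" "mono_on {0<..<\<epsilon>} \<phi>" "bounded (\<phi> ` {0<..<\<epsilon>})"
    "\<And>P s. P \<in> Z \<Longrightarrow> F P < \<epsilon> \<Longrightarrow> 0 < s \<Longrightarrow> s < F P \<Longrightarrow>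
      F P - s \<le> sqrt (q P) * (\<phi> (F P) - \<phi> s)"
proof -
  let ?K = "{(r, P). P \<in> Z \<and> F P = r}"
  have fK: "fibre ?K r = {P\<in>Z. F P = r}" for r by (auto simp: fibre_def)
  have cK: "\<And>r. compact (fibre ?K r)" unfolding fK by (rule comp)
  note M = minimisers[OF K cK q(1)]
  have "semialgebraic {r. \<exists>P. (r, P) \<in> ?K}" by (intro sa_intros K pf_intros)
  from semialgebraic_decided(1)[OF this, of 0]
  consider "eventually (\<lambda>r. \<not> (\<exists>P\<in>Z. F P = r)) (at_right 0)" | "eventually (\<lambda>r. \<exists>P\<in>Z. F P = r) (at_right 0)"
    unfolding decided_def by (auto simp: Bex_def)
  then show thesis
  proof cases
    case 1
    \<comment> \<open>No point of \<open>Z\<close> has a small positive value, so the inequality is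
      vacuous.\<close>
    then obtain \<epsilon> where \<epsilon>: "\<epsilon> > 0" "\<And>r. 0 < r \<Longrightarrow> r < \<epsilon> \<Longrightarrow> \<not> (\<exists>P\<in>Z. F P = r)"
      unfolding eventually_at_right_field by blast
    show thesis
    proof (rule that[of \<epsilon> "\<lambda>_. 0"])
      show "bounded ((\<lambda>_. 0 :: real) ` {0<..<\<epsilon>})" unfolding bounded_iff by auto
      fix P s assume "P \<in> Z" "F P < \<epsilon>" "0 < s" "s < F P"
      then show "F P - s \<le> sqrt (q P) * (0 - 0)" using \<epsilon>(2)[of "F P"] by auto
    qed (use \<epsilon> in \<open>auto simp: mono_on_def\<close>)
  next
    case 2
    then obtain \<epsilon>1 where \<epsilon>1: "\<epsilon>1 > 0" "\<And>r. 0 < r \<Longrightarrow> r < \<epsilon>1 \<Longrightarrow> \<exists>P\<in>Z. F P = r"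
      unfolding eventually_at_right_field by blast
    have ne: "fibre (minimisers ?K q) r \<noteq> {}" if "0 < r" "r < \<epsilon>1" for r
      using \<epsilon>1(2)[OF that] by (intro M(3)) (auto simp: fK)
    obtain w where w: "\<And>r. fibre (minimisers ?K q) r \<noteq> {} \<Longrightarrow> (r, w r) \<in> minimisers ?K q"
      "\<And>(p :: 'a \<Rightarrow> real) \<epsilon>. polynomial_function p \<Longrightarrow> (\<And>r. 0 < r \<Longrightarrow> r < \<epsilon> \<Longrightarrow> fibre (minimisers ?K q) r \<noteq> {}) \<Longrightarrow>
        semialgebraic {(r, y). 0 < r \<and> r < \<epsilon> \<and> y = p (w r)}"
      using semialgebraic_selection[OF M(1,2)] by blast
    have wZ: "w r \<in> Z" "F (w r) = r" "\<And>P. P \<in> Z \<Longrightarrow> F P = r \<Longrightarrow> q (w r) \<le> q P"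
      if "0 < r" "r < \<epsilon>1" for r
      using w(1)[OF ne[OF that]] by (auto simp: minimisers_def)
    have mon: "\<exists>\<delta> \<sigma>. 0 < \<delta> \<and> \<delta> \<le> \<epsilon>1 \<and> \<bar>\<sigma>\<bar> = 1 \<and> mono_on {0<..<\<delta>} (\<lambda>r. \<sigma> * p (w r)) \<and>
        continuous_on {0<..<\<delta>} (\<lambda>r. p (w r))" if p: "polynomial_function p" for p :: "'a \<Rightarrow> real"
    proof -
      obtain \<delta> where d: "0 < \<delta>" "\<delta> \<le> \<epsilon>1" "mono_on {0<..<\<delta>} (\<lambda>r. p (w r)) \<or> mono_on {0<..<\<delta>} (\<lambda>r. - p (w r))"
        "continuous_on {0<..<\<delta>} (\<lambda>r. p (w r))"
        using semialgebraic_eventually_monotone[OF \<epsilon>1(1) w(2)[OF p ne]] by blast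
      from d(3) have "\<exists>\<sigma>::real. \<bar>\<sigma>\<bar> = 1 \<and> mono_on {0<..<\<delta>} (\<lambda>r. \<sigma> * p (w r))"
      proof
        assume "mono_on {0<..<\<delta>} (\<lambda>r. p (w r))"
        then show ?thesis by (intro exI[of _ 1]) simp
      next
        assume "mono_on {0<..<\<delta>} (\<lambda>r. - p (w r))"
        then show ?thesis by (intro exI[of _ "-1"]) simp
      qed
      then show ?thesis using d by blast
    qed
    have "\<forall>c\<in>Basis. \<exists>\<delta> \<sigma>. 0 < \<delta> \<and> \<delta> \<le> \<epsilon>1 \<and> \<bar>\<sigma>\<bar> = 1 \<and> mono_on {0<..<\<delta>} (\<lambda>r. \<sigma> * (w r \<bullet> c)) \<and>
        continuous_on {0<..<\<delta>} (\<lambda>r. w r \<bullet> c)"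
      by (intro ballI mon pf_intros)
    then obtain \<delta> \<sigma> where \<delta>: "\<And>c. c \<in> Basis \<Longrightarrow> 0 < \<delta> c" and \<sigma>: "\<And>c. c \<in> Basis \<Longrightarrow> \<bar>\<sigma> c\<bar> = 1"
      and mc: "\<And>c. c \<in> Basis \<Longrightarrow> mono_on {0<..<\<delta> c} (\<lambda>r. \<sigma> c * (w r \<bullet> c))"
        "\<And>c. c \<in> Basis \<Longrightarrow> continuous_on {0<..<\<delta> c} (\<lambda>r. w r \<bullet> c)"
      by metis
    obtain \<delta>' \<sigma>' where \<delta>': "0 < \<delta>'" "\<delta>' \<le> \<epsilon>1" "\<bar>\<sigma>'\<bar> = 1" "mono_on {0<..<\<delta>'} (\<lambda>r. \<sigma>' * q (w r))"
      using mon[OF q(1)] by blast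
    define \<epsilon> where "\<epsilon> = Min (insert \<delta>' (\<delta> ` Basis))"
    have "0 < \<epsilon>" unfolding \<epsilon>_def using \<delta> \<delta>'(1) by auto
    moreover have "\<epsilon> \<le> y" if "y \<in> insert \<delta>' (\<delta> ` Basis)" for y
      unfolding \<epsilon>_def by (rule Min_le) (use that in auto)
    ultimately have \<epsilon>: "0 < \<epsilon>" "\<epsilon> \<le> \<delta>'" "\<And>c. c \<in> Basis \<Longrightarrow> \<epsilon> \<le> \<delta> c" by auto
    \<comment> \<open>The signs make every summand increasing, so an increment of \<open>V\<close>
      is the l1 distance of two curve points and bounds their Euclidean distance.\<close>
    define V where "V r = (\<Sum>c\<in>Basis. \<sigma> c * (w r \<bullet> c))" for r
    have Vmono: "mono_on {0<..<\<epsilon>} V"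
      unfolding V_def by (intro mono_onI sum_mono) (use \<epsilon>(3) mono_onD[OF mc(1)] in force)
    have Vcont: "continuous_on {0<..<\<epsilon>} V"
      unfolding V_def by (intro continuous_intros continuous_on_subset[OF mc(2)]) (use \<epsilon>(3) in force)+
    have Vnorm: "norm (w v - w u) \<le> V v - V u" if "0 < u" "u \<le> v" "v < \<epsilon>" for u v
    proof -
      have "norm (w v - w u) \<le> (\<Sum>c\<in>Basis. \<bar>(w v - w u) \<bullet> c\<bar>)" by (rule norm_le_l1)
      also have "\<dots> \<le> (\<Sum>c\<in>Basis. \<sigma> c * (w v \<bullet> c) - \<sigma> c * (w u \<bullet> c))"
      proof (rule sum_mono)
        fix c :: 'a assume c: "c \<in> Basis"
        have "\<sigma> c * (w u \<bullet> c) \<le> \<sigma> c * (w v \<bullet> c)"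
          using mono_onD[OF mc(1)[OF c], of u v] \<epsilon>(3)[OF c] that by simp
        moreover have "\<bar>(w v - w u) \<bullet> c\<bar> = \<bar>\<sigma> c * (w v \<bullet> c) - \<sigma> c * (w u \<bullet> c)\<bar>"
          using \<sigma>[OF c] by (simp add: right_diff_distrib[symmetric] inner_diff_left[symmetric] abs_mult)
        ultimately show "\<bar>(w v - w u) \<bullet> c\<bar> \<le> \<sigma> c * (w v \<bullet> c) - \<sigma> c * (w u \<bullet> c)" by simp
      qed
      finally show ?thesis by (simp add: V_def sum_subtractf)
    qed
    have len: "r2 - r1 \<le> b * \<mu> * (V r2 - V r1)"
      if r: "0 < r1" "r1 \<le> r2" "r2 < \<epsilon>" and \<mu>: "\<And>r. r1 \<le> r \<Longrightarrow> r \<le> r2 \<Longrightarrow> sqrt (q (w r)) \<le> \<mu>" for r1 r2 \<mu>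
    proof (rule monotone_length_bound[OF r(2) _ _ bC(2)])
      show "continuous_on {r1..r2} V" by (rule continuous_on_subset[OF Vcont]) (use r in auto)
      show "mono_on {r1..r2} V" by (rule mono_on_subset[OF Vmono]) (use r in auto)
      fix u v assume uv: "r1 \<le> u" "u \<le> v" "v \<le> r2"
      have pos: "0 < u" "u < \<epsilon>1" "0 < v" "v < \<epsilon>1" using uv r \<epsilon>(2) \<delta>'(2) by auto
      have "v - u = F (w v) - F (w u)" using wZ(2) pos by simp
      also have "\<dots> \<le> b * sqrt (q (w v)) * norm (w v - w u) + C * (norm (w v - w u))\<^sup>2"
        using wZ(1) pos by (intro ineq) auto
      also have "\<dots> \<le> b * \<mu> * (V v - V u) + C * (V v - V u)\<^sup>2"
      proof -
        have n: "norm (w v - w u) \<le> V v - V u" using uv r by (intro Vnorm) auto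
        have "0 \<le> \<mu>" using \<mu>[of r1] r q(2)[of "w r1"] by (meson order.refl order.trans real_sqrt_ge_zero)
        then have "b * sqrt (q (w v)) * norm (w v - w u) \<le> b * \<mu> * (V v - V u)"
          using n bC(1) \<mu>[of v] uv by (intro mult_mono mult_left_mono mult_nonneg_nonneg) auto
        moreover have "C * (norm (w v - w u))\<^sup>2 \<le> C * (V v - V u)\<^sup>2"
          using n bC(2) by (intro mult_left_mono power_mono) auto
        ultimately show ?thesis by simp
      qed
      finally show "v - u \<le> b * \<mu> * (V v - V u) + C * (V v - V u)\<^sup>2" .
    qed
    have m_le: "sqrt (q (w (F P))) \<le> sqrt (q P)" if "P \<in> Z" "0 < F P" "F P < \<epsilon>" for P
      using wZ(3)[of "F P" P] that \<epsilon>(2) \<delta>'(2) by simp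
    show thesis
    proof (cases "\<sigma>' = 1")
      case True
      \<comment> \<open>The minimal slope is itself monotone in the level. If it increases, its
        maximum on \<open>[s, F P]\<close> is attained at \<open>F P\<close>, where the choice of
        \<open>w\<close> bounds it by the slope at \<open>P\<close>.\<close>
      have qm: "mono_on {0<..<\<epsilon>} (\<lambda>r. q (w r))"
        using \<delta>'(4) \<epsilon>(2) True by (auto simp: mono_on_def)
      show thesis
      proof (rule that[of \<epsilon> "\<lambda>r. b * V r"])
        show "mono_on {0<..<\<epsilon>} (\<lambda>r. b * V r)"
          using Vmono bC(1) by (auto simp: mono_on_def intro: mult_left_mono)
        obtain B where B: "\<And>P. P \<in> Z \<Longrightarrow> norm P \<le> B" using bdd unfolding bounded_iff by blast
        show "bounded ((\<lambda>r. b * V r) ` {0<..<\<epsilon>})"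
          unfolding bounded_iff
        proof (intro exI ballI)
          fix y assume "y \<in> (\<lambda>r. b * V r) ` {0<..<\<epsilon>}"
          then obtain r where r: "0 < r" "r < \<epsilon>" "y = b * V r" by auto
          have "\<bar>V r\<bar> \<le> (\<Sum>c\<in>Basis. \<bar>\<sigma> c * (w r \<bullet> c)\<bar>)" unfolding V_def by (rule sum_abs)
          also have "\<dots> \<le> (\<Sum>c\<in>(Basis::'a set). B)"
          proof (rule sum_mono)
            fix c :: 'a assume c: "c \<in> Basis"
            have "\<bar>w r \<bullet> c\<bar> \<le> norm (w r)" using c by (rule Basis_le_norm)
            also have "\<dots> \<le> B" using r \<epsilon>(2) \<delta>'(2) by (intro B wZ(1)) auto
            finally show "\<bar>\<sigma> c * (w r \<bullet> c)\<bar> \<le> B" using \<sigma>[OF c] by (simp add: abs_mult)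
          qed
          finally have "b * \<bar>V r\<bar> \<le> b * (\<Sum>c\<in>(Basis::'a set). B)" using bC(1) by (rule mult_left_mono)
          then show "norm y \<le> b * (\<Sum>c\<in>(Basis::'a set). B)" using r(3) bC(1) by (simp add: abs_mult)
        qed
        fix P s assume P: "P \<in> Z" "F P < \<epsilon>" "0 < s" "s < F P"
        have "F P - s \<le> b * sqrt (q (w (F P))) * (V (F P) - V s)"
          using P mono_onD[OF qm] by (intro len) auto
        also have "\<dots> = sqrt (q (w (F P))) * (b * V (F P) - b * V s)" by (simp add: algebra_simps)
        also have "\<dots> \<le> sqrt (q P) * (b * V (F P) - b * V s)"
          using m_le[OF P(1)] P mono_onD[OF Vmono, of s "F P"] bC(1)
          by (intro mult_right_mono) (auto simp: mult_left_mono)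
        finally show "F P - s \<le> sqrt (q P) * (b * V (F P) - b * V s)" .
      qed (rule \<epsilon>(1))
    next
      case False
      then have s1: "\<sigma>' = -1" using \<delta>'(3) by (simp add: abs_if split: if_splits)
      have qa: "q (w v) \<le> q (w u)" if "0 < u" "u \<le> v" "v < \<epsilon>" for u v
        using mono_onD[OF \<delta>'(4), of u v] that \<epsilon>(2) s1 by simp
      \<comment> \<open>A decreasing slope is at least \<open>m0\<close> on all levels below
        \<open>\<epsilon> / 2\<close>, so a linear \<phi> suffices. Were \<open>m0\<close> zero, the
        slope would vanish just above \<open>\<epsilon> / 2\<close> as well, and \<open>len\<close>
        would bound the difference of two distinct levels there by 0.\<close>
      define m0 where "m0 = sqrt (q (w (\<epsilon> / 2)))"
      have "m0 \<noteq> 0"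
      proof
        assume "m0 = 0"
        then have z: "sqrt (q (w r)) \<le> 0" if "\<epsilon> / 2 \<le> r" "r \<le> 3 * \<epsilon> / 4" for r
          using qa[of "\<epsilon> / 2" r] that \<epsilon>(1) by (simp add: m0_def)
        have "3 * \<epsilon> / 4 - \<epsilon> / 2 \<le> b * 0 * (V (3 * \<epsilon> / 4) - V (\<epsilon> / 2))"
          by (rule len) (use \<epsilon>(1) z in auto)
        then show False using \<epsilon>(1) by simp
      qed
      then have m0: "m0 > 0" using q(2) by (simp add: m0_def order_less_le)
      show thesis
      proof (rule that[of "\<epsilon> / 2" "\<lambda>r. r / m0"])
        show "mono_on {0<..<\<epsilon> / 2} (\<lambda>r. r / m0)"
          using m0 by (auto simp: mono_on_def divide_right_mono)
        have "bounded ((\<lambda>r. r * (1 / m0)) ` {0<..<\<epsilon> / 2})"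
          by (intro bounded_linear_image bounded_linear_mult_left) auto
        then show "bounded ((\<lambda>r. r / m0) ` {0<..<\<epsilon> / 2})" by simp
        fix P s assume P: "P \<in> Z" "F P < \<epsilon> / 2" "0 < s" "s < F P"
        have "m0 \<le> sqrt (q (w (F P)))" using qa[of "F P" "\<epsilon> / 2"] P \<epsilon>(1) by (simp add: m0_def)
        also have "\<dots> \<le> sqrt (q P)" using m_le[of P] P \<epsilon>(1) by simp
        finally have "m0 * ((F P - s) / m0) \<le> sqrt (q P) * ((F P - s) / m0)"
          using P m0 by (intro mult_right_mono) auto
        moreover have "m0 * ((F P - s) / m0) = F P - s" using m0 by simp
        ultimately show "F P - s \<le> sqrt (q P) * (F P / m0 - s / m0)"
          unfolding diff_divide_distrib by simp
      qed (use \<epsilon>(1) in simp)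
    qed
  qed
qed

subsection \<open>The parameterized Douglas--Rachford iteration\<close>

lemma gderiv_line:
  assumes "GDERIV f y :> D"
  shows "((\<lambda>t. f (y + t *\<^sub>R h)) has_real_derivative D \<bullet> h) (at 0)"
proof -
  have "((\<lambda>t. y + t *\<^sub>R h) has_derivative (\<lambda>t. t *\<^sub>R h)) (at (0::real))"
    by (auto intro!: derivative_eq_intros)
  moreover have "(f has_derivative (\<lambda>k. k \<bullet> D)) (at (y + 0 *\<^sub>R h))"
    using assms by (simp add: gderiv_def)
  ultimately have "((\<lambda>t. f (y + t *\<^sub>R h)) has_derivative (\<lambda>t. (t *\<^sub>R h) \<bullet> D)) (at 0)"
    by (rule has_derivative_compose)
  moreover have "(\<lambda>t. (t *\<^sub>R h) \<bullet> D) = (*) (D \<bullet> h)"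
    by (auto simp: fun_eq_iff inner_commute)
  ultimately show ?thesis by (simp add: has_field_derivative_def)
qed

lemma argmin_setD:
  fixes F :: "'a \<Rightarrow> 'b::linorder"
  shows "x \<in> argmin_set F \<Longrightarrow> F x \<le> F y"
  by (auto simp: argmin_set_def is_arg_min_def not_less)

lemma argmin_set_iff:
  fixes F :: "'a \<Rightarrow> 'b::linorder"
  shows "x \<in> argmin_set F \<longleftrightarrow> (\<forall>y. F x \<le> F y)"
  by (auto simp: argmin_set_def is_arg_min_def not_less)

text \<open>Inside the ball the length of the path is at most the decrease of \<open>p\<close>. From
  an iterate within \<open>\<rho> / 2\<close> of \<open>z\<close> whose remaining decrease is below
  \<open>\<rho> / 2\<close> the path cannot leave the ball, so the step bound holds from then on and
  the sequence is Cauchy.\<close>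

lemma convergent_of_trapped_cluster:
  fixes w :: "nat \<Rightarrow> 'a::banach" and p :: "nat \<Rightarrow> real"
  assumes r: "strict_mono r" "(w \<circ> r) \<longlonglongrightarrow> z"
    and p: "\<And>t. p (Suc t) \<le> p t" "\<And>t. B \<le> p t"
    and \<rho>: "0 < \<rho>" and step: "\<And>t. norm (w t - z) < \<rho> \<Longrightarrow> norm (w (Suc t) - w t) \<le> p t - p (Suc t)"
  shows "convergent w"
proof -
  have dec: "decseq p" using p(1) by (rule decseq_SucI)
  obtain L where L: "p \<longlonglongrightarrow> L" "\<And>t. L \<le> p t" using decseq_convergent[OF dec allI[OF p(2)]] by blast
  have "\<forall>\<^sub>F t in sequentially. p t < L + \<rho> / 2" using L(1) \<rho> by (intro order_tendstoD) auto
  then obtain T where T: "\<And>t. t \<ge> T \<Longrightarrow> p t < L + \<rho> / 2" unfolding eventually_sequentially by blast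
  have "\<forall>\<^sub>F j in sequentially. dist ((w \<circ> r) j) z < \<rho> / 2" by (rule tendstoD[OF r(2)]) (use \<rho> in simp)
  then obtain J where J: "\<And>j. j \<ge> J \<Longrightarrow> dist (w (r j)) z < \<rho> / 2" unfolding eventually_sequentially by auto
  define N where "N = r (max J T)"
  have "T \<le> N" unfolding N_def using seq_suble[OF r(1), of "max J T"] by simp
  have N: "norm (w N - z) < \<rho> / 2" "p N - L < \<rho> / 2"
    using J[of "max J T"] T[OF \<open>T \<le> N\<close>] by (auto simp: N_def dist_norm)
  have near: "norm (w t - w N) \<le> p N - p t" if "t \<ge> N" for t
    using that
  proof (induction t rule: dec_induct)
    case (step t)
    have "norm (w t - z) \<le> norm (w t - w N) + norm (w N - z)"
      using norm_triangle_ineq[of "w t - w N" "w N - z"] by simp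
    also have "\<dots> < \<rho>" using step.IH N L(2)[of t] by linarith
    finally have "norm (w (Suc t) - w t) \<le> p t - p (Suc t)" by (rule assms(6))
    moreover have "norm (w (Suc t) - w N) \<le> norm (w (Suc t) - w t) + norm (w t - w N)"
      using norm_triangle_ineq[of "w (Suc t) - w t" "w t - w N"] by simp
    ultimately show ?case using step.IH by linarith
  qed simp
  have trapped: "norm (w t - z) < \<rho>" if "t \<ge> N" for t
  proof -
    have "norm (w t - z) \<le> norm (w t - w N) + norm (w N - z)"
      using norm_triangle_ineq[of "w t - w N" "w N - z"] by simp
    then show ?thesis using near[OF that] N L(2)[of t] by linarith
  qed
  have step': "norm (w t - w s) \<le> p s - p t" if "N \<le> s" "s \<le> t" for s t
    using that(2)
  proof (induction t rule: dec_induct)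
    case (step t)
    have "norm (w (Suc t) - w t) \<le> p t - p (Suc t)"
      using trapped[of t] step.hyps that(1) by (intro assms(6)) auto
    moreover have "norm (w (Suc t) - w s) \<le> norm (w (Suc t) - w t) + norm (w t - w s)"
      using norm_triangle_ineq[of "w (Suc t) - w t" "w t - w s"] by simp
    ultimately show ?case using step.IH by linarith
  qed simp
  have "Cauchy w"
  proof (rule CauchyI')
    fix e :: real assume "0 < e"
    then have "\<forall>\<^sub>F t in sequentially. p t < L + e" using L(1) by (intro order_tendstoD) auto
    then obtain M where M: "\<And>t. t \<ge> M \<Longrightarrow> p t < L + e" unfolding eventually_sequentially by blast
    show "\<exists>M. \<forall>s\<ge>M. \<forall>t>s. dist (w s) (w t) < e"
    proof (intro exI allI impI)
      fix s t assume st: "max M N \<le> s" "s < t"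
      have "norm (w t - w s) \<le> p s - p t" using st by (intro step') auto
      also have "\<dots> < e" using M[of s] L(2)[of t] st by auto
      finally show "dist (w s) (w t) < e" by (simp add: dist_norm norm_minus_commute)
    qed
  qed
  then show ?thesis by (rule Cauchy_convergent)
qed

locale parameterized_DR =
  fixes f :: "'a::euclidean_space \<Rightarrow> real" and grad :: "'a \<Rightarrow> 'a" and g :: "'a \<Rightarrow> ereal"
    and L l \<alpha> \<gamma> :: real
  assumes grad: "\<And>y. GDERIV f y :> grad y"
    and L: "L > 0" "\<And>y1 y2. norm (grad y1 - grad y2) \<le> L * norm (y1 - y2)"
    and conv: "convex_on UNIV (\<lambda>y. f y + l / 2 * (norm y)\<^sup>2)"
    and proper: "proper_fun g" and closed: "closed_fun g"
    and \<alpha>: "0 < \<alpha>" "\<alpha> \<le> 2" and \<gamma>: "\<gamma> > 0"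
    and step_size: "(4 - \<alpha>) / 2 * (1 + \<gamma> * L)\<^sup>2 + (9 - 2 * \<alpha>) / 2 * (\<gamma> * l) - (1 + \<alpha>) / 2 < 0"
    and sa_f: "semialgebraic_fun (\<lambda>y. ereal (f y))" and sa_g: "semialgebraic_fun g"
begin

text \<open>The third entry is the input of a step, not its result: a run of the iteration enters as
  \<open>(u (Suc t), v (Suc t), x t)\<close>.\<close>

definition Prox :: "('a \<times> 'a \<times> 'a) set" where
  "Prox = {(u, v, x). u \<in> argmin_set (\<lambda>w. f w + 1 / (2 * \<gamma>) * (norm (w - x))\<^sup>2) \<and>
     v \<in> argmin_set (\<lambda>w. g w + ereal (1 / (2 * \<gamma>) * (norm (w - \<alpha> *\<^sub>R u + x))\<^sup>2))}"

text \<open>At points where \<open>g\<close> is infinite this takes the value 0, so values are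
  compared only where finiteness is known.\<close>

definition gr :: "'a \<Rightarrow> real" where "gr v = real_of_ereal (g v)"

definition quad :: "'a \<Rightarrow> 'a \<Rightarrow> 'a \<Rightarrow> real" where
  "quad u v x = 1 / 2 * (norm (v - u))\<^sup>2 + (v - u) \<bullet> (x - (\<alpha> - 1) *\<^sub>R u) + (2 - \<alpha>) / 2 * (norm u)\<^sup>2"

text \<open>At a point of \<open>Prox\<close> this Lyapunov function has the proximal subgradient
  \<open>(- \<alpha> (v - u), 0, v - u) / \<gamma>\<close>; the terms of \<open>quad\<close> are chosen to make it a multiple of \<open>v - u\<close>.\<close>

definition merit :: "'a \<times> 'a \<times> 'a \<Rightarrow> real" where
  "merit = (\<lambda>(u, v, x). f u + gr v + quad u v x / \<gamma>)"

lemma g_real: "g v \<noteq> \<infinity> \<Longrightarrow> g v = ereal (gr v)"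
  using proper unfolding proper_fun_def gr_def by (cases "g v") auto

lemma lsc: assumes "s < g v" shows "\<forall>\<^sub>F y in nhds v. s < g y"
proof -
  have "g v \<le> Liminf (at v) g"
    using closed by (auto simp: closed_fun_def lower_semicont_def)
  then have "\<forall>\<^sub>F y in at v. s < g y" using assms unfolding le_Liminf_iff by blast
  then show ?thesis using assms by (auto simp: eventually_at_filter elim: eventually_mono)
qed

lemma Prox_fD:
  assumes "(u, v, x) \<in> Prox"
  shows "f u + 1 / (2 * \<gamma>) * (norm (u - x))\<^sup>2 \<le> f w + 1 / (2 * \<gamma>) * (norm (w - x))\<^sup>2"
  using assms unfolding Prox_def by (auto dest: argmin_setD[where y = w])

lemma Prox_gD:
  assumes "(u, v, x) \<in> Prox"
  shows "g v \<noteq> \<infinity>"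
    "g w \<noteq> \<infinity> \<Longrightarrow> gr v + 1 / (2 * \<gamma>) * (norm (v - \<alpha> *\<^sub>R u + x))\<^sup>2 \<le>
      gr w + 1 / (2 * \<gamma>) * (norm (w - \<alpha> *\<^sub>R u + x))\<^sup>2"
proof -
  have *: "g v + ereal (1 / (2 * \<gamma>) * (norm (v - \<alpha> *\<^sub>R u + x))\<^sup>2) \<le>
      g w + ereal (1 / (2 * \<gamma>) * (norm (w - \<alpha> *\<^sub>R u + x))\<^sup>2)" for w
    using assms unfolding Prox_def by (auto dest: argmin_setD[where y = w])
  obtain w0 where "g w0 \<noteq> \<infinity>" using proper by (auto simp: proper_fun_def)
  with *[of w0] show v: "g v \<noteq> \<infinity>" by (auto simp: g_real)
  show "gr v + 1 / (2 * \<gamma>) * (norm (v - \<alpha> *\<^sub>R u + x))\<^sup>2 \<le>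
      gr w + 1 / (2 * \<gamma>) * (norm (w - \<alpha> *\<^sub>R u + x))\<^sup>2" if "g w \<noteq> \<infinity>"
    using *[of w] g_real[OF v] g_real[OF that] by simp
qed

lemma Prox_g_scaled:
  assumes "(u, v, x) \<in> Prox" "g w \<noteq> \<infinity>"
  shows "\<gamma> * (gr v - gr w) \<le> 1 / 2 * (norm (w - \<alpha> *\<^sub>R u + x))\<^sup>2 - 1 / 2 * (norm (v - \<alpha> *\<^sub>R u + x))\<^sup>2"
proof -
  have "\<gamma> * (gr v + 1 / (2 * \<gamma>) * A) = \<gamma> * gr v + 1 / 2 * A" for v A
    using \<gamma> by (simp add: field_simps)
  then show ?thesis
    using mult_left_mono[OF Prox_gD(2)[OF assms], of \<gamma>] \<gamma> by (simp add: right_diff_distrib)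
qed

lemma ProxI:
  assumes "\<And>w. f u + 1 / (2 * \<gamma>) * (norm (u - x))\<^sup>2 \<le> f w + 1 / (2 * \<gamma>) * (norm (w - x))\<^sup>2"
    "g v \<noteq> \<infinity>" "\<And>w. g w \<noteq> \<infinity> \<Longrightarrow> gr v + 1 / (2 * \<gamma>) * (norm (v - \<alpha> *\<^sub>R u + x))\<^sup>2 \<le>
      gr w + 1 / (2 * \<gamma>) * (norm (w - \<alpha> *\<^sub>R u + x))\<^sup>2"
  shows "(u, v, x) \<in> Prox"
proof -
  have "g v + ereal (1 / (2 * \<gamma>) * (norm (v - \<alpha> *\<^sub>R u + x))\<^sup>2) \<le>
      g w + ereal (1 / (2 * \<gamma>) * (norm (w - \<alpha> *\<^sub>R u + x))\<^sup>2)" for w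
  proof (cases "g w = \<infinity>")
    case False
    then show ?thesis using assms(3)[OF False] g_real[OF assms(2)] g_real[OF False] by simp
  qed simp
  with assms(1) show ?thesis unfolding Prox_def by (simp add: argmin_set_iff)
qed

text \<open>The first-order condition of the smooth subproblem, tested along lines. It makes
  \<open>x\<close> a Lipschitz function of \<open>u\<close>, so that convergence of the
  \<open>u\<close> iterates carries over to the others.\<close>

lemma Prox_grad:
  assumes "(u, v, x) \<in> Prox" shows "x = u + \<gamma> *\<^sub>R grad u"
proof -
  have zero: "(grad u + (1 / \<gamma>) *\<^sub>R (u - x)) \<bullet> h = 0" for h
  proof -
    let ?k = "\<lambda>t. f (u + t *\<^sub>R h) + 1 / (2 * \<gamma>) * (norm (u + t *\<^sub>R h - x))\<^sup>2"
    have eq: "(norm (u + t *\<^sub>R h - x))\<^sup>2 = (norm (u - x))\<^sup>2 + 2 * t * ((u - x) \<bullet> h) + t\<^sup>2 * (norm h)\<^sup>2" for t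
      unfolding power2_norm_eq_inner unfolding power2_eq_square by (simp add: inner_simps inner_commute algebra_simps)
    have "(?k has_real_derivative grad u \<bullet> h + 1 / (2 * \<gamma>) * (2 * ((u - x) \<bullet> h))) (at 0)"
      unfolding eq by (rule derivative_eq_intros gderiv_line[OF grad] refl | simp)+
    then have "grad u \<bullet> h + 1 / (2 * \<gamma>) * (2 * ((u - x) \<bullet> h)) = 0"
      by (rule DERIV_local_min[of _ _ _ 1]) (use Prox_fD[OF assms] in auto)
    then show ?thesis by (simp add: inner_add_left)
  qed
  have "grad u + (1 / \<gamma>) *\<^sub>R (u - x) = 0" using zero[of "grad u + (1 / \<gamma>) *\<^sub>R (u - x)"] by simp
  then have "\<gamma> *\<^sub>R (grad u + (1 / \<gamma>) *\<^sub>R (u - x)) = 0" by simp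
  then show ?thesis using \<gamma> by (simp add: scaleR_add_right algebra_simps)
qed

text \<open>The tangent inequality of the convex function in \<open>conv\<close>, restricted to the
  line through \<open>u\<close> and \<open>w\<close>; its quadratic terms combine to the square of
  the distance.\<close>

lemma f_lower: "f w \<ge> f u + grad u \<bullet> (w - u) - l / 2 * (norm (w - u))\<^sup>2"
proof -
  define h where "h = w - u"
  define k where "k t = f (u + t *\<^sub>R h) + l / 2 * (norm (u + t *\<^sub>R h))\<^sup>2" for t
  have "convex_on UNIV k"
  proof (intro convex_onI)
    fix t x y :: real assume t: "0 < t" "t < 1"
    have "u + ((1 - t) *\<^sub>R x + t *\<^sub>R y) *\<^sub>R h = (1 - t) *\<^sub>R (u + x *\<^sub>R h) + t *\<^sub>R (u + y *\<^sub>R h)"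
      by (simp add: algebra_simps)
    then show "k ((1 - t) *\<^sub>R x + t *\<^sub>R y) \<le> (1 - t) * k x + t * k y"
      unfolding k_def using convex_onD[OF conv, of t "u + x *\<^sub>R h" "u + y *\<^sub>R h"] t by simp
  qed simp
  moreover have "(k has_real_derivative grad u \<bullet> h + l / 2 * (2 * (u \<bullet> h))) (at 0)"
  proof -
    have eq: "(norm (u + t *\<^sub>R h))\<^sup>2 = (norm u)\<^sup>2 + 2 * t * (u \<bullet> h) + t\<^sup>2 * (norm h)\<^sup>2" for t
      unfolding power2_norm_eq_inner unfolding power2_eq_square by (simp add: inner_simps inner_commute algebra_simps)
    show ?thesis
      unfolding k_def eq by (rule derivative_eq_intros gderiv_line[OF grad] refl | simp)+
  qed
  ultimately have "k 1 - k 0 \<ge> (grad u \<bullet> h + l / 2 * (2 * (u \<bullet> h))) * (1 - 0)"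
    by (intro convex_on_imp_above_tangent[where A = UNIV]) auto
  moreover have "(norm w)\<^sup>2 = (norm u)\<^sup>2 + 2 * (u \<bullet> h) + (norm h)\<^sup>2"
    unfolding power2_norm_eq_inner h_def by (simp add: inner_simps inner_commute algebra_simps)
  ultimately show ?thesis by (simp add: k_def h_def algebra_simps)
qed

text \<open>Adding the tangent inequalities between 0 and a unit vector, in both directions, bounds
  the increment of the gradient along that vector from below by \<open>- l\<close>; the Lipschitz
  bound limits it by \<open>L\<close>.\<close>

lemma l_ge: "- l \<le> L"
proof -
  obtain b :: 'a where b: "b \<in> Basis" using nonempty_Basis by blast
  have "f b \<ge> f 0 + grad 0 \<bullet> (b - 0) - l / 2 * (norm (b - 0))\<^sup>2"
    "f 0 \<ge> f b + grad b \<bullet> (0 - b) - l / 2 * (norm (0 - b))\<^sup>2" by (rule f_lower)+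
  then have "- l \<le> (grad b - grad 0) \<bullet> b" using b by (simp add: inner_diff_left)
  also have "\<dots> \<le> norm (grad b - grad 0) * norm b" by (rule norm_cauchy_schwarz)
  also have "\<dots> \<le> L" using L(2)[of b 0] b by simp
  finally show ?thesis .
qed

text \<open>The constant that \<open>merit_descent\<close> produces: minus the coefficient of
  \<open>|u' - u|^2\<close> after the Cauchy-Schwarz and Lipschitz bounds.\<close>

definition rate :: real where
  "rate = - ((1 - \<alpha> + \<gamma> * l) / 2 + (2 - \<alpha>) * (\<gamma> * L) + (\<gamma> * L)\<^sup>2)"

text \<open>With \<open>s = \<gamma> * L\<close>, the left side of the step-size condition exceeds
  \<open>- rate\<close> by \<open>(2 - \<alpha>) / 2 * (1 - s)^2 + (4 - \<alpha>) * (s + \<gamma> *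
  l)\<close>. The first term is nonnegative by \<alpha> \<le> 2, the second by
  \<open>l_ge\<close>.\<close>

lemma rate_pos: "rate > 0"
proof -
  define s where "s = \<gamma> * L"
  have s: "s > 0" using \<gamma> L(1) by (simp add: s_def)
  have "- (\<gamma> * l) \<le> s" using mult_left_mono[OF l_ge, of \<gamma>] \<gamma> by (simp add: s_def)
  then have "(4 - \<alpha>) * (- (\<gamma> * l)) \<le> (4 - \<alpha>) * s" using \<alpha> by (intro mult_left_mono) auto
  moreover have "0 \<le> (2 - \<alpha>) / 2 * (1 - s)\<^sup>2" using \<alpha> by simp
  moreover have "(4 - \<alpha>) / 2 * (1 + s)\<^sup>2 + (9 - 2 * \<alpha>) / 2 * (\<gamma> * l) - (1 + \<alpha>) / 2 =
      - rate + ((2 - \<alpha>) / 2 * (1 - s)\<^sup>2 + ((4 - \<alpha>) * s - (4 - \<alpha>) * (- (\<gamma> * l))))"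
    unfolding rate_def s_def[symmetric] by (simp add: field_simps power2_eq_square)
  ultimately show ?thesis using step_size unfolding s_def[symmetric] by linarith
qed

text \<open>The two inner products on the left are \<gamma> times the first-order changes of
  \<open>f\<close> and \<open>g\<close> at a point of \<open>Prox\<close>. Once they are included,
  the only first-order terms left carry the factor \<open>v - u\<close>.\<close>

lemma quad_expansion:
  "quad (u + a) (v + b) (x + c) - quad u v x + (x - u) \<bullet> a - (v - \<alpha> *\<^sub>R u + x) \<bullet> b =
    (v - u) \<bullet> c - \<alpha> * ((v - u) \<bullet> a) + 1 / 2 * (norm (b - a))\<^sup>2 + (b - a) \<bullet> (c - (\<alpha> - 1) *\<^sub>R a)
    + (2 - \<alpha>) / 2 * (norm a)\<^sup>2"
  unfolding quad_def power2_norm_eq_inner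
  by (simp add: inner_simps inner_commute algebra_simps) (simp add: field_simps)

text \<open>The tangent bound for \<open>f\<close> and the minimality of \<open>v\<close> for
  \<open>g\<close> bound their changes from below, and \<open>quad_expansion\<close> supplies the
  rest. This is the hypothesis \<open>ineq\<close> of \<open>semialgebraic_KL\<close>.\<close>

lemma merit_slope:
  assumes P: "P \<in> Prox" "P' \<in> Prox" and uvx: "P = (u, v, x)"
  shows "merit P - merit P' \<le>
    3 / \<gamma> * norm (v - u) * norm (P - P') + (\<bar>l\<bar> / 2 + 8 / \<gamma>) * (norm (P - P'))\<^sup>2"
proof -
  obtain u' v' x' where P': "P' = (u', v', x')" by (cases P')
  define a b c D where "a = u' - u" and "b = v' - v" and "c = x' - x" and "D = norm (P - P')"
  have D: "norm a \<le> D" "norm b \<le> D" "norm c \<le> D" "0 \<le> D"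
  proof -
    have "D = norm (a, b, c)"
      unfolding D_def uvx P' a_def b_def c_def using norm_minus_commute[of P P'] by (simp add: uvx P')
    then show "norm a \<le> D" "norm b \<le> D" "norm c \<le> D" "0 \<le> D"
      using norm_fst_le[of "a" "(b, c)"] norm_snd_le[of "(b, c)" a] norm_fst_le[of b c] norm_snd_le[of c b]
      by (auto intro: order.trans)
  qed
  note P1 = P(1)[unfolded uvx] and P2 = P(2)[unfolded P']
  have "\<gamma> * (f u' - f u) \<ge> (x - u) \<bullet> a - \<gamma> * (l / 2) * (norm a)\<^sup>2"
  proof -
    have "\<gamma> * (f u' - f u) \<ge> \<gamma> * (grad u \<bullet> a - l / 2 * (norm a)\<^sup>2)"
      using f_lower[of u u'] \<gamma> by (intro mult_left_mono) (auto simp: a_def)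
    moreover have "\<gamma> * (grad u \<bullet> a) = (x - u) \<bullet> a" using Prox_grad[OF P1] by simp
    ultimately show ?thesis by (simp add: algebra_simps)
  qed
  moreover have "\<gamma> * (l / 2) * (norm a)\<^sup>2 \<le> \<gamma> * (\<bar>l\<bar> / 2) * D\<^sup>2"
  proof (rule mult_mono)
    show "\<gamma> * (l / 2) \<le> \<gamma> * (\<bar>l\<bar> / 2)" using \<gamma> by (intro mult_left_mono) auto
    show "(norm a)\<^sup>2 \<le> D\<^sup>2" using D by (intro power_mono) auto
  qed (use \<gamma> in auto)
  moreover have "\<gamma> * (gr v' - gr v) \<ge> - ((v - \<alpha> *\<^sub>R u + x) \<bullet> b) - 1 / 2 * (norm b)\<^sup>2"
  proof -
    have "\<gamma> * (gr v - gr v') \<le> 1 / 2 * (norm (v' - \<alpha> *\<^sub>R u + x))\<^sup>2 - 1 / 2 * (norm (v - \<alpha> *\<^sub>R u + x))\<^sup>2"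
      by (rule Prox_g_scaled[OF P1 Prox_gD(1)[OF P2]])
    moreover have "(norm (v' - \<alpha> *\<^sub>R u + x))\<^sup>2 =
        (norm (v - \<alpha> *\<^sub>R u + x))\<^sup>2 + 2 * ((v - \<alpha> *\<^sub>R u + x) \<bullet> b) + (norm b)\<^sup>2"
      unfolding power2_norm_eq_inner b_def by (simp add: inner_simps inner_commute algebra_simps)
    ultimately show ?thesis by (simp add: algebra_simps)
  qed
  moreover have "1 / 2 * (norm b)\<^sup>2 \<le> 1 / 2 * D\<^sup>2" using D by (simp add: power_mono)
  moreover have "quad u' v' x' - quad u v x + (x - u) \<bullet> a - (v - \<alpha> *\<^sub>R u + x) \<bullet> b =
    (v - u) \<bullet> c - \<alpha> * ((v - u) \<bullet> a) + 1 / 2 * (norm (b - a))\<^sup>2 + (b - a) \<bullet> (c - (\<alpha> - 1) *\<^sub>R a)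
    + (2 - \<alpha>) / 2 * (norm a)\<^sup>2"
    using quad_expansion[of u a v b x c] by (simp add: a_def b_def c_def)
  moreover have "(v - u) \<bullet> c \<ge> - (norm (v - u) * D)"
    using Cauchy_Schwarz_ineq2[of "v - u" c] mult_left_mono[OF D(3), of "norm (v - u)"] by simp
  moreover have "\<alpha> * ((v - u) \<bullet> a) \<le> 2 * (norm (v - u) * D)"
  proof -
    have "(v - u) \<bullet> a \<le> norm (v - u) * D"
      using norm_cauchy_schwarz[of "v - u" a] mult_left_mono[OF D(1), of "norm (v - u)"] by simp
    then have "\<alpha> * ((v - u) \<bullet> a) \<le> \<alpha> * (norm (v - u) * D)" using \<alpha> by (intro mult_left_mono) auto
    also have "\<dots> \<le> 2 * (norm (v - u) * D)" using \<alpha> D(4) by (intro mult_right_mono mult_nonneg_nonneg) auto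
    finally show ?thesis .
  qed
  moreover have "1 / 2 * (norm (b - a))\<^sup>2 \<ge> 0" by simp
  moreover have "(b - a) \<bullet> (c - (\<alpha> - 1) *\<^sub>R a) \<ge> - (4 * D\<^sup>2)"
  proof -
    have "norm (b - a) \<le> 2 * D" using norm_triangle_ineq4[of b a] D by linarith
    moreover have "norm (c - (\<alpha> - 1) *\<^sub>R a) \<le> 2 * D"
    proof -
      have "norm ((\<alpha> - 1) *\<^sub>R a) \<le> 1 * D" unfolding norm_scaleR using \<alpha> D by (intro mult_mono) auto
      then show ?thesis using norm_triangle_ineq4[of c "(\<alpha> - 1) *\<^sub>R a"] D by linarith
    qed
    ultimately have "norm (b - a) * norm (c - (\<alpha> - 1) *\<^sub>R a) \<le> (2 * D) * (2 * D)"
      using D(4) by (intro mult_mono) auto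
    then show ?thesis using Cauchy_Schwarz_ineq2[of "b - a" "c - (\<alpha> - 1) *\<^sub>R a"]
      by (simp add: power2_eq_square)
  qed
  moreover have "(2 - \<alpha>) / 2 * (norm a)\<^sup>2 \<ge> 0" using \<alpha> by simp
  \<comment> \<open>The 3 is 1 for the shift of \<open>x\<close> plus \<alpha> \<le> 2 for that of
    \<open>u\<close>. Apart from the term with \<open>l\<close>, the quadratic errors are 1/2 from
    \<open>g\<close> and 4 from the mixed product, rounded up to 8.\<close>
  ultimately have "- (\<gamma> * (f u' - f u)) - \<gamma> * (gr v' - gr v) - (quad u' v' x' - quad u v x) \<le>
      3 * (norm (v - u) * D) + (\<gamma> * (\<bar>l\<bar> / 2) * D\<^sup>2 + 8 * D\<^sup>2)"
    using zero_le_power2[of D] by linarith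
  moreover have "\<gamma> * (merit P - merit P') =
      - (\<gamma> * (f u' - f u)) - \<gamma> * (gr v' - gr v) - (quad u' v' x' - quad u v x)"
    unfolding merit_def uvx P' using \<gamma> by (simp add: field_simps)
  moreover have "\<gamma> * (3 / \<gamma> * norm (v - u) * D + (\<bar>l\<bar> / 2 + 8 / \<gamma>) * D\<^sup>2) =
      3 * (norm (v - u) * D) + (\<gamma> * (\<bar>l\<bar> / 2) * D\<^sup>2 + 8 * D\<^sup>2)"
    using \<gamma> by (simp add: field_simps)
  ultimately have "\<gamma> * (merit P - merit P') \<le> \<gamma> * (3 / \<gamma> * norm (v - u) * D + (\<bar>l\<bar> / 2 + 8 / \<gamma>) * D\<^sup>2)"
    by simp
  then show ?thesis using \<gamma> unfolding D_def by (rule mult_left_le_imp_le)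
qed

text \<open>Two consecutive inputs differ by \<open>v - u\<close>, and each of them equals
  \<open>u + \<gamma> *\<^sub>R grad u\<close> at its own \<open>u\<close>.\<close>

lemma displacement:
  assumes "(u, v, x) \<in> Prox" "(u', v', x + (v - u)) \<in> Prox"
  shows "norm (v - u) \<le> (1 + \<gamma> * L) * norm (u' - u)"
proof -
  have \<delta>: "v - u = (u' - u) + \<gamma> *\<^sub>R (grad u' - grad u)"
    using Prox_grad[OF assms(1)] Prox_grad[OF assms(2)] by (simp add: algebra_simps)
  have "norm (v - u) \<le> norm (u' - u) + \<gamma> * norm (grad u' - grad u)"
    unfolding \<delta> using norm_triangle_ineq[of "u' - u" "\<gamma> *\<^sub>R (grad u' - grad u)"] \<gamma> by simp
  also have "\<gamma> * norm (grad u' - grad u) \<le> \<gamma> * (L * norm (u' - u))"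
    using L(2) \<gamma> by (intro mult_left_mono) auto
  finally show ?thesis by (simp add: algebra_simps)
qed

text \<open>The tangent bound for \<open>f\<close> is taken at the new point, and \<open>v\<close>
  is the competitor of \<open>v'\<close> in the new subproblem for \<open>g\<close>. With the change
  of \<open>quad\<close> added, everything cancels except a quadratic form in \<open>h\<close> and
  the scaled gradient increment \<open>d\<close>.\<close>

lemma merit_descent:
  assumes P: "(u, v, x) \<in> Prox" "(u', v', x + (v - u)) \<in> Prox"
  shows "rate * (norm (u' - u))\<^sup>2 \<le> \<gamma> * (merit (u, v, x) - merit (u', v', x + (v - u)))"
proof -
  define h d x' where "h = u' - u" and "d = \<gamma> *\<^sub>R (grad u' - grad u)" and "x' = x + (v - u)"
  note P2 = P(2)[folded x'_def]
  have u': "u' = u + h" by (simp add: h_def)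
  have \<delta>: "v = u + (h + d)"
    using Prox_grad[OF P(1)] Prox_grad[OF P(2)] by (simp add: h_def d_def algebra_simps)
  have "\<gamma> * (f u' - f u) \<le> (x' - u') \<bullet> h + \<gamma> * l / 2 * (norm h)\<^sup>2"
  proof -
    have "f u' - f u \<le> grad u' \<bullet> h + l / 2 * (norm h)\<^sup>2"
      using f_lower[of u' u] by (simp add: h_def norm_minus_commute inner_diff_right)
    then have "\<gamma> * (f u' - f u) \<le> \<gamma> * (grad u' \<bullet> h + l / 2 * (norm h)\<^sup>2)"
      using \<gamma> by (intro mult_left_mono) auto
    moreover have "\<gamma> * (grad u' \<bullet> h) = (x' - u') \<bullet> h" using Prox_grad[OF P2] by simp
    ultimately show ?thesis by (simp add: algebra_simps)
  qed
  moreover have "\<gamma> * (gr v' - gr v) \<le> 1 / 2 * (norm (v - \<alpha> *\<^sub>R u' + x'))\<^sup>2 - 1 / 2 * (norm (v' - \<alpha> *\<^sub>R u' + x'))\<^sup>2"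
    by (rule Prox_g_scaled[OF P2 Prox_gD(1)[OF P(1)]])
  moreover have "(x' - u') \<bullet> h + \<gamma> * l / 2 * (norm h)\<^sup>2 + (1 / 2 * (norm (v - \<alpha> *\<^sub>R u' + x'))\<^sup>2 - 1 / 2 * (norm (v' - \<alpha> *\<^sub>R u' + x'))\<^sup>2)
      + (quad u' v' x' - quad u v x) =
      (1 - \<alpha> + \<gamma> * l) / 2 * (norm h)\<^sup>2 + (2 - \<alpha>) * (h \<bullet> d) + (norm d)\<^sup>2"
    unfolding quad_def power2_norm_eq_inner x'_def u' \<delta>
    by (simp add: inner_simps inner_commute algebra_simps) (simp add: field_simps)
  moreover have "(2 - \<alpha>) * (h \<bullet> d) \<le> (2 - \<alpha>) * (\<gamma> * L) * (norm h)\<^sup>2"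
    and "(norm d)\<^sup>2 \<le> (\<gamma> * L)\<^sup>2 * (norm h)\<^sup>2"
  proof -
    have d: "norm d \<le> \<gamma> * L * norm h"
      using L(2)[of u' u] \<gamma> unfolding d_def h_def by (simp add: mult.assoc)
    have "h \<bullet> d \<le> norm h * (\<gamma> * L * norm h)"
      using norm_cauchy_schwarz[of h d] mult_left_mono[OF d, of "norm h"] by simp
    then have "(2 - \<alpha>) * (h \<bullet> d) \<le> (2 - \<alpha>) * (norm h * (\<gamma> * L * norm h))"
      using \<alpha> by (intro mult_left_mono) auto
    then show "(2 - \<alpha>) * (h \<bullet> d) \<le> (2 - \<alpha>) * (\<gamma> * L) * (norm h)\<^sup>2"
      by (simp add: power2_eq_square algebra_simps)
    show "(norm d)\<^sup>2 \<le> (\<gamma> * L)\<^sup>2 * (norm h)\<^sup>2"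
      using power_mono[OF d, of 2] by (simp add: power_mult_distrib)
  qed
  ultimately have "\<gamma> * (f u' - f u) + \<gamma> * (gr v' - gr v) + (quad u' v' x' - quad u v x) \<le> - rate * (norm h)\<^sup>2"
    unfolding rate_def by (simp add: algebra_simps)
  moreover have "\<gamma> * (merit (u, v, x) - merit (u', v', x')) =
      - (\<gamma> * (f u' - f u) + \<gamma> * (gr v' - gr v) + (quad u' v' x' - quad u v x))"
    unfolding merit_def using \<gamma> by (simp add: field_simps)
  ultimately show ?thesis by (simp add: x'_def h_def)
qed

end


section \<open>Limits of proximal points and convergence of the iterates\<close>

context parameterized_DR
begin

lemma continuous_f: "continuous_on UNIV f"
  using has_derivative_continuous[OF grad[unfolded gderiv_def]]
  by (simp add: continuous_at_imp_continuous_on)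

lemma continuous_grad: "continuous_on UNIV grad"
  unfolding continuous_on_iff
proof (intro ballI allI impI)
  fix y :: 'a and e :: real assume "0 < e"
  show "\<exists>d>0. \<forall>y'\<in>UNIV. dist y' y < d \<longrightarrow> dist (grad y') (grad y) < e"
  proof (intro exI[of _ "e / L"] conjI ballI impI)
    fix y' assume "dist y' y < e / L"
    then have "L * norm (y' - y) < e" using L(1) by (simp add: dist_norm field_simps)
    then show "dist (grad y') (grad y) < e" using L(2)[of y' y] by (simp add: dist_norm)
  qed (use L(1) \<open>0 < e\<close> in simp)
qed

text \<open>Lower semicontinuity gives only one inequality for the limit of \<open>gr (v j)\<close>;
  the other comes from the minimality of \<open>v j\<close>, with the limit \<open>v'\<close> itself
  as competitor. Finiteness of \<open>g v'\<close> has to be settled first, by a competitor at which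
  \<open>g\<close> is finite.\<close>

lemma Prox_limit:
  assumes P: "\<And>j. P j \<in> Prox" and lim: "P \<longlonglongrightarrow> Q"
  shows "Q \<in> Prox" "(\<lambda>j. merit (P j)) \<longlonglongrightarrow> merit Q"
proof -
  define u v x where "u j = fst (P j)" and "v j = fst (snd (P j))" and "x j = snd (snd (P j))" for j
  obtain u' v' x' where Q: "Q = (u', v', x')" by (cases Q)
  have Pj: "(u j, v j, x j) \<in> Prox" for j using P[of j] by (simp add: u_def v_def x_def)
  have u: "u \<longlonglongrightarrow> u'" and v: "v \<longlonglongrightarrow> v'" and x: "x \<longlonglongrightarrow> x'"
    using tendsto_fst[OF lim] tendsto_fst[OF tendsto_snd[OF lim]] tendsto_snd[OF tendsto_snd[OF lim]]
    by (simp_all add: Q u_def[abs_def] v_def[abs_def] x_def[abs_def])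
  have fu: "(\<lambda>j. f (u j)) \<longlonglongrightarrow> f u'"
    using continuous_f u by (auto simp: continuous_on_eq_continuous_at intro: isCont_tendsto_compose)
  \<comment> \<open>The upper bound for \<open>gr (v j)\<close> given by the competitor
    \<open>w\<close>; in the limit, \<open>B' v' = gr v'\<close>.\<close>
  define B where "B w j = gr w + 1 / (2 * \<gamma>) * (norm (w - \<alpha> *\<^sub>R u j + x j))\<^sup>2
    - 1 / (2 * \<gamma>) * (norm (v j - \<alpha> *\<^sub>R u j + x j))\<^sup>2" for w j
  define B' where "B' w = gr w + 1 / (2 * \<gamma>) * (norm (w - \<alpha> *\<^sub>R u' + x'))\<^sup>2
    - 1 / (2 * \<gamma>) * (norm (v' - \<alpha> *\<^sub>R u' + x'))\<^sup>2" for w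
  have B: "B w \<longlonglongrightarrow> B' w" for w
    unfolding B_def[abs_def] B'_def by (intro tendsto_intros u v x)
  have le: "gr (v j) \<le> B w j" if "g w \<noteq> \<infinity>" for w j
    using Prox_gD(2)[OF Pj that, of j] by (simp add: B_def)
  have gv: "g (v j) = ereal (gr (v j))" for j using Prox_gD(1)[OF Pj] by (rule g_real)
  have lower: "\<forall>\<^sub>F j in sequentially. s < gr (v j)" if "ereal s < g v'" for s
    using eventually_compose_filterlim[OF lsc[OF that] v] by (simp add: gv)
  have gle: "g v' \<le> ereal (B' w)" if "g w \<noteq> \<infinity>" for w
  proof (rule ccontr)
    assume "\<not> g v' \<le> ereal (B' w)"
    then obtain s where s: "ereal (B' w) < ereal s" "ereal s < g v'" using ereal_dense2 by (metis not_le)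
    have "s \<le> B' w"
      by (rule tendsto_lowerbound[OF B, of s]) (use lower[OF s(2)] le[OF that] in \<open>auto elim!: eventually_mono intro: less_imp_le less_le_trans\<close>)
    then show False using s(1) by simp
  qed
  obtain w0 where "g w0 \<noteq> \<infinity>" using proper by (auto simp: proper_fun_def)
  from gle[OF this] have fin: "g v' \<noteq> \<infinity>" by auto
  have "(u', v', x') \<in> Prox"
  proof (rule ProxI)
    fix w
    show "f u' + 1 / (2 * \<gamma>) * (norm (u' - x'))\<^sup>2 \<le> f w + 1 / (2 * \<gamma>) * (norm (w - x'))\<^sup>2"
    proof (rule LIMSEQ_le)
      show "(\<lambda>j. f (u j) + 1 / (2 * \<gamma>) * (norm (u j - x j))\<^sup>2) \<longlonglongrightarrow> f u' + 1 / (2 * \<gamma>) * (norm (u' - x'))\<^sup>2"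
        by (intro tendsto_intros fu u x)
      show "(\<lambda>j. f w + 1 / (2 * \<gamma>) * (norm (w - x j))\<^sup>2) \<longlonglongrightarrow> f w + 1 / (2 * \<gamma>) * (norm (w - x'))\<^sup>2"
        by (intro tendsto_intros x)
    qed (use Prox_fD[OF Pj] in blast)
  next
    fix w assume "g w \<noteq> \<infinity>"
    from gle[OF this] show "gr v' + 1 / (2 * \<gamma>) * (norm (v' - \<alpha> *\<^sub>R u' + x'))\<^sup>2 \<le>
      gr w + 1 / (2 * \<gamma>) * (norm (w - \<alpha> *\<^sub>R u' + x'))\<^sup>2"
      using g_real[OF fin] by (simp add: B'_def)
  qed (rule fin)
  then show "Q \<in> Prox" by (simp add: Q)
  have "(\<lambda>j. gr (v j)) \<longlonglongrightarrow> gr v'"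
  proof (rule order_tendstoI)
    fix a assume "a < gr v'"
    then show "\<forall>\<^sub>F j in sequentially. a < gr (v j)" by (intro lower) (simp add: g_real[OF fin])
  next
    fix a assume "gr v' < a"
    then have "B' v' < a" by (simp add: B'_def)
    from order_tendstoD(2)[OF B this] show "\<forall>\<^sub>F j in sequentially. gr (v j) < a"
      by eventually_elim (use le[OF fin] in \<open>blast intro: le_less_trans\<close>)
  qed
  then have "(\<lambda>j. f (u j) + gr (v j) + quad (u j) (v j) (x j) / \<gamma>) \<longlonglongrightarrow> f u' + gr v' + quad u' v' x' / \<gamma>"
    unfolding quad_def using \<gamma> by (intro tendsto_intros fu u v x) auto
  then show "(\<lambda>j. merit (P j)) \<longlonglongrightarrow> merit Q"
    by (simp add: merit_def Q u_def v_def x_def case_prod_beta)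
qed

text \<open>Closedness is \<open>Prox_limit\<close>: membership in \<open>Prox\<close> and the value
  of \<open>merit\<close> both pass to the limit.\<close>

lemma compact_level:
  "compact {P \<in> Prox \<inter> cball Q 1. merit P - c = r}"
  unfolding compact_eq_bounded_closed
proof
  show "bounded {P \<in> Prox \<inter> cball Q 1. merit P - c = r}"
    by (rule bounded_subset[OF bounded_cball[of Q 1]]) auto
  show "closed {P \<in> Prox \<inter> cball Q 1. merit P - c = r}"
    unfolding closed_sequential_limits
  proof (intro allI impI, elim conjE)
    fix P R assume P: "\<forall>j. P j \<in> {P \<in> Prox \<inter> cball Q 1. merit P - c = r}" and lim: "P \<longlonglongrightarrow> R"
    then have "R \<in> Prox" "(\<lambda>j. merit (P j)) \<longlonglongrightarrow> merit R" using Prox_limit[OF _ lim] by auto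
    moreover have "(\<lambda>j. merit (P j)) = (\<lambda>j. r + c)" using P by (auto simp: fun_eq_iff)
    ultimately have "merit R = r + c" by (simp add: LIMSEQ_const_iff)
    moreover have "R \<in> cball Q 1"
      using closed_sequentially[OF closed_cball _ lim, of Q 1] P by auto
    ultimately show "R \<in> {P \<in> Prox \<inter> cball Q 1. merit P - c = r}" using \<open>R \<in> Prox\<close> by simp
  qed
qed

text \<open>The values of \<open>f\<close> and \<open>g\<close> enter only through their graphs:
  \<open>a\<close> and \<open>b\<close> are quantified, and the two minimality conditions become
  universal quantifiers over graph points. Finiteness of \<open>g\<close> is encoded by
  \<open>b\<close> being real.\<close>

lemma semialgebraic_level:
  "semialgebraic {(r, P). P \<in> Prox \<inter> cball Q 1 \<and> merit P - c = r}"
proof -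
  let ?Gf = "{(x, r). ereal (f x) = ereal r}" and ?Gg = "{(x, r). g x = ereal r}"
  define S where "S = {z :: real \<times> 'a \<times> 'a \<times> 'a. \<exists>a b. (fst (snd z), a) \<in> ?Gf \<and> (fst (snd (snd z)), b) \<in> ?Gg \<and>
    (\<forall>w a'. (w, a') \<in> ?Gf \<longrightarrow>
      a + 1 / (2 * \<gamma>) * (norm (fst (snd z) - snd (snd (snd z))))\<^sup>2 \<le> a' + 1 / (2 * \<gamma>) * (norm (w - snd (snd (snd z))))\<^sup>2) \<and>
    (\<forall>w b'. (w, b') \<in> ?Gg \<longrightarrow>
      b + 1 / (2 * \<gamma>) * (norm (fst (snd (snd z)) - \<alpha> *\<^sub>R fst (snd z) + snd (snd (snd z))))\<^sup>2 \<le>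
      b' + 1 / (2 * \<gamma>) * (norm (w - \<alpha> *\<^sub>R fst (snd z) + snd (snd (snd z))))\<^sup>2) \<and>
    (norm (snd z - Q))\<^sup>2 \<le> 1 \<and>
    a + b + (1 / \<gamma>) * quad (fst (snd z)) (fst (snd (snd z))) (snd (snd (snd z))) - c = fst z}"
  have "semialgebraic S"
    unfolding S_def quad_def
    by (intro sa_intros sa_f[unfolded semialgebraic_fun_def] sa_g[unfolded semialgebraic_fun_def] pf_intros)
  moreover have "{(r, P). P \<in> Prox \<inter> cball Q 1 \<and> merit P - c = r} = S"
  proof (intro set_eqI iffI)
    fix z assume z: "z \<in> {(r, P). P \<in> Prox \<inter> cball Q 1 \<and> merit P - c = r}"
    obtain r u v x where zz: "z = (r, u, v, x)" by (cases z)
    have P: "(u, v, x) \<in> Prox" "norm ((u, v, x) - Q) \<le> 1" "merit (u, v, x) - c = r"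
      using z by (auto simp: zz dist_norm norm_minus_commute)
    show "z \<in> S"
      unfolding S_def zz
    proof (rule CollectI, unfold fst_conv snd_conv, rule exI[of _ "f u"], rule exI[of _ "gr v"], intro conjI allI impI)
      show "(u, f u) \<in> ?Gf" by simp
      show "(v, gr v) \<in> ?Gg" using g_real[OF Prox_gD(1)[OF P(1)]] by simp
      fix w a'
      show "f u + 1 / (2 * \<gamma>) * (norm (u - x))\<^sup>2 \<le> a' + 1 / (2 * \<gamma>) * (norm (w - x))\<^sup>2"
        if "(w, a') \<in> ?Gf"
        using Prox_fD[OF P(1), of w] that by simp
      show "gr v + 1 / (2 * \<gamma>) * (norm (v - \<alpha> *\<^sub>R u + x))\<^sup>2 \<le> a' + 1 / (2 * \<gamma>) * (norm (w - \<alpha> *\<^sub>R u + x))\<^sup>2"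
        if "(w, a') \<in> ?Gg"
        using Prox_gD(2)[OF P(1), of w] that by (simp add: gr_def)
    next
      show "(norm ((u, v, x) - Q))\<^sup>2 \<le> 1" using P(2) by (simp add: abs_square_le_1)
      show "f u + gr v + 1 / \<gamma> * quad u v x - c = r" using P(3) by (simp add: merit_def)
    qed
  next
    fix z assume z: "z \<in> S"
    obtain r u v x where zz: "z = (r, u, v, x)" by (cases z)
    from z obtain b where b: "g v = ereal b"
      "\<And>w. f u + 1 / (2 * \<gamma>) * (norm (u - x))\<^sup>2 \<le> f w + 1 / (2 * \<gamma>) * (norm (w - x))\<^sup>2"
      "\<And>w b'. g w = ereal b' \<Longrightarrow> b + 1 / (2 * \<gamma>) * (norm (v - \<alpha> *\<^sub>R u + x))\<^sup>2 \<le>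
          b' + 1 / (2 * \<gamma>) * (norm (w - \<alpha> *\<^sub>R u + x))\<^sup>2"
      "(norm ((u, v, x) - Q))\<^sup>2 \<le> 1" "f u + b + (1 / \<gamma>) * quad u v x - c = r"
      unfolding S_def zz by auto
    have gr: "gr v = b" using b(1) by (simp add: gr_def)
    have "(u, v, x) \<in> Prox"
      by (rule ProxI[OF b(2)]) (use b(1) b(3)[OF g_real] gr in auto)
    moreover have "norm ((u, v, x) - Q) \<le> 1" using b(4) by (simp add: abs_square_le_1)
    ultimately show "z \<in> {(r, P). P \<in> Prox \<inter> cball Q 1 \<and> merit P - c = r}"
      using b(5) gr by (auto simp: zz merit_def dist_norm norm_minus_commute)
  qed
  ultimately show ?thesis by simp
qed

theorem iteration_convergent:
  assumes iter: "param_DR_iteration f g \<alpha> \<gamma> u v x"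
    and cluster: "cluster_point (\<lambda>t. (u t, v t, x t)) z"
  shows "convergent (\<lambda>t. (u t, v t, x t))"
proof -
  define P where "P t = (u (Suc t), v (Suc t), x t)" for t
  have P: "P t \<in> Prox" and x: "x (Suc t) = x t + (v (Suc t) - u (Suc t))" for t
    using iter unfolding param_DR_iteration_def Prox_def P_def by auto
  define h \<delta> where "h t = norm (u (Suc (Suc t)) - u (Suc t))" and "\<delta> t = norm (v (Suc t) - u (Suc t))" for t
  have P': "(u (Suc (Suc t)), v (Suc (Suc t)), x t + (v (Suc t) - u (Suc t))) \<in> Prox" for t
    using P[of "Suc t"] by (simp add: P_def x)
  have desc: "rate * (h t)\<^sup>2 \<le> \<gamma> * (merit (P t) - merit (P (Suc t)))" for t
    using merit_descent[OF P[of t, unfolded P_def] P'] by (simp add: h_def P_def x)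
  have disp: "\<delta> t \<le> (1 + \<gamma> * L) * h t" for t
    using displacement[OF P[of t, unfolded P_def] P'] by (simp add: h_def \<delta>_def)
  have xu: "x t = u (Suc t) + \<gamma> *\<^sub>R grad (u (Suc t))" for t
    using Prox_grad[OF P[of t, unfolded P_def]] .
  have "merit (P (Suc t)) \<le> merit (P t)" for t
  proof -
    have "0 \<le> \<gamma> * (merit (P t) - merit (P (Suc t)))"
      using desc[of t] rate_pos by (meson order.trans mult_nonneg_nonneg less_imp_le zero_le_power2)
    then show ?thesis using \<gamma> by (simp add: zero_le_mult_iff)
  qed
  then have dec: "decseq (\<lambda>t. merit (P t))" by (rule decseq_SucI)
  obtain r where r: "strict_mono r" "((\<lambda>t. (u t, v t, x t)) \<circ> r) \<longlonglongrightarrow> z"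
    using cluster unfolding cluster_point_def by blast
  \<comment> \<open>The triple \<open>P (s j)\<close> contains \<open>u\<close> and \<open>v\<close>
    at index \<open>r (Suc j)\<close>. Taking \<open>Suc j\<close> makes this index positive, which
    also avoids the arbitrary \<open>u 0\<close> and \<open>v 0\<close>.\<close>
  define s where "s j = r (Suc j) - 1" for j
  have r1: "Suc (s j) = r (Suc j)" for j
    using seq_suble[OF r(1), of "Suc j"] by (simp add: s_def)
  have s: "strict_mono s"
    unfolding strict_mono_Suc_iff
  proof
    fix j show "s j < s (Suc j)"
      using r1[of j] r1[of "Suc j"] strict_monoD[OF r(1), of "Suc j" "Suc (Suc j)"] by linarith
  qed
  obtain u' v' x' where z: "z = (u', v', x')" by (cases z)
  have lim: "(\<lambda>j. (u (r (Suc j)), v (r (Suc j)), x (r (Suc j)))) \<longlonglongrightarrow> (u', v', x')"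
    using LIMSEQ_Suc[OF r(2)] by (simp add: z o_def)
  have us: "(\<lambda>j. u (Suc (s j))) \<longlonglongrightarrow> u'" and vs: "(\<lambda>j. v (Suc (s j))) \<longlonglongrightarrow> v'"
    and xs: "(\<lambda>j. x (Suc (s j))) \<longlonglongrightarrow> x'"
    using tendsto_fst[OF lim] tendsto_fst[OF tendsto_snd[OF lim]] tendsto_snd[OF tendsto_snd[OF lim]]
    by (simp_all add: r1)
  \<comment> \<open>\<open>P\<close> holds the previous \<open>x\<close>, hence the last entry is
    the limit of \<open>x\<close> moved back by \<open>v' - u'\<close>.\<close>
  define Q where "Q = (u', v', x' - (v' - u'))"
  have "(\<lambda>j. x (s j)) \<longlonglongrightarrow> x' - (v' - u')"
    using tendsto_diff[OF xs tendsto_diff[OF vs us]] by (simp add: x)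
  then have PQ: "(\<lambda>j. P (s j)) \<longlonglongrightarrow> Q"
    unfolding P_def Q_def by (intro tendsto_intros us vs)
  note Q = Prox_limit[OF P PQ]
  define c where "c = merit Q"
  have lower: "c \<le> merit (P t)" for t
  proof (rule LIMSEQ_le_const2[OF Q(2)[folded c_def]])
    show "\<exists>N. \<forall>j\<ge>N. merit (P (s j)) \<le> merit (P t)"
    proof (intro exI allI impI)
      fix j assume "t \<le> j"
      then have "t \<le> s j" using seq_suble[OF s, of j] by simp
      then show "merit (P (s j)) \<le> merit (P t)" using decseqD[OF dec] by blast
    qed
  qed
  have mlim: "(\<lambda>t. merit (P t)) \<longlonglongrightarrow> c"
  proof -
    obtain c' where c': "(\<lambda>t. merit (P t)) \<longlonglongrightarrow> c'" using decseq_convergent[OF dec] lower by blast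
    from LIMSEQ_subseq_LIMSEQ[OF this s] have "(\<lambda>j. merit (P (s j))) \<longlonglongrightarrow> c'" by (simp add: o_def)
    then have "c' = c" using Q(2) LIMSEQ_unique unfolding c_def by blast
    with c' show ?thesis by simp
  qed
  have h0: "h \<longlonglongrightarrow> 0"
  proof -
    have "(\<lambda>t. \<gamma> * (merit (P t) - merit (P (Suc t))) / rate) \<longlonglongrightarrow> \<gamma> * (c - c) / rate"
      by (intro tendsto_intros mlim LIMSEQ_Suc[OF mlim]) (use rate_pos in auto)
    then have 0: "(\<lambda>t. \<gamma> * (merit (P t) - merit (P (Suc t))) / rate) \<longlonglongrightarrow> 0" by simp
    have "(\<lambda>t. (h t)\<^sup>2) \<longlonglongrightarrow> 0"
    proof (rule tendsto_sandwich[OF _ _ tendsto_const 0])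
      show "\<forall>\<^sub>F t in sequentially. (h t)\<^sup>2 \<le> \<gamma> * (merit (P t) - merit (P (Suc t))) / rate"
        using desc rate_pos by (simp add: pos_le_divide_eq mult.commute)
    qed simp
    moreover have "sqrt ((h t)\<^sup>2) = h t" for t by (simp add: h_def)
    ultimately show ?thesis using tendsto_real_sqrt by fastforce
  qed
  have \<delta>0: "\<delta> \<longlonglongrightarrow> 0"
  proof (rule tendsto_sandwich[of "\<lambda>_. 0" _ _ "\<lambda>t. (1 + \<gamma> * L) * h t"])
    show "(\<lambda>t. (1 + \<gamma> * L) * h t) \<longlonglongrightarrow> 0" using tendsto_mult_left[OF h0, of "1 + \<gamma> * L"] by simp
  qed (use disp in \<open>auto simp: \<delta>_def\<close>)
  have "v' = u'"
  proof -
    have "(\<lambda>j. \<delta> (s j)) \<longlonglongrightarrow> norm (v' - u')" unfolding \<delta>_def by (intro tendsto_intros us vs)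
    moreover have "(\<lambda>j. \<delta> (s j)) \<longlonglongrightarrow> 0" using LIMSEQ_subseq_LIMSEQ[OF \<delta>0 s] by (simp add: o_def)
    ultimately show ?thesis using LIMSEQ_unique by fastforce
  qed
  then have Q_eq: "Q = (u', u', u' + \<gamma> *\<^sub>R grad u')"
    using Prox_grad[of u' v' "x' - (v' - u')"] Q(1) by (simp add: Q_def)
  obtain \<epsilon> \<phi> where KL: "0 < \<epsilon>" "mono_on {0<..<\<epsilon>} \<phi>" "bounded (\<phi> ` {0<..<\<epsilon>})"
    "\<And>p s. p \<in> Prox \<inter> cball Q 1 \<Longrightarrow> merit p - c < \<epsilon> \<Longrightarrow> 0 < s \<Longrightarrow> s < merit p - c \<Longrightarrow>
      merit p - c - s \<le> sqrt ((norm (fst (snd p) - fst p))\<^sup>2) * (\<phi> (merit p - c) - \<phi> s)"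
  proof (rule semialgebraic_KL[of "Prox \<inter> cball Q 1" "\<lambda>p. merit p - c" "\<lambda>p. (norm (fst (snd p) - fst p))\<^sup>2"
        "3 / \<gamma>" "\<bar>l\<bar> / 2 + 8 / \<gamma>"])
    show "semialgebraic {(r, p). p \<in> Prox \<inter> cball Q 1 \<and> merit p - c = r}" by (rule semialgebraic_level)
    show "compact {p \<in> Prox \<inter> cball Q 1. merit p - c = r}" for r by (rule compact_level)
    show "bounded (Prox \<inter> cball Q 1)" by (rule bounded_subset[OF bounded_cball]) auto
    show "polynomial_function (\<lambda>p :: 'a \<times> 'a \<times> 'a. (norm (fst (snd p) - fst p))\<^sup>2)" by (intro pf_intros)
    show "merit p - c - (merit p' - c) \<le> 3 / \<gamma> * sqrt ((norm (fst (snd p) - fst p))\<^sup>2) * norm (p - p')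
      + (\<bar>l\<bar> / 2 + 8 / \<gamma>) * (norm (p - p'))\<^sup>2" if "p \<in> Prox \<inter> cball Q 1" "p' \<in> Prox \<inter> cball Q 1" for p p'
      using merit_slope[of p p' "fst p" "fst (snd p)" "snd (snd p)"] that by simp
  qed (use \<gamma> in auto)
  \<comment> \<open>\<open>KL\<close> speaks only of values above \<open>c\<close>. If the limit
    value is attained, descent forces all later steps to be zero.\<close>
  have "convergent (\<lambda>t. u (Suc t))"
  proof (cases "\<exists>T. merit (P T) = c")
    case True
    then obtain T where T: "merit (P T) = c" by blast
    have "merit (P t) = c" if "t \<ge> T" for t
      using decseqD[OF dec that] lower[of t] T by simp
    then have "rate * (h t)\<^sup>2 \<le> 0" if "t \<ge> T" for t
      using desc[of t] that by simp
    then have hz: "h t = 0" if "t \<ge> T" for t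
      using that rate_pos by (auto simp: mult_le_0_iff not_le[symmetric])
    have "u (Suc (t + T)) = u (Suc T)" for t
      by (induction t) (use hz in \<open>auto simp: h_def\<close>)
    then have "convergent (\<lambda>t. u (Suc (t + T)))" by (simp add: convergent_const)
    then show ?thesis using convergent_ignore_initial_segment[of "\<lambda>t. u (Suc t)" T] by simp
  next
    case False
    then have gt: "c < merit (P t)" for t using lower[of t] by (metis order_le_less)
    define F where "F t = merit (P t) - c" for t
    \<comment> \<open>Chosen so that \<open>(3 + \<gamma> * L) * \<rho> = 1 / 2\<close>. The
      distance of \<open>P t\<close> from \<open>Q\<close> is at most
      \<open>(3 + \<gamma> * L) * norm (u (Suc t) - u') + \<delta> t\<close>, and
      \<open>\<delta> t < 1 / 2\<close> for late \<open>t\<close>, so \<open>P t\<close> lies in the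
      unit ball around \<open>Q\<close>.\<close>
    define \<rho> where "\<rho> = 1 / (2 * (3 + \<gamma> * L))"
    have \<gamma>L: "0 < \<gamma> * L" using \<gamma> L(1) by simp
    have \<rho>: "0 < \<rho>" using \<gamma>L by (simp add: \<rho>_def)
    have "\<forall>\<^sub>F t in sequentially. merit (P t) < c + \<epsilon> \<and> \<delta> t < 1 / 2"
      using order_tendstoD(2)[OF mlim, of "c + \<epsilon>"] order_tendstoD(2)[OF \<delta>0, of "1 / 2"] KL(1)
      by (intro eventually_conj) auto
    then obtain T where T: "\<And>t. t \<ge> T \<Longrightarrow> merit (P t) < c + \<epsilon>" "\<And>t. t \<ge> T \<Longrightarrow> \<delta> t < 1 / 2"
      unfolding eventually_sequentially by blast
    have F: "F t \<in> {0<..<\<epsilon>}" if "t \<ge> T" for t using gt[of t] T(1)[OF that] by (simp add: F_def)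
    have Fdec: "F (Suc t) \<le> F t" for t using decseqD[OF dec, of t "Suc t"] by (simp add: F_def)
    define C where "C = \<gamma> * (1 + \<gamma> * L) / rate"
    have C: "0 \<le> C" using \<gamma> \<gamma>L rate_pos by (simp add: C_def)
    obtain B where B: "\<And>r. r \<in> {0<..<\<epsilon>} \<Longrightarrow> \<bar>\<phi> r\<bar> \<le> B"
      using KL(3) unfolding bounded_iff by (metis imageI real_norm_def)
    have \<phi>dec: "\<phi> (F (Suc t)) \<le> \<phi> (F t)" if "t \<ge> T" for t
      by (rule mono_onD[OF KL(2)]) (use F[OF that] F[of "Suc t"] Fdec that in auto)
    \<comment> \<open>Descent bounds the square of \<open>h\<close> by the drop of \<open>F\<close>,
      \<open>KL\<close> with \<open>s = F (Suc t)\<close> bounds that by \<delta> times the drop of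
      \<phi>, and \<open>disp\<close> bounds \<delta> by \<open>h\<close>; one factor
      \<open>h\<close> cancels. As \<open>KL\<close> demands \<open>s < F t\<close>, equal values
      form a case of their own.\<close>
    have step: "h t \<le> C * (\<phi> (F t) - \<phi> (F (Suc t)))" if t: "t \<ge> T" and near: "norm (u (Suc t) - u') < \<rho>" for t
    proof (cases "F (Suc t) = F t")
      case True
      then have "rate * (h t)\<^sup>2 \<le> 0" using desc[of t] by (simp add: F_def)
      then have "h t = 0" using rate_pos by (auto simp: mult_le_0_iff not_le[symmetric])
      then show ?thesis using C \<phi>dec[OF t] by simp
    next
      case False
      then have Flt: "F (Suc t) < F t" using Fdec[of t] by simp
      have "norm (P t - Q) \<le> norm (u (Suc t) - u') + norm (v (Suc t) - u') + norm (x t - (u' + \<gamma> *\<^sub>R grad u'))"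
        unfolding P_def Q_eq
        using norm_Pair_le[of "u (Suc t) - u'" "(v (Suc t) - u', x t - (u' + \<gamma> *\<^sub>R grad u'))"]
          norm_Pair_le[of "v (Suc t) - u'" "x t - (u' + \<gamma> *\<^sub>R grad u')"] by simp
      also have "norm (v (Suc t) - u') \<le> \<delta> t + norm (u (Suc t) - u')"
        using norm_triangle_ineq[of "v (Suc t) - u (Suc t)" "u (Suc t) - u'"] by (simp add: \<delta>_def)
      also have "norm (x t - (u' + \<gamma> *\<^sub>R grad u')) \<le> (1 + \<gamma> * L) * norm (u (Suc t) - u')"
      proof -
        have eq: "x t - (u' + \<gamma> *\<^sub>R grad u') = (u (Suc t) - u') + \<gamma> *\<^sub>R (grad (u (Suc t)) - grad u')"
          by (simp add: xu algebra_simps)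
        have "norm (x t - (u' + \<gamma> *\<^sub>R grad u')) \<le> norm (u (Suc t) - u') + \<gamma> * norm (grad (u (Suc t)) - grad u')"
          unfolding eq using norm_triangle_ineq[of "u (Suc t) - u'" "\<gamma> *\<^sub>R (grad (u (Suc t)) - grad u')"] \<gamma> by simp
        also have "\<gamma> * norm (grad (u (Suc t)) - grad u') \<le> \<gamma> * (L * norm (u (Suc t) - u'))"
          using L(2) \<gamma> by (intro mult_left_mono) auto
        finally show ?thesis by (simp add: algebra_simps)
      qed
      finally have "norm (P t - Q) \<le> (3 + \<gamma> * L) * norm (u (Suc t) - u') + \<delta> t" by (simp add: algebra_simps)
      also have "(3 + \<gamma> * L) * norm (u (Suc t) - u') \<le> (3 + \<gamma> * L) * \<rho>"
        using near \<gamma>L by (intro mult_left_mono) auto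
      also have "(3 + \<gamma> * L) * \<rho> = 1 / 2" using \<gamma>L by (simp add: \<rho>_def)
      finally have "P t \<in> Prox \<inter> cball Q 1"
        using T(2)[OF t] P by (simp add: dist_norm norm_minus_commute)
      from KL(4)[OF this, of "F (Suc t)"] F[OF t] F[of "Suc t"] t Flt
      have "F t - F (Suc t) \<le> \<delta> t * (\<phi> (F t) - \<phi> (F (Suc t)))"
        by (simp add: F_def P_def \<delta>_def)
      also have "\<dots> \<le> (1 + \<gamma> * L) * h t * (\<phi> (F t) - \<phi> (F (Suc t)))"
        using disp[of t] \<phi>dec[OF t] by (intro mult_right_mono) auto
      finally have "\<gamma> * (F t - F (Suc t)) \<le> \<gamma> * ((1 + \<gamma> * L) * h t * (\<phi> (F t) - \<phi> (F (Suc t))))"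
        using \<gamma> by (intro mult_left_mono) auto
      then have "rate * (h t)\<^sup>2 \<le> \<gamma> * ((1 + \<gamma> * L) * h t * (\<phi> (F t) - \<phi> (F (Suc t))))"
        using desc[of t] by (simp add: F_def)
      then have *: "h t * (rate * h t) \<le> h t * (\<gamma> * (1 + \<gamma> * L) * (\<phi> (F t) - \<phi> (F (Suc t))))"
        by (simp add: power2_eq_square algebra_simps)
      show ?thesis
      proof (cases "h t = 0")
        case True
        then show ?thesis using C \<phi>dec[OF t] by simp
      next
        case False
        then have "h t > 0" by (simp add: h_def)
        with * have "rate * h t \<le> \<gamma> * (1 + \<gamma> * L) * (\<phi> (F t) - \<phi> (F (Suc t)))" by simp
        then show ?thesis using rate_pos by (simp add: C_def field_simps)
      qed
    qed
    \<comment> \<open>The estimates hold from \<open>T\<close> on, so the sequence is cut there.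
      Since \<open>s (k + T)\<close> is at least \<open>T\<close>, the subtraction is exact.\<close>
    define j where "j k = s (k + T) - T" for k
    have sT: "s (k + T) = j k + T" for k using seq_suble[OF s, of "k + T"] by (simp add: j_def)
    have "convergent (\<lambda>t. u (Suc (t + T)))"
    proof (rule convergent_of_trapped_cluster[of j _ u' "\<lambda>t. C * \<phi> (F (t + T))" "C * - B" \<rho>])
      show "strict_mono j"
        unfolding strict_mono_Suc_iff
      proof
        fix k show "j k < j (Suc k)"
          using sT[of k] sT[of "Suc k"] strict_monoD[OF s, of "k + T" "Suc k + T"] by linarith
      qed
      show "((\<lambda>t. u (Suc (t + T))) \<circ> j) \<longlonglongrightarrow> u'"
        using LIMSEQ_ignore_initial_segment[OF us, of T] by (simp add: o_def sT)
      show "C * \<phi> (F (Suc t + T)) \<le> C * \<phi> (F (t + T))" for t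
        using \<phi>dec[of "t + T"] C by (simp add: mult_left_mono)
      show "C * - B \<le> C * \<phi> (F (t + T))" for t
        using B[OF F[of "t + T"]] C by (intro mult_left_mono) auto
      show "norm (u (Suc (Suc t + T)) - u (Suc (t + T))) \<le> C * \<phi> (F (t + T)) - C * \<phi> (F (Suc t + T))"
        if "norm (u (Suc (t + T)) - u') < \<rho>" for t
        using step[of "t + T"] that by (simp add: h_def right_diff_distrib)
    qed (rule \<rho>)
    then show ?thesis using convergent_ignore_initial_segment[of "\<lambda>t. u (Suc t)" T] by simp
  qed
  then obtain w where w: "(\<lambda>t. u (Suc t)) \<longlonglongrightarrow> w" by (auto simp: convergent_def)
  \<comment> \<open>\<open>x\<close> follows from \<open>u\<close> by the first-order condition, and
    \<open>v\<close> from \<open>u\<close> and the increments of \<open>x\<close>, which tend to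
    0.\<close>
  have "(\<lambda>t. grad (u (Suc t))) \<longlonglongrightarrow> grad w"
    using continuous_grad w by (auto simp: continuous_on_eq_continuous_at intro: isCont_tendsto_compose)
  then have xlim: "x \<longlonglongrightarrow> w + \<gamma> *\<^sub>R grad w"
    unfolding xu[abs_def] by (intro tendsto_intros w)
  have "(\<lambda>t. u (Suc t) + (x (Suc t) - x t)) \<longlonglongrightarrow> w + ((w + \<gamma> *\<^sub>R grad w) - (w + \<gamma> *\<^sub>R grad w))"
    by (intro tendsto_intros w LIMSEQ_Suc[OF xlim] xlim)
  then have v: "(\<lambda>t. v (Suc t)) \<longlonglongrightarrow> w" by (simp add: x)
  have "(\<lambda>t. (u t, v t, x t)) \<longlonglongrightarrow> (w, w, w + \<gamma> *\<^sub>R grad w)"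
    using w v xlim by (intro tendsto_Pair) (simp_all only: filterlim_sequentially_Suc)
  then show ?thesis by (rule convergentI)
qed

end

theorem theorem3p7:
  fixes f :: "real ^ 'n \<Rightarrow> real"
    and grad_f :: "real ^ 'n \<Rightarrow> real ^ 'n"
    and g :: "real ^ 'n \<Rightarrow> ereal"
    and L l \<alpha> \<gamma> :: real
    and u v x :: "nat \<Rightarrow> real ^ 'n"
  assumes "\<And>y. GDERIV f y :> grad_f y"
    and "L > 0"
    and "\<And>y1 y2. norm (grad_f y1 - grad_f y2) \<le> L * norm (y1 - y2)"
    and "convex_on UNIV (\<lambda>y. f y + l / 2 * (norm y)\<^sup>2)"
    and "proper_fun g" and "closed_fun g"
    and "\<And>(z :: real ^ 'n) (\<mu> :: real). \<mu> > 0 \<Longrightarrow>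
           argmin_set (\<lambda>y. g y + ereal (1 / (2 * \<mu>) * (norm (y - z))\<^sup>2)) \<noteq> {}"
    and "0 < \<alpha>" and "\<alpha> \<le> 2"
    and "\<gamma> > 0"
    and "(4 - \<alpha>) / 2 * (1 + \<gamma> * L)\<^sup>2 + (9 - 2 * \<alpha>) / 2 * (\<gamma> * l) - (1 + \<alpha>) / 2 < 0"
    and "semialgebraic_fun (\<lambda>y. ereal (f y))"
    and "semialgebraic_fun g"
    and "param_DR_iteration f g \<alpha> \<gamma> u v x"
    and "\<exists>z. cluster_point (\<lambda>t. (u t, v t, x t)) z"
  shows "convergent (\<lambda>t. (u t, v t, x t))"
proof -
  interpret parameterized_DR f grad_f g L l \<alpha> \<gamma>
    using assms(1-6,8-13) by unfold_locales
  show ?thesis using assms(14,15) iteration_convergent by blast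
qed

end
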